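(* Let $n\ge 2$, let $1<s\le\infty$, let $\Omega\in L^s(S^{n-1})$ be homogeneous of degree zero on $\mathbb R^n$, and let $b\in BMO(\mathbb R^n)$. Let $0<\alpha<n$, $1\le s'<p<n/\alpha$, $1/q=1/p-\alpha/n$, $0<\kappa<p/q$, and let $w$ be a weight on $\mathbb R^n$ with $w^{s'}\in A(p/s',q/s')$. Then the commutator $$[b,T_{\Omega,\alpha}](f)(x)=b(x)T_{\Omega,\alpha}f(x)-T_{\Omega,\alpha}(bf)(x)=\int_{\mathbb R^n}\frac{\Omega(x-y)}{|x-y|^{n-\alpha}}[b(x)-b(y)]f(y)\,dy$$ is bounded from $L^{p,\kappa}(w^p,w^q)$ to $L^{q,\kappa q/p}(w^q)$; that is, there is a constant $C>0$ such that $\|[b,T_{\Omega,\alpha}](f)\|_{L^{q,\kappa q/p}(w^q)}\le C\|f\|_{L^{p,\kappa}(w^p,w^q)}$ for all $f\in L^{p,\kappa}(w^p,w^q)$.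
   Context: Notation: $S^{n-1}$ is the unit sphere of $\mathbb R^n$ with normalized Lebesgue measure $d\sigma$; $y'=y/|y|$ for $y\ne 0$; $\Omega$ homogeneous of degree zero means $\Omega(\lambda x)=\Omega(x)$ for all $\lambda>0$, $x\neq 0$, and $\Omega\in L^s(S^{n-1})$ refers to its restriction to $S^{n-1}$. Here $s'=s/(s-1)$ if $1<s<\infty$ and $s'=1$ if $s=\infty$. The fractional integral operator with rough kernel is $$T_{\Omega,\alpha}f(x)=\int_{\mathbb R^n}\frac{\Omega(y')}{|y|^{n-\alpha}}f(x-y)\,dy.$$ A weight is a nonnegative locally integrable function on $\mathbb R^n$. For a weight $v$ and a ball $B$, $v(B)=\int_B v(x)\,dx$, and $|B|$ is the Lebesgue measure of $B$. A locally integrable function $b$ is in $BMO(\mathbb R^n)$ if $\|b\|_*=\sup_B\frac1{|B|}\int_B|b(x)-b_B|\,dx<\infty$, where $b_B=\frac1{|B|}\int_B b(y)\,dy$ and the supremum is over all balls $B$ in $\mathbb R^n$. Class $A(p,q)$: for $1<p<q<\infty$, a weight $w$ belongs to $A(p,q)$ if there is $C>0$ such that for every ball $B\subseteq\mathbb R^n$, $$\left(\frac1{|B|}\int_B w(x)^q\,dx\right)^{1/q}\left(\frac1{|B|}\int_B w(x)^{-p'}\,dx\right)^{1/p'}\le C,$$ where $p'=p/(p-1)$. Weighted Morrey spaces: for $1\le p<\infty$, $0<\kappa<1$ and a weight $w$, $L^{p,\kappa}(w)$ is the set of $f\in L^p_{loc}(w)$ with $$\|f\|_{L^{p,\kappa}(w)}=\sup_B\left(\frac1{w(B)^\kappa}\int_B|f(x)|^p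 w(x)\,dx\right)^{1/p}<\infty.$$ For two weights $u,v$, $L^{p,\kappa}(u,v)$ is the set of $f\in L^p_{loc}(u)$ with $$\|f\|_{L^{p,\kappa}(u,v)}=\sup_B\left(\frac1{v(B)^\kappa}\int_B|f(x)|^p u(x)\,dx\right)^{1/p}<\infty.$$ Both suprema are over all balls $B\subseteq\mathbb R^n$. *)

theory Defs
  imports "HOL-Analysis.Analysis"
begin

text \<open>
  Functions on \<open>\<real>\<^sup>n\<close> are genuine functions, measurable with respect to the Lebesgue
  \<open>\<sigma>\<close>-algebra; \<open>\<Omega>\<close>, \<open>b\<close> and \<open>f\<close> are complex valued, which contains the real-valued case.
  Norms are \<open>ennreal\<close>-valued, so that "\<open>< \<infinity>\<close>" has its literal meaning.
\<close>

text \<open>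
  Powers of elements of \<open>[0,\<infinity>]\<close>. Only used for exponents \<open>a > 0\<close>; negative powers are
  written with \<open>inverse\<close> on \<open>ennreal\<close>, because real \<open>powr\<close> has \<open>0 powr a = 0\<close> even for \<open>a < 0\<close>.
\<close>

definition epow :: "ennreal \<Rightarrow> real \<Rightarrow> ennreal" where
  "epow x a = (if x = \<infinity> then \<infinity> else ennreal (enn2real x powr a))"

section \<open>The sphere and the kernel\<close>

text \<open>
  Normalized Lebesgue measure on the unit sphere: the measure of \<open>E\<close> is the proportion of the
  unit ball occupied by the cone \<open>{r u | u \<in> E, 0 < r < 1}\<close>. The restriction to the sphere
  only removes the value \<open>0\<close>, taken at the origin since \<open>0 /\<^sub>R norm 0 = 0\<close>. It is completed
  so that it carries all Lebesgue measurable functions on the sphere.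
\<close>

definition sphere_measure :: "'a::euclidean_space measure" where
  "sphere_measure = completion (restrict_space
     (distr (uniform_measure lborel (ball 0 1)) borel (\<lambda>x. x /\<^sub>R norm x)) (sphere 0 1))"

definition Lp_space :: "ennreal \<Rightarrow> 'a measure \<Rightarrow> ('a \<Rightarrow> complex) set" where
  "Lp_space s M = {f \<in> borel_measurable M.
     if s = \<infinity> then \<exists>K. AE x in M. norm (f x) \<le> K
     else (\<integral>\<^sup>+x. ennreal (norm (f x) powr enn2real s) \<partial>M) < \<infinity>}"

definition conj_exponent :: "ennreal \<Rightarrow> real" where
  "conj_exponent s = (if s = \<infinity> then 1 else enn2real s / (enn2real s - 1))"

definition homogeneous_deg0 :: "('a::euclidean_space \<Rightarrow> complex) \<Rightarrow> bool" where
  "homogeneous_deg0 \<Omega> \<longleftrightarrow> (\<forall>c>0. \<forall>x. x \<noteq> 0 \<longrightarrow> \<Omega> (c *\<^sub>R x) = \<Omega> x)"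

definition rough_integrand ::
    "('a::euclidean_space \<Rightarrow> complex) \<Rightarrow> real \<Rightarrow> ('a \<Rightarrow> complex) \<Rightarrow> 'a \<Rightarrow> 'a \<Rightarrow> complex" where
  "rough_integrand \<Omega> \<alpha> f x y =
     \<Omega> (y /\<^sub>R norm y) / of_real (norm y powr (real DIM('a) - \<alpha>)) * f (x - y)"

definition rough_frac_int ::
    "('a::euclidean_space \<Rightarrow> complex) \<Rightarrow> real \<Rightarrow> ('a \<Rightarrow> complex) \<Rightarrow> 'a \<Rightarrow> complex" where
  "rough_frac_int \<Omega> \<alpha> f x = (LINT y|lebesgue. rough_integrand \<Omega> \<alpha> f x y)"

definition commutator ::
    "('a \<Rightarrow> complex) \<Rightarrow> (('a \<Rightarrow> complex) \<Rightarrow> 'a \<Rightarrow> complex) \<Rightarrow> ('a \<Rightarrow> complex) \<Rightarrow> 'a \<Rightarrow> complex" where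
  "commutator b T f x = b x * T f x - T (\<lambda>y. b y * f y) x"

definition commutator_integrand ::
    "('a::euclidean_space \<Rightarrow> complex) \<Rightarrow> real \<Rightarrow> ('a \<Rightarrow> complex) \<Rightarrow> ('a \<Rightarrow> complex) \<Rightarrow> 'a \<Rightarrow> 'a \<Rightarrow> complex" where
  "commutator_integrand \<Omega> \<alpha> b f x y =
     \<Omega> (x - y) / of_real (norm (x - y) powr (real DIM('a) - \<alpha>)) * (b x - b y) * f y"

section \<open>BMO, weights and weighted Morrey spaces\<close>

definition locally_integrable ::
    "('a::euclidean_space \<Rightarrow> 'b::{banach, second_countable_topology}) \<Rightarrow> bool" where
  "locally_integrable f \<longleftrightarrow> (\<forall>K. compact K \<longrightarrow> set_integrable lebesgue K f)"

definition ball_average :: "('a::euclidean_space \<Rightarrow> complex) \<Rightarrow> 'a \<Rightarrow> real \<Rightarrow> complex" where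
  "ball_average b c r = (LINT x:ball c r|lebesgue. b x) /\<^sub>R measure lebesgue (ball c r)"

definition bmo_norm :: "('a::euclidean_space \<Rightarrow> complex) \<Rightarrow> ennreal" where
  "bmo_norm b = (SUP (c, r) \<in> UNIV \<times> {0<..}.
     (\<integral>\<^sup>+x\<in>ball c r. ennreal (norm (b x - ball_average b c r)) \<partial>lebesgue)
       / emeasure lebesgue (ball c r))"

definition BMO :: "('a::euclidean_space \<Rightarrow> complex) set" where
  "BMO = {b. locally_integrable b \<and> bmo_norm b < \<infinity>}"

definition weight :: "('a::euclidean_space \<Rightarrow> real) \<Rightarrow> bool" where
  "weight w \<longleftrightarrow> (\<forall>x. 0 \<le> w x) \<and> locally_integrable w"

text \<open>
  The integrand \<open>w\<^sup>-\<^sup>p\<^sup>'\<close> is \<open>\<infinity>\<close> where \<open>w\<close> vanishes. Finiteness of its integral is required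
  separately because \<open>0 * \<infinity> = 0\<close> in \<open>ennreal\<close>: for \<open>w\<close> not almost everywhere \<open>0\<close> it follows
  from the bound on the product, and \<open>w = 0\<close> almost everywhere would otherwise be admitted.
\<close>

definition A_class :: "real \<Rightarrow> real \<Rightarrow> ('a::euclidean_space \<Rightarrow> real) set" where
  "A_class p q = {w. weight w \<and> (\<exists>C>0. \<forall>c r. r > 0 \<longrightarrow>
     (let p' = p / (p - 1); B = ball c r;
          I = (\<integral>\<^sup>+x\<in>B. ennreal (w x powr q) \<partial>lebesgue);
          J = (\<integral>\<^sup>+x\<in>B. inverse (ennreal (w x powr p')) \<partial>lebesgue)
      in J < \<infinity> \<and>
         epow (I / emeasure lebesgue B) (1 / q) * epow (J / emeasure lebesgue B) (1 / p')
           \<le> ennreal C))}"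

definition Lp_loc :: "real \<Rightarrow> ('a::euclidean_space \<Rightarrow> real) \<Rightarrow> ('a \<Rightarrow> complex) set" where
  "Lp_loc p u = {f \<in> borel_measurable lebesgue.
     \<forall>K. compact K \<longrightarrow> (\<integral>\<^sup>+x\<in>K. ennreal (norm (f x) powr p * u x) \<partial>lebesgue) < \<infinity>}"

definition morrey_norm2 ::
    "real \<Rightarrow> real \<Rightarrow> ('a::euclidean_space \<Rightarrow> real) \<Rightarrow> ('a \<Rightarrow> real) \<Rightarrow> ('a \<Rightarrow> complex) \<Rightarrow> ennreal" where
  "morrey_norm2 p \<kappa> u v f = (SUP (c, r) \<in> UNIV \<times> {0<..}.
     epow ((\<integral>\<^sup>+x\<in>ball c r. ennreal (norm (f x) powr p * u x) \<partial>lebesgue)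
             / epow (\<integral>\<^sup>+x\<in>ball c r. ennreal (v x) \<partial>lebesgue) \<kappa>) (1 / p))"

definition morrey2 ::
    "real \<Rightarrow> real \<Rightarrow> ('a::euclidean_space \<Rightarrow> real) \<Rightarrow> ('a \<Rightarrow> real) \<Rightarrow> ('a \<Rightarrow> complex) set" where
  "morrey2 p \<kappa> u v = {f \<in> Lp_loc p u. morrey_norm2 p \<kappa> u v f < \<infinity>}"

abbreviation morrey_norm ::
    "real \<Rightarrow> real \<Rightarrow> ('a::euclidean_space \<Rightarrow> real) \<Rightarrow> ('a \<Rightarrow> complex) \<Rightarrow> ennreal" where
  "morrey_norm p \<kappa> w \<equiv> morrey_norm2 p \<kappa> w w"

abbreviation morrey ::
    "real \<Rightarrow> real \<Rightarrow> ('a::euclidean_space \<Rightarrow> real) \<Rightarrow> ('a \<Rightarrow> complex) set" where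
  "morrey p \<kappa> w \<equiv> morrey2 p \<kappa> w w"

end

theory Submission
  imports Defs
begin

text \<open>
  For \<open>t > 0\<close> and a complex number \<open>d\<close>, the modulus of \<open>d\<close> is at most \<open>1/t\<close> times the sum of
  \<open>exp (\<plusminus>t Re d)\<close> and \<open>exp (\<plusminus>t Im d)\<close>. With \<open>d = b x - b y\<close> this dominates the commutator
  pointwise by four terms \<open>exp (t \<beta>) T (exp (- t \<beta>) |f|)\<close>, where \<open>T\<close> has the kernel
  \<open>|\<Omega>(y')| |y|\<^sup>\<alpha>\<^sup>-\<^sup>n\<close> and \<open>\<beta>\<close> is \<open>\<plusminus>Re b\<close> or \<open>\<plusminus>Im b\<close>. It therefore suffices to bound \<open>T\<close> itself
  for the weights \<open>w exp (t \<beta>)\<close>, \<open>t\<close> small.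

  These weights satisfy the same condition as \<open>w\<close>, with room in the exponent \<open>q\<close>, because of the
  John-Nirenberg inequality with respect to the measures \<open>w\<^sup>q dx\<close> and \<open>w\<^sup>-\<^sup>s\<^sup>'\<^sup>P\<^sup>' dx\<close>, \<open>P = p/s'\<close>, applied to
  \<open>\<beta>\<close> and to \<open>ln w\<close>. Hoelder's inequality on dyadic annuli removes \<open>\<Omega>\<close>, Welland's
  argument bounds \<open>T\<close> by the geometric mean of two fractional maximal operators with nearby
  exponents, and Lerner's argument bounds those operators on weighted spaces.

  For the Morrey estimate on a ball \<open>B\<close>, \<open>f\<close> is split at the boundary of \<open>2B\<close>. The far part is a
  series over the balls \<open>2\<^sup>jB\<close>; it converges because the \<open>w\<^sup>q\<close>-mass of \<open>2\<^sup>jB\<close> grows geometrically,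
  while \<open>exp (t \<beta>)\<close> changes its size by at most a factor \<open>exp (O(t))\<close> from one ball to the next.
\<close>

text \<open>The obstacle is the factor b x - b y in the kernel: it is unbounded, so size estimates
  for T say nothing about the commutator. Exponentials trade the factor for a change of weight. For
  one fixed small t > 0 the difference leaves the kernel, and the price is that every weighted
  estimate must be stable under the passage from w to w exp (t \<beta>). Neither a sharp maximal
  function nor a good-lambda inequality enters. The room in the exponent is consumed by the
  geometric mean: its two fractional maximal operators have orders slightly above and slightly below
  the natural one, so they map the same space into two different ones, each with a weight condition
  of its own. The case t = 0 of the same estimate shows that T |f| is finite a.e.; this is why both
  separate integrals in the commutator converge. The analysis is done for Borel functions and
  weights that are positive everywhere. The A(p,q) condition forces w > 0 a.e., so changes on null
  sets reduce Lebesgue measurable data to this situation.\<close>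

lemma epow_ennreal: "0 \<le> x \<Longrightarrow> epow (ennreal x) a = ennreal (x powr a)"
  by (simp add: epow_def)

lemma epow_top [simp]: "epow \<infinity> a = \<infinity>" "epow top a = top"
  by (simp_all add: epow_def)

lemma epow_0 [simp]: "epow 0 a = 0"
  by (simp add: epow_def)

lemma epow_1 [simp]: "epow x 1 = x"
  by (cases x) (auto simp: epow_def)

lemma epow_mono: "x \<le> y \<Longrightarrow> 0 < a \<Longrightarrow> epow x a \<le> epow y a"
  by (cases x; cases y) (auto simp: epow_ennreal powr_mono2 top_unique)

lemma epow_mult: "0 < a \<Longrightarrow> epow (x * y) a = epow x a * epow y a"
  by (cases x; cases y)
     (auto simp: epow_ennreal powr_mult ennreal_mult_top ennreal_top_mult epow_def
       simp flip: ennreal_mult ennreal_mult'')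

lemma epow_epow: "0 < a \<Longrightarrow> 0 < b \<Longrightarrow> epow (epow x a) b = epow x (a * b)"
  by (cases x) (auto simp: epow_ennreal powr_powr)

lemma epow_epow_inverse: "0 < a \<Longrightarrow> epow (epow x a) (1 / a) = x"
  by (simp add: epow_epow)

lemma epow_inverse_epow: "0 < a \<Longrightarrow> epow (epow x (1 / a)) a = x"
  by (simp add: epow_epow)

lemma epow_add: "0 < a \<Longrightarrow> 0 < b \<Longrightarrow> epow x (a + b) = epow x a * epow x b"
  by (cases x) (auto simp: epow_ennreal powr_add ennreal_mult)

lemma epow_eq_0_iff [simp]: "epow x a = 0 \<longleftrightarrow> x = 0"
  by (cases x) (auto simp: epow_ennreal ennreal_eq_0_iff)

lemma epow_eq_top_iff [simp]: "epow x a = top \<longleftrightarrow> x = top"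
  by (cases x) (auto simp: epow_ennreal)

lemma epow_le_iff: "0 < a \<Longrightarrow> epow x a \<le> epow y a \<longleftrightarrow> x \<le> y"
  using epow_mono[of "epow x a" "epow y a" "1/a"] epow_mono[of x y a]
  by (auto simp: epow_epow_inverse)

lemma epow_le_iff_le_epow: "0 < a \<Longrightarrow> epow x a \<le> y \<longleftrightarrow> x \<le> epow y (1 / a)"
  using epow_le_iff[of a x "epow y (1/a)"] by (simp add: epow_inverse_epow)

lemma epow_measurable [measurable]:
  assumes [measurable]: "f \<in> borel_measurable M"
  shows "(\<lambda>x. epow (f x) a) \<in> borel_measurable M"
  unfolding epow_def by measurable

text \<open>The sum is at most twice the larger term, so the constant 2 powr a serves all exponents
  a > 0, including a < 1 where convexity fails.\<close>

lemma epow_sum_le: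
  assumes "0 < a"
  shows "epow (x + y) a \<le> ennreal (2 powr a) * (epow x a + epow y a)"
proof -
  have "epow (x + y) a \<le> epow (2 * max x y) a"
  proof (rule epow_mono)
    show "x + y \<le> 2 * max x y"
      by (metis add_mono max.cobounded1 max.cobounded2 mult_2)
  qed fact
  also have "\<dots> = ennreal (2 powr a) * epow (max x y) a"
    using assms epow_ennreal[of 2 a] by (simp add: epow_mult)
  also have "epow (max x y) a \<le> epow x a + epow y a"
    by (simp add: max_def)
  finally show ?thesis
    by (simp add: mult_left_mono)
qed

lemma Young_ennreal:
  assumes "0 < t" "t < 1"
  shows "epow x t * epow y (1 - t) \<le> ennreal t * x + ennreal (1 - t) * y"
proof (cases "x = top \<or> y = top")
  case True
  then show ?thesis using assms
    by (cases "x = 0"; cases "y = 0") (auto simp: ennreal_mult_top)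
next
  case False
  then obtain a b where ab: "x = ennreal a" "y = ennreal b" "0 \<le> a" "0 \<le> b"
    by (cases x; cases y) auto
  have "a powr t * b powr (1 - t) \<le> t * a + (1 - t) * b"
    using Youngs_inequality_0[of t "1 - t" a b] assms ab
    by (cases "a = 0 \<or> b = 0") auto
  then show ?thesis
    using assms ab by (simp add: epow_ennreal ennreal_leI flip: ennreal_mult ennreal_plus)
qed

text \<open>The exponents t and 1 - t sit on integrable functions, the form in which a weight and
  its dual are split below. Young's inequality is applied after division by the two integrals, so
  the cases in which one of them is 0 or infinite come apart. The convention 0 * \<infinity> = 0 is
  consistent there because a vanishing integral forces a vanishing integrand a.e.\<close>

lemma Holder_nn_integral:
  assumes [measurable]: "f \<in> borel_measurable M" "g \<in> borel_measurable M"
    and t: "0 < t" "t < 1"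
  shows "(\<integral>\<^sup>+x. epow (f x) t * epow (g x) (1 - t) \<partial>M)
           \<le> epow (\<integral>\<^sup>+x. f x \<partial>M) t * epow (\<integral>\<^sup>+x. g x \<partial>M) (1 - t)"
proof -
  define A where "A = (\<integral>\<^sup>+x. f x \<partial>M)"
  define B where "B = (\<integral>\<^sup>+x. g x \<partial>M)"
  consider "A = 0" | "B = 0" | "A \<noteq> 0" "B \<noteq> 0" "A = top \<or> B = top"
    | "A \<noteq> 0" "B \<noteq> 0" "A < top" "B < top"
    using top.not_eq_extremum by blast
  then show ?thesis
  proof cases
    case 1
    then have "AE x in M. f x = 0"
      by (simp add: A_def nn_integral_0_iff_AE)
    then have "(\<integral>\<^sup>+x. epow (f x) t * epow (g x) (1 - t) \<partial>M) = (\<integral>\<^sup>+x. 0 \<partial>M)"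
      by (intro nn_integral_cong_AE) auto
    then show ?thesis by simp
  next
    case 2
    then have "AE x in M. g x = 0"
      by (simp add: B_def nn_integral_0_iff_AE)
    then have "(\<integral>\<^sup>+x. epow (f x) t * epow (g x) (1 - t) \<partial>M) = (\<integral>\<^sup>+x. 0 \<partial>M)"
      by (intro nn_integral_cong_AE) auto
    then show ?thesis by simp
  next
    case 3
    then have "epow A t * epow B (1 - t) = top"
      by (auto simp: ennreal_mult_top ennreal_top_mult)
    then show ?thesis by (simp add: A_def B_def)
  next
    case 4
    have e: "epow (f x) t * epow (g x) (1 - t)
           = epow A t * epow B (1 - t) * (epow (f x / A) t * epow (g x / B) (1 - t))" for x
    proof -
      have "f x = A * (f x / A)" "g x = B * (g x / B)"
        using 4 mult_divide_eq_ennreal[of A "f x"] mult_divide_eq_ennreal[of B "g x"]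
        by (simp_all add: ennreal_times_divide mult.commute)
      then have "epow (f x) t * epow (g x) (1 - t)
           = epow (A * (f x / A)) t * epow (B * (g x / B)) (1 - t)"
        by simp
      then show ?thesis
        using t by (simp only: epow_mult diff_gt_0_iff_gt mult_ac)
    qed
    have "(\<integral>\<^sup>+x. epow (f x / A) t * epow (g x / B) (1 - t) \<partial>M)
        \<le> (\<integral>\<^sup>+x. ennreal t * (f x / A) + ennreal (1 - t) * (g x / B) \<partial>M)"
      by (intro nn_integral_mono Young_ennreal t)
    also have "\<dots> = ennreal t * (A / A) + ennreal (1 - t) * (B / B)"
      by (simp add: nn_integral_add nn_integral_cmult nn_integral_divide A_def B_def)
    also have "\<dots> = 1"
      using 4 t by (simp add: ennreal_divide_self flip: ennreal_plus)
    finally have "(\<integral>\<^sup>+x. epow (f x / A) t * epow (g x / B) (1 - t) \<partial>M) \<le> 1" .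
    then show ?thesis
      unfolding e using mult_left_mono[of _ 1 "epow A t * epow B (1 - t)"]
      by (simp add: nn_integral_cmult flip: A_def B_def)
  qed
qed

section \<open>Weighted maximal functions\<close>

text \<open>The quantity \<open>a\<close> attached to a ball is arbitrary: with averages for a
  measure this is the uncentred maximal function, with a power of the volume in front it is a
  fractional maximal function. Uncentred balls matter for measurability and for Lerner's argument,
  where one ball is viewed from each of its points.\<close>

definition supball :: "('a::metric_space \<Rightarrow> real \<Rightarrow> ennreal) \<Rightarrow> 'a \<Rightarrow> ennreal" where
  "supball a x = (SUP (c, r)\<in>{(c, r). 0 < r \<and> x \<in> ball c r}. a c r)"

lemma supball_upper: "x \<in> ball c r \<Longrightarrow> a c r \<le> supball a x"
  unfolding supball_def
  by (rule SUP_upper2[of "(c, r)"]) (auto intro: le_less_trans[OF zero_le_dist])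

lemma supball_least: "(\<And>c r. 0 < r \<Longrightarrow> x \<in> ball c r \<Longrightarrow> a c r \<le> t) \<Longrightarrow> supball a x \<le> t"
  unfolding supball_def by (rule SUP_least) auto

lemma less_supball_iff: "t < supball a x \<longleftrightarrow> (\<exists>c r. 0 < r \<and> x \<in> ball c r \<and> t < a c r)"
  unfolding supball_def less_SUP_iff by auto

text \<open>A superlevel set is the union of the open balls on which \<open>a\<close> exceeds the
  level, hence open whatever \<open>a\<close> is.\<close>

lemma supball_measurable [measurable]: "supball a \<in> borel_measurable borel"
proof (rule borel_measurableI_greater)
  fix t
  have "{x. t < supball a x} = (\<Union>(c, r)\<in>{(c, r). 0 < r \<and> t < a c r}. ball c r)"
    by (auto simp: less_supball_iff) blast
  then have "open {x. t < supball a x}"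
    by auto
  then show "{x \<in> space borel. t < supball a x} \<in> sets borel"
    by simp
qed

definition maximal :: "'a::metric_space measure \<Rightarrow> ('a \<Rightarrow> ennreal) \<Rightarrow> 'a \<Rightarrow> ennreal" where
  "maximal M f = supball (\<lambda>c r. (\<integral>\<^sup>+x\<in>ball c r. f x \<partial>M) / emeasure M (ball c r))"

lemma maximal_measurable [measurable]:
  "sets M = sets borel \<Longrightarrow> maximal M f \<in> borel_measurable M"
  unfolding maximal_def using supball_measurable measurable_cong_sets by blast

text \<open>The indicator of a union is at most the sum of the indicators. The sum is an integral
  over counting measure so that countable families of balls and cubes can be summed without choosing
  an enumeration.\<close>

lemma emeasure_UN_le_count_space:
  assumes "countable I" "\<And>i. i \<in> I \<Longrightarrow> A i \<in> sets M"
  shows "emeasure M (\<Union>i\<in>I. A i) \<le> (\<integral>\<^sup>+i. emeasure M (A i) \<partial>count_space I)"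
proof -
  have "(\<Union>i\<in>I. A i) \<in> sets M"
    using assms by auto
  then have "emeasure M (\<Union>i\<in>I. A i) = (\<integral>\<^sup>+x. indicator (\<Union>i\<in>I. A i) x \<partial>M)"
    by simp
  also have "\<dots> \<le> (\<integral>\<^sup>+x. (\<integral>\<^sup>+i. indicator (A i) x \<partial>count_space I) \<partial>M)"
  proof (rule nn_integral_mono)
    fix x
    show "indicator (\<Union>i\<in>I. A i) x \<le> (\<integral>\<^sup>+i. indicator (A i) x \<partial>count_space I :: ennreal)"
    proof (cases "x \<in> (\<Union>i\<in>I. A i)")
      case True
      then obtain i where i: "i \<in> I" "x \<in> A i" by auto
      then show ?thesis
        using nn_integral_ge_point[of i I "\<lambda>i. indicator (A i) x"] True by simp
    qed simp
  qed
  also have "\<dots> = (\<integral>\<^sup>+i. (\<integral>\<^sup>+x. indicator (A i) x \<partial>M) \<partial>count_space I)"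
    using assms by (intro nn_integral_count_space_nn_integral) auto
  also have "\<dots> = (\<integral>\<^sup>+i. emeasure M (A i) \<partial>count_space I)"
    using assms by (intro nn_integral_cong) auto
  finally show ?thesis .
qed

text \<open>For finite x this is the integral of p t^(p-1) over [0, x]; for x = \<infinity> the
  value is compared with the one at n powr (1/p), which is n, for every n. Being pointwise, the
  identity can be inserted under an integral and followed by Fubini's theorem.\<close>

lemma layer_cake:
  assumes p: "0 < p"
  shows "(\<integral>\<^sup>+t. ennreal (p * t powr (p - 1)) * indicator {t. 0 < t \<and> ennreal t < x} t \<partial>lborel) = epow x p"
proof -
  have fin: "(\<integral>\<^sup>+t. ennreal (p * t powr (p - 1)) * indicator {t. 0 < t \<and> ennreal t < ennreal y} t \<partial>lborel)
      = ennreal (y powr p)" if "0 \<le> y" for y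
  proof -
    have "((\<lambda>t. p * t powr (p - 1)) has_integral (p * (y powr (p - 1 + 1) / (p - 1 + 1)))) {0..y}"
      using p that by (intro has_integral_mult_right has_integral_powr_from_0) auto
    then have "((\<lambda>t. p * t powr (p - 1)) has_integral (y powr p)) {0..y}"
      using p by simp
    then have "(\<integral>\<^sup>+t. ennreal (indicator {0..y} t * (p * t powr (p - 1))) \<partial>lborel) = ennreal (y powr p)"
      using p by (intro nn_integral_has_integral_lebesgue) auto
    moreover have "(\<integral>\<^sup>+t. ennreal (p * t powr (p - 1)) * indicator {t. 0 < t \<and> ennreal t < ennreal y} t \<partial>lborel)
      = (\<integral>\<^sup>+t. ennreal (indicator {0..y} t * (p * t powr (p - 1))) \<partial>lborel)"
    proof (intro nn_integral_cong_AE)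
      have "AE t in lborel. t \<noteq> y \<and> t \<noteq> 0"
        by (intro AE_conjI AE_lborel_singleton)
      then show "AE t in lborel. ennreal (p * t powr (p - 1)) * indicator {t. 0 < t \<and> ennreal t < ennreal y} t
         = ennreal (indicator {0..y} t * (p * t powr (p - 1)))"
        by eventually_elim (auto simp: indicator_def ennreal_less_iff)
    qed
    ultimately show ?thesis by simp
  qed
  show ?thesis
  proof (cases x)
    case (real y)
    then show ?thesis using fin by (simp add: epow_ennreal)
  next
    case top
    have "ennreal (real n) \<le> (\<integral>\<^sup>+t. ennreal (p * t powr (p - 1)) * indicator {t. 0 < t \<and> ennreal t < x} t \<partial>lborel)"
      for n
    proof -
      have "ennreal (real n) = ennreal ((real n powr (1 / p)) powr p)"
        using p by (simp add: powr_powr)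
      also have "\<dots> = (\<integral>\<^sup>+t. ennreal (p * t powr (p - 1)) * indicator {t. 0 < t \<and> ennreal t < ennreal (real n powr (1 / p))} t \<partial>lborel)"
        by (rule fin[symmetric]) simp
      also have "\<dots> \<le> (\<integral>\<^sup>+t. ennreal (p * t powr (p - 1)) * indicator {t. 0 < t \<and> ennreal t < x} t \<partial>lborel)"
        by (intro nn_integral_mono) (auto simp: indicator_def top)
      finally show ?thesis .
    qed
    then show ?thesis
      using top ennreal_Ex_less_of_nat by (simp add: ennreal_of_nat_eq_real_of_nat) (metis not_less top.not_eq_extremum)
  qed
qed

lemma ennreal_less_divide_two: "t < x / 2 \<longleftrightarrow> 2 * t < (x::ennreal)"
proof -
  have eq: "2 * (x / 2) = x"
    using mult_divide_eq_ennreal[of 2 x] by (simp add: ennreal_times_divide mult.commute)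
  have "x \<le> 2 * t" if "x / 2 \<le> t"
    using mult_left_mono[OF that, of 2] unfolding eq by simp
  moreover have "x \<le> 2 * t \<Longrightarrow> x / 2 \<le> t"
    using divide_right_mono_ennreal[of x "2 * t" 2] mult_divide_eq_ennreal[of 2 t]
    by (simp add: mult.commute)
  ultimately have "x \<le> 2 * t \<longleftrightarrow> x / 2 \<le> t" by blast
  then show ?thesis by (simp flip: not_le)
qed

text \<open>The dilation factor 5 is the one of the Vitali covering lemma, so \<open>D\<close>
  becomes the constant of the weak type inequality. Positive and finite masses of balls allow
  averages in \<open>ennreal\<close> to be cleared of their denominators.\<close>

locale doubling_measure = sigma_finite_measure M
  for M :: "'a::euclidean_space measure" +
  fixes D :: real
  assumes sets_M [measurable_cong]: "sets M = sets borel"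
    and D_pos: "0 < D"
    and finite_ball: "emeasure M (ball c r) < top"
    and pos_ball: "0 < r \<Longrightarrow> 0 < emeasure M (ball c r)"
    and doubling: "0 < r \<Longrightarrow> emeasure M (ball c (5 * r)) \<le> ennreal D * emeasure M (ball c r)"
begin

lemma maximal_weak_type:
  assumes [measurable]: "f \<in> borel_measurable borel"
  shows "t * emeasure M {x. t < maximal M f x} \<le> ennreal D * (\<integral>\<^sup>+x. f x \<partial>M)"
proof -
  \<comment> \<open>Vitali's lemma asks for bounded radii, so radii up to N are treated first; the
    bound is independent of N and passes to the increasing union.\<close>
  define K where "K N = {(c, r). 0 < r \<and> r \<le> real N \<and>
    t < (\<integral>\<^sup>+x\<in>ball c r. f x \<partial>M) / emeasure M (ball c r)}" for N
  define E where "E N = (\<Union>(c, r)\<in>K N. ball c r)" for N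
  have E_sets: "E N \<in> sets M" for N
    unfolding E_def sets_M by (intro borel_open) auto
  have E: "{x. t < maximal M f x} = (\<Union>N. E N)"
  proof (intro equalityI subsetI)
    fix x assume "x \<in> {x. t < maximal M f x}"
    then obtain c r where cr: "0 < r" "x \<in> ball c r"
        "t < (\<integral>\<^sup>+x\<in>ball c r. f x \<partial>M) / emeasure M (ball c r)"
      by (auto simp: maximal_def less_supball_iff)
    obtain N where "r \<le> real N" using real_arch_simple by blast
    with cr show "x \<in> (\<Union>N. E N)" unfolding E_def K_def by blast
  next
    fix x assume "x \<in> (\<Union>N. E N)"
    then show "x \<in> {x. t < maximal M f x}"
      unfolding E_def K_def maximal_def less_supball_iff mem_Collect_eq by blast
  qed
  have "incseq E"
    by (intro incseq_SucI) (auto simp: E_def K_def)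
  then have "emeasure M {x. t < maximal M f x} = (SUP N. emeasure M (E N))"
    unfolding E using E_sets by (intro SUP_emeasure_incseq[symmetric]) auto
  moreover have "t * emeasure M (E N) \<le> ennreal D * (\<integral>\<^sup>+x. f x \<partial>M)" for N
  proof -
    have "E N \<subseteq> (\<Union>i\<in>K N. ball (fst i) (snd i))"
      by (auto simp: E_def)
    moreover have "0 < snd i \<and> snd i \<le> real N" if "i \<in> K N" for i
      using that by (auto simp: K_def)
    ultimately obtain C where C: "countable C" "C \<subseteq> K N"
      "pairwise (\<lambda>i j. disjnt (ball (fst i) (snd i)) (ball (fst j) (snd j))) C"
      "E N \<subseteq> (\<Union>i\<in>C. ball (fst i) (5 * snd i))"
      by (rule Vitali_covering_lemma_balls[where S="E N" and K="K N" and a=fst and r=snd and B="real N"])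
    have meas: "ball (c::'a) r \<in> sets M" for c r
      by (simp add: sets_M)
    have "t * emeasure M (E N) \<le> t * emeasure M (\<Union>i\<in>C. ball (fst i) (5 * snd i))"
      using C meas by (intro mult_left_mono emeasure_mono) auto
    also have "\<dots> \<le> t * (\<integral>\<^sup>+i. emeasure M (ball (fst i) (5 * snd i)) \<partial>count_space C)"
      using C meas by (intro mult_left_mono emeasure_UN_le_count_space) auto
    also have "\<dots> = (\<integral>\<^sup>+i. t * emeasure M (ball (fst i) (5 * snd i)) \<partial>count_space C)"
      by (simp add: nn_integral_cmult)
    also have "\<dots> \<le> (\<integral>\<^sup>+i. ennreal D * emeasure (density M f) (ball (fst i) (snd i)) \<partial>count_space C)"
    proof (rule nn_integral_mono)
      fix i assume "i \<in> space (count_space C)"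
      then have "i \<in> K N" using C by auto
      then have i: "0 < snd i" and
        "t < (\<integral>\<^sup>+x\<in>ball (fst i) (snd i). f x \<partial>M) / emeasure M (ball (fst i) (snd i))"
        by (auto simp: K_def)
      then have "t * emeasure M (ball (fst i) (snd i)) \<le>
         (\<integral>\<^sup>+x\<in>ball (fst i) (snd i). f x \<partial>M) / emeasure M (ball (fst i) (snd i))
          * emeasure M (ball (fst i) (snd i))"
        by (intro mult_right_mono) auto
      also have "\<dots> = (\<integral>\<^sup>+x\<in>ball (fst i) (snd i). f x \<partial>M)"
        using pos_ball[OF i, of "fst i"] finite_ball[of "fst i" "snd i"]
        by (simp add: ennreal_divide_times ennreal_mult_divide_eq)
      finally have "t * emeasure M (ball (fst i) (snd i)) \<le> (\<integral>\<^sup>+x\<in>ball (fst i) (snd i). f x \<partial>M)" .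
      then have "ennreal D * (t * emeasure M (ball (fst i) (snd i)))
          \<le> ennreal D * emeasure (density M f) (ball (fst i) (snd i))"
        by (simp add: emeasure_density meas mult_left_mono)
      moreover have "t * emeasure M (ball (fst i) (5 * snd i))
          \<le> t * (ennreal D * emeasure M (ball (fst i) (snd i)))"
        by (intro mult_left_mono doubling i) auto
      ultimately show "t * emeasure M (ball (fst i) (5 * snd i))
          \<le> ennreal D * emeasure (density M f) (ball (fst i) (snd i))"
        by (simp add: mult_ac order_trans)
    qed
    also have "\<dots> = ennreal D * emeasure (density M f) (\<Union>i\<in>C. ball (fst i) (snd i))"
      using C meas
      by (subst emeasure_UN_countable)
         (auto simp: nn_integral_cmult disjoint_family_on_def pairwise_def disjnt_def)
    also have "\<dots> \<le> ennreal D * emeasure (density M f) (space M)"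
      using emeasure_space[of "density M f"] by (intro mult_left_mono) (auto simp: space_density)
    also have "\<dots> = ennreal D * (\<integral>\<^sup>+x. f x \<partial>M)"
      by (subst emeasure_density) (auto intro!: arg_cong2[where f="(*)"] nn_integral_cong)
    finally show ?thesis .
  qed
  ultimately show ?thesis
    by (simp add: SUP_mult_left_ennreal SUP_least)
qed

text \<open>The part of f not exceeding t adds at most t to any average, so the maximal function can
  exceed 2 t only where that of the part above t exceeds t. This localises the weak type bound to {f
  > t}, the input of Marcinkiewicz interpolation.\<close>

lemma maximal_truncated_weak_type:
  assumes [measurable]: "f \<in> borel_measurable borel" and t: "0 < t" "t < top"
  shows "emeasure M {x. 2 * t < maximal M f x}
      \<le> ennreal D * (\<integral>\<^sup>+x\<in>{x. t < f x}. f x \<partial>M) / t"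
proof -
  have [measurable]: "(\<lambda>x. f x * indicator {x. t < f x} x) \<in> borel_measurable borel"
    by measurable
  define g where "g = (\<lambda>x. f x * indicator {x. t < f x} x)"
  have "maximal M f x \<le> maximal M g x + t" for x
    unfolding maximal_def
  proof (rule supball_least)
    fix c r assume r: "0 < (r::real)" "x \<in> ball c r"
    have [measurable]: "ball c r \<in> sets M" by (simp add: sets_M)
    have "(\<integral>\<^sup>+x\<in>ball c r. f x \<partial>M)
        \<le> (\<integral>\<^sup>+x. g x * indicator (ball c r) x + t * indicator (ball c r) x \<partial>M)"
      by (intro nn_integral_mono) (auto simp: g_def indicator_def not_less)
    also have "\<dots> = (\<integral>\<^sup>+x\<in>ball c r. g x \<partial>M) + t * emeasure M (ball c r)"
      by (subst nn_integral_add) (auto simp: g_def nn_integral_cmult)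
    finally have "(\<integral>\<^sup>+x\<in>ball c r. f x \<partial>M) / emeasure M (ball c r)
        \<le> ((\<integral>\<^sup>+x\<in>ball c r. g x \<partial>M) + t * emeasure M (ball c r)) / emeasure M (ball c r)"
      by (rule divide_right_mono_ennreal)
    also have "\<dots> = (\<integral>\<^sup>+x\<in>ball c r. g x \<partial>M) / emeasure M (ball c r) + t"
      using pos_ball[OF r(1), of c] finite_ball[of c r]
      by (simp add: ennreal_mult_divide_eq add_divide_distrib_ennreal)
    also have "\<dots> \<le> supball (\<lambda>c r. (\<integral>\<^sup>+x\<in>ball c r. g x \<partial>M) / emeasure M (ball c r)) x + t"
      using supball_upper[OF r(2), of "\<lambda>c r. (\<integral>\<^sup>+x\<in>ball c r. g x \<partial>M) / emeasure M (ball c r)"]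
      by (rule add_right_mono)
    finally show "(\<integral>\<^sup>+x\<in>ball c r. f x \<partial>M) / emeasure M (ball c r)
      \<le> supball (\<lambda>c r. (\<integral>\<^sup>+x\<in>ball c r. g x \<partial>M) / emeasure M (ball c r)) x + t" .
  qed
  note le = this
  have "{x. 2 * t < maximal M f x} \<subseteq> {x. t < maximal M g x}"
  proof (intro subsetI CollectI, rule ccontr)
    fix x assume x: "x \<in> {x. 2 * t < maximal M f x}" "\<not> t < maximal M g x"
    have "maximal M f x \<le> maximal M g x + t" by (rule le)
    also have "\<dots> \<le> t + t" using x by (intro add_right_mono) simp
    finally show False using x by (simp add: mult_2 not_less[symmetric])
  qed
  moreover have "{x. t < maximal M g x} \<in> sets M"
    using maximal_measurable[OF sets_M, of g] by measurable
  ultimately have "emeasure M {x. 2 * t < maximal M f x} \<le> emeasure M {x. t < maximal M g x}"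
    by (rule emeasure_mono)
  also have "\<dots> = t * emeasure M {x. t < maximal M g x} / t"
    using t mult_divide_eq_ennreal[of t "emeasure M {x. t < maximal M g x}"]
    by (simp add: mult.commute)
  also have "\<dots> \<le> ennreal D * (\<integral>\<^sup>+x. g x \<partial>M) / t"
    by (intro divide_right_mono_ennreal maximal_weak_type) (simp add: g_def)
  finally show ?thesis by (simp add: g_def)
qed

text \<open>Marcinkiewicz interpolation with the trivial bound at \<infinity>.
  \<open>layer_cake\<close> is used with exponent p for the maximal function and, after the
  integrals are exchanged, with exponent p - 1 for f; the missing power is the factor f in the
  truncated weak type bound.\<close>

theorem maximal_strong_type:
  assumes [measurable]: "f \<in> borel_measurable borel" and p: "1 < p"
  shows "(\<integral>\<^sup>+x. epow (maximal M f x) p \<partial>M)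
      \<le> ennreal (2 powr p * D * p / (p - 1)) * (\<integral>\<^sup>+x. epow (f x) p \<partial>M)"
proof -
  have [measurable]: "maximal M f \<in> borel_measurable M"
    using maximal_measurable sets_M by blast
  have [measurable]: "f \<in> borel_measurable M"
    using assms measurable_cong_sets sets_M by blast
  interpret P: pair_sigma_finite M "lborel :: real measure" ..
  have "(\<integral>\<^sup>+x. epow (maximal M f x) p \<partial>M)
     = (\<integral>\<^sup>+x. ennreal (2 powr p) * epow (maximal M f x / 2) p \<partial>M)"
  proof (intro nn_integral_cong)
    fix x
    have "maximal M f x = 2 * (maximal M f x / 2)"
      using mult_divide_eq_ennreal[of 2 "maximal M f x"] by (simp add: ennreal_times_divide mult.commute)
    then have "epow (maximal M f x) p = epow (2 * (maximal M f x / 2)) p" by simp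
    also have "\<dots> = ennreal (2 powr p) * epow (maximal M f x / 2) p"
      using p epow_ennreal[of 2 p] by (simp add: epow_mult)
    finally show "epow (maximal M f x) p = ennreal (2 powr p) * epow (maximal M f x / 2) p" .
  qed
  also have "\<dots> = ennreal (2 powr p) * (\<integral>\<^sup>+x. epow (maximal M f x / 2) p \<partial>M)"
    by (simp add: nn_integral_cmult)
  finally have outer: "(\<integral>\<^sup>+x. epow (maximal M f x) p \<partial>M)
    = ennreal (2 powr p) * (\<integral>\<^sup>+x. epow (maximal M f x / 2) p \<partial>M)" .
  have "(\<integral>\<^sup>+x. epow (maximal M f x / 2) p \<partial>M) =
      (\<integral>\<^sup>+x. (\<integral>\<^sup>+t. ennreal (p * t powr (p - 1)) *
          indicator {t. 0 < t \<and> ennreal t < maximal M f x / 2} t \<partial>lborel) \<partial>M)"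
    using p by (simp add: layer_cake)
  also have "\<dots> = (\<integral>\<^sup>+t. (\<integral>\<^sup>+x. ennreal (p * t powr (p - 1)) *
          indicator {t. 0 < t \<and> ennreal t < maximal M f x / 2} t \<partial>M) \<partial>lborel)"
    by (rule P.Fubini'[symmetric]) measurable
  also have "\<dots> \<le> (\<integral>\<^sup>+t. (\<integral>\<^sup>+x. ennreal (D * p / (p - 1)) * f x * (ennreal ((p - 1) * t powr (p - 1 - 1)) *
          indicator {t. 0 < t \<and> ennreal t < f x} t) \<partial>M) \<partial>lborel)"
  proof (rule nn_integral_mono)
    fix t :: real
    show "(\<integral>\<^sup>+x. ennreal (p * t powr (p - 1)) *
          indicator {t. 0 < t \<and> ennreal t < maximal M f x / 2} t \<partial>M)
      \<le> (\<integral>\<^sup>+x. ennreal (D * p / (p - 1)) * f x * (ennreal ((p - 1) * t powr (p - 1 - 1)) *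
          indicator {t. 0 < t \<and> ennreal t < f x} t) \<partial>M)"
    proof (cases "0 < t")
      case True
      have iff: "ennreal t < maximal M f x / 2 \<longleftrightarrow> 2 * ennreal t < maximal M f x" for x
        by (rule ennreal_less_divide_two)
      have "(\<integral>\<^sup>+x. ennreal (p * t powr (p - 1)) *
          indicator {t. 0 < t \<and> ennreal t < maximal M f x / 2} t \<partial>M)
        = (\<integral>\<^sup>+x. ennreal (p * t powr (p - 1)) *
          indicator {x. 2 * ennreal t < maximal M f x} x \<partial>M)"
        using True by (intro nn_integral_cong) (auto simp: indicator_def iff)
      also have "\<dots> = ennreal (p * t powr (p - 1)) * emeasure M {x. 2 * ennreal t < maximal M f x}"
        by (subst nn_integral_cmult) (auto simp: sets_eq_imp_space_eq[OF sets_M])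
      also have "\<dots> \<le> ennreal (p * t powr (p - 1)) *
           (ennreal D * (\<integral>\<^sup>+x\<in>{x. ennreal t < f x}. f x \<partial>M) / ennreal t)"
        using True by (intro mult_left_mono maximal_truncated_weak_type) auto
      also have "\<dots> = ennreal (p * t powr (p - 1) * D / t) * (\<integral>\<^sup>+x\<in>{x. ennreal t < f x}. f x \<partial>M)"
      proof -
        have "ennreal (p * t powr (p - 1) * D / t) = ennreal (p * t powr (p - 1)) * ennreal D / ennreal t"
          using True p D_pos by (simp add: divide_ennreal flip: ennreal_mult)
        then show ?thesis
          by (simp add: divide_ennreal_def mult_ac)
      qed
      also have "p * t powr (p - 1) * D / t = D * p / (p - 1) * ((p - 1) * t powr (p - 1 - 1))"
      proof -
        have "t powr (p - 1 - 1) = t powr (p - 1) / t"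
          using True by (subst powr_diff) simp
        then show ?thesis using p by simp
      qed
      also have "ennreal \<dots> = ennreal (D * p / (p - 1)) * ennreal ((p - 1) * t powr (p - 1 - 1))"
        using p D_pos by (intro ennreal_mult) auto
      also have "\<dots> * (\<integral>\<^sup>+x\<in>{x. ennreal t < f x}. f x \<partial>M) =
         (\<integral>\<^sup>+x. ennreal (D * p / (p - 1)) * f x * (ennreal ((p - 1) * t powr (p - 1 - 1)) *
          indicator {t. 0 < t \<and> ennreal t < f x} t) \<partial>M)"
        using True
        by (subst nn_integral_cmult[symmetric]) (auto intro!: nn_integral_cong simp: indicator_def mult_ac)
      finally show ?thesis .
    qed simp
  qed
  also have "\<dots> = (\<integral>\<^sup>+x. (\<integral>\<^sup>+t. ennreal (D * p / (p - 1)) * f x * (ennreal ((p - 1) * t powr (p - 1 - 1)) *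
          indicator {t. 0 < t \<and> ennreal t < f x} t) \<partial>lborel) \<partial>M)"
    by (rule P.Fubini') measurable
  also have "\<dots> = (\<integral>\<^sup>+x. ennreal (D * p / (p - 1)) * (f x * epow (f x) (p - 1)) \<partial>M)"
    using p layer_cake[of "p - 1"] by (intro nn_integral_cong) (simp add: nn_integral_cmult mult_ac)
  also have "\<dots> = ennreal (D * p / (p - 1)) * (\<integral>\<^sup>+x. epow (f x) p \<partial>M)"
  proof -
    have "f x * epow (f x) (p - 1) = epow (f x) p" for x
      using epow_add[of 1 "p - 1" "f x"] p by simp
    then show ?thesis by (simp add: nn_integral_cmult)
  qed
  finally have "(\<integral>\<^sup>+x. epow (maximal M f x) p \<partial>M)
      \<le> ennreal (2 powr p) * (ennreal (D * p / (p - 1)) * (\<integral>\<^sup>+x. epow (f x) p \<partial>M))"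
    unfolding outer by (rule mult_left_mono) simp
  also have "\<dots> = ennreal (2 powr p * (D * p / (p - 1))) * (\<integral>\<^sup>+x. epow (f x) p \<partial>M)"
    using p D_pos by (subst ennreal_mult) (auto simp: mult.assoc)
  finally show ?thesis by (simp add: mult.assoc)
qed

end

section \<open>Dyadic cubes\<close>

text \<open>Half-open, so that the dyadic subcubes of one generation are disjoint and cover the cube
  exactly.\<close>

definition hcube :: "'a::euclidean_space \<Rightarrow> real \<Rightarrow> 'a set" where
  "hcube a l = {x. \<forall>i\<in>Basis. a \<bullet> i \<le> x \<bullet> i \<and> x \<bullet> i < a \<bullet> i + l}"

lemma hcube_measurable [measurable]: "hcube a l \<in> sets borel"
proof -
  have "hcube a l = (\<Inter>i\<in>Basis. {x. x \<bullet> i \<ge> a \<bullet> i} \<inter> {x. x \<bullet> i < a \<bullet> i + l})"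
    unfolding hcube_def by blast
  then show ?thesis
    by (simp add: sets.finite_INT borel_closed borel_open closed_halfspace_component_ge
        open_halfspace_component_lt sets.Int)
qed

lemma emeasure_hcube:
  fixes a :: "'a::euclidean_space"
  assumes "0 \<le> l"
  shows "emeasure lborel (hcube a l) = ennreal (l ^ DIM('a))"
proof (rule antisym)
  have "emeasure lborel (hcube a l) \<le> emeasure lborel (cbox a (a + l *\<^sub>R One))"
    by (intro emeasure_mono) (auto simp: hcube_def mem_box inner_simps less_imp_le)
  also have "\<dots> = ennreal (l ^ DIM('a))"
    using assms by (subst emeasure_lborel_cbox) (auto simp: inner_simps)
  finally show "emeasure lborel (hcube a l) \<le> ennreal (l ^ DIM('a))" .
  have "ennreal (l ^ DIM('a)) = emeasure lborel (box a (a + l *\<^sub>R One))"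
    using assms by (subst emeasure_lborel_box) (auto simp: inner_simps)
  also have "\<dots> \<le> emeasure lborel (hcube a l)"
    by (intro emeasure_mono) (auto simp: hcube_def mem_box inner_simps less_imp_le)
  finally show "ennreal (l ^ DIM('a)) \<le> emeasure lborel (hcube a l)" .
qed

lemma ball_subset_hcube: "ball c r \<subseteq> hcube (c - r *\<^sub>R One) (2 * r)"
proof
  fix x assume "x \<in> ball c r"
  then have "\<bar>(x - c) \<bullet> i\<bar> < r" if "i \<in> Basis" for i
    using Basis_le_norm[OF that, of "x - c"] by (simp add: dist_norm norm_minus_commute)
  then show "x \<in> hcube (c - r *\<^sub>R One) (2 * r)"
    by (auto simp: hcube_def inner_simps abs_less_iff algebra_simps less_imp_le)
qed

lemma hcube_subset_ball:
  fixes a :: "'a::euclidean_space"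
  assumes "0 < l"
  shows "hcube a l \<subseteq> ball (a + (l / 2) *\<^sub>R One) (l * DIM('a))"
proof
  fix x assume x: "x \<in> hcube a l"
  have "norm (a + (l / 2) *\<^sub>R One - x) \<le> (\<Sum>i\<in>Basis. \<bar>(a + (l / 2) *\<^sub>R One - x) \<bullet> i\<bar>)"
    by (rule norm_le_l1)
  also have "\<dots> \<le> (\<Sum>i\<in>(Basis::'a set). l / 2)"
  proof (intro sum_mono)
    fix i :: 'a assume i: "i \<in> Basis"
    then have "a \<bullet> i \<le> x \<bullet> i" "x \<bullet> i < a \<bullet> i + l"
      using x by (auto simp: hcube_def)
    moreover have "(a + (l / 2) *\<^sub>R One - x) \<bullet> i = a \<bullet> i + l / 2 - x \<bullet> i"
      using i by (simp add: inner_simps)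
    ultimately show "\<bar>(a + (l / 2) *\<^sub>R One - x) \<bullet> i\<bar> \<le> l / 2"
      by linarith
  qed
  also have "\<dots> < l * DIM('a)"
    using assms by simp
  finally show "x \<in> ball (a + (l / 2) *\<^sub>R One) (l * DIM('a))"
    by (simp add: dist_norm)
qed

text \<open>The cells of each generation tile the whole space, anchored at the corner
  \<open>a\<close>; the cell of generation 0 that contains a point of \<open>hcube a l\<close> is
  this cube itself. Cells are handled through integer indices, so that nestedness and disjointness
  reduce to equality of indices.\<close>

locale dyadic_grid =
  fixes a :: "'a::euclidean_space" and l :: real
  assumes l_pos: "0 < l"
begin

text \<open>Restricting the function to \<open>Basis\<close> makes it extensional, which leaves only
  countably many indices.\<close>

definition index :: "nat \<Rightarrow> 'a \<Rightarrow> 'a \<Rightarrow> int" where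
  "index k x = (\<lambda>i\<in>Basis. \<lfloor>(x \<bullet> i - a \<bullet> i) / (l / 2 ^ k)\<rfloor>)"

definition corner :: "nat \<Rightarrow> ('a \<Rightarrow> int) \<Rightarrow> 'a" where
  "corner k m = a + (\<Sum>i\<in>Basis. (l / 2 ^ k * real_of_int (m i)) *\<^sub>R i)"

definition cell :: "nat \<Rightarrow> 'a \<Rightarrow> 'a set" where
  "cell k x = hcube (corner k (index k x)) (l / 2 ^ k)"

lemma index_eq_iff:
  "index k y = index k x \<longleftrightarrow> (\<forall>i\<in>Basis. \<lfloor>(y \<bullet> i - a \<bullet> i) / (l / 2 ^ k)\<rfloor> = \<lfloor>(x \<bullet> i - a \<bullet> i) / (l / 2 ^ k)\<rfloor>)"
proof
  assume eq: "index k y = index k x"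
  show "\<forall>i\<in>Basis. \<lfloor>(y \<bullet> i - a \<bullet> i) / (l / 2 ^ k)\<rfloor> = \<lfloor>(x \<bullet> i - a \<bullet> i) / (l / 2 ^ k)\<rfloor>"
  proof
    fix i :: 'a assume "i \<in> Basis"
    then show "\<lfloor>(y \<bullet> i - a \<bullet> i) / (l / 2 ^ k)\<rfloor> = \<lfloor>(x \<bullet> i - a \<bullet> i) / (l / 2 ^ k)\<rfloor>"
      using fun_cong[OF eq, of i] by (simp only: index_def restrict_apply if_True)
  qed
next
  assume *: "\<forall>i\<in>Basis. \<lfloor>(y \<bullet> i - a \<bullet> i) / (l / 2 ^ k)\<rfloor> = \<lfloor>(x \<bullet> i - a \<bullet> i) / (l / 2 ^ k)\<rfloor>"
  show "index k y = index k x"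
    unfolding index_def by (rule restrict_ext) (use * in blast)
qed

lemma mem_cell_iff: "y \<in> cell k x \<longleftrightarrow> index k y = index k x"
proof -
  have *: "A + t * m \<le> z \<and> z < A + t * m + t \<longleftrightarrow> m \<le> (z - A) / t \<and> (z - A) / t < m + 1"
    if "0 < t" for A t m z :: real
    using that by (auto simp: pos_le_divide_eq pos_divide_less_eq algebra_simps)
  have corner: "corner k (index k x) \<bullet> i = a \<bullet> i + l / 2 ^ k * real_of_int (index k x i)"
    if "i \<in> Basis" for i
    using that by (simp add: corner_def inner_simps)
  have "y \<in> cell k x \<longleftrightarrow> (\<forall>i\<in>Basis. a \<bullet> i + l / 2 ^ k * real_of_int (index k x i) \<le> y \<bullet> i
       \<and> y \<bullet> i < a \<bullet> i + l / 2 ^ k * real_of_int (index k x i) + l / 2 ^ k)"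
    unfolding cell_def hcube_def mem_Collect_eq using corner by (intro ball_cong) simp_all
  also have "\<dots> \<longleftrightarrow> (\<forall>i\<in>Basis. real_of_int (index k x i) \<le> (y \<bullet> i - a \<bullet> i) / (l / 2 ^ k)
       \<and> (y \<bullet> i - a \<bullet> i) / (l / 2 ^ k) < real_of_int (index k x i) + 1)"
    using l_pos by (intro ball_cong * refl) simp
  also have "\<dots> \<longleftrightarrow> (\<forall>i\<in>Basis. \<lfloor>(y \<bullet> i - a \<bullet> i) / (l / 2 ^ k)\<rfloor> = index k x i)"
    by (intro ball_cong refl) (simp only: floor_eq_iff)
  also have "\<dots> \<longleftrightarrow> index k y = index k x"
    unfolding index_eq_iff by (intro ball_cong refl) (simp only: index_def restrict_apply if_True)
  finally show ?thesis .
qed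

text \<open>Passing to the parent halves the scaled coordinate, and the floor of a half is the
  integer half of the floor.\<close>

lemma index_coarser:
  assumes "index (Suc k) y = index (Suc k) x"
  shows "index k y = index k x"
proof -
  have "\<lfloor>(z \<bullet> i - a \<bullet> i) / (l / 2 ^ k)\<rfloor> = \<lfloor>(z \<bullet> i - a \<bullet> i) / (l / 2 ^ Suc k)\<rfloor> div 2" for z i
  proof -
    have "(z \<bullet> i - a \<bullet> i) / (l / 2 ^ k) = (z \<bullet> i - a \<bullet> i) / (l / 2 ^ Suc k) / real_of_int 2"
      by simp
    then show ?thesis
      by (simp only: floor_divide_real_eq_div zero_le_numeral)
  qed
  then show ?thesis
    using assms unfolding index_eq_iff by simp
qed

lemma index_mono: "j \<le> k \<Longrightarrow> index k y = index k x \<Longrightarrow> index j y = index j x"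
proof (induction rule: dec_induct)
  case (step n)
  show ?case by (rule step.IH, rule index_coarser, rule step.prems)
qed

lemma cell_antimono: "j \<le> k \<Longrightarrow> cell k x \<subseteq> cell j x"
  by (intro subsetI) (unfold mem_cell_iff, rule index_mono)

lemma cell_0: "x \<in> hcube a l \<Longrightarrow> cell 0 x = hcube a l"
proof -
  assume "x \<in> hcube a l"
  then have "index 0 x = (\<lambda>i\<in>Basis. 0)"
    using l_pos by (auto simp: index_def hcube_def restrict_def fun_eq_iff floor_eq_iff field_simps)
  then show ?thesis
    by (simp add: cell_def corner_def)
qed

lemma cell_small:
  assumes "open U" "x \<in> U"
  shows "\<exists>k. cell k x \<subseteq> U"
proof -
  obtain e where e: "0 < e" "ball x e \<subseteq> U"
    using assms openE by blast
  obtain k where k: "l * DIM('a) / e < 2 ^ k"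
    using real_arch_pow[of 2 "l * DIM('a) / e"] by auto
  have "cell k x \<subseteq> ball x e"
  proof
    fix y assume "y \<in> cell k x"
    have "x \<in> cell k x" by (simp add: mem_cell_iff)
    have y: "\<bar>(x - y) \<bullet> i\<bar> \<le> l / 2 ^ k" if "i \<in> Basis" for i
    proof -
      define m where "m = corner k (index k x) \<bullet> i"
      have "m \<le> x \<bullet> i" "x \<bullet> i < m + l / 2 ^ k" "m \<le> y \<bullet> i" "y \<bullet> i < m + l / 2 ^ k"
        using \<open>x \<in> cell k x\<close> \<open>y \<in> cell k x\<close> that by (auto simp: cell_def hcube_def m_def)
      then show ?thesis
        unfolding inner_diff_left by linarith
    qed
    have "norm (x - y) \<le> (\<Sum>i\<in>Basis. \<bar>(x - y) \<bullet> i\<bar>)"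
      by (rule norm_le_l1)
    also have "\<dots> \<le> (\<Sum>i\<in>(Basis::'a set). l / 2 ^ k)"
      by (intro sum_mono y)
    also have "\<dots> < e"
      using k e by (simp add: field_simps)
    finally show "y \<in> ball x e" by (simp add: dist_norm)
  qed
  with e show ?thesis by blast
qed

end

text \<open>Every point of an open set lies in a small dyadic cube contained in the set, so the
  maximal cubes of density at least \<open>2\<^sup>-\<^sup>n\<^sup>-\<^sup>1\<close> cover it without any differentiation theorem.\<close>

lemma Calderon_Zygmund_cubes:
  fixes a :: "'a::euclidean_space"
  assumes U: "open U" and l: "0 < l"
    and small: "2 ^ (DIM('a) + 1) * measure lborel (U \<inter> hcube a l) \<le> l ^ DIM('a)"
  obtains I where "countable I" "\<And>c r. (c, r) \<in> I \<Longrightarrow> 0 < r \<and> hcube c r \<subseteq> hcube a l"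
    "disjoint_family_on (\<lambda>i. hcube (fst i) (snd i)) I"
    "U \<inter> hcube a l \<subseteq> (\<Union>i\<in>I. hcube (fst i) (snd i))"
    "\<And>c r. (c, r) \<in> I \<Longrightarrow> 2 * measure lborel (U \<inter> hcube c r) \<le> r ^ DIM('a)"
    "\<And>c r. (c, r) \<in> I \<Longrightarrow> r ^ DIM('a) < 2 ^ (DIM('a) + 1) * measure lborel (U \<inter> hcube c r)"
proof -
  interpret dyadic_grid a l by standard (rule l)
  have [measurable]: "U \<in> sets borel" using U by simp
  have fin: "emeasure lborel (V \<inter> hcube c r) < \<infinity>" if "0 \<le> r" for V and c :: 'a and r
  proof -
    have "emeasure lborel (V \<inter> hcube c r) \<le> emeasure lborel (hcube c r)"
      by (intro emeasure_mono) auto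
    with that show ?thesis by (simp add: emeasure_hcube le_less_trans)
  qed
  have mono: "measure lborel (U \<inter> hcube c r) \<le> measure lborel (U \<inter> hcube c' r')"
    if "hcube c r \<subseteq> hcube c' r'" "0 \<le> r'" for c c' :: 'a and r r'
    using that fin[OF that(2), of U c'] unfolding measure_def
    by (intro enn2real_mono emeasure_mono) auto
  \<comment> \<open>\<open>P k x\<close> says that U fills more than the fraction 2^-(n+1) of the
    cell. The stopping generation \<open>\<kappa>\<close> is the first at which this happens; a cell
    lying inside U passes the test, so it exists on U.\<close>
  define P where "P k x \<longleftrightarrow> (l / 2 ^ k) ^ DIM('a) < 2 ^ (DIM('a) + 1) * measure lborel (U \<inter> cell k x)"
    for k x
  define \<kappa> where "\<kappa> x = (LEAST k. P k x)" for x
  have ex: "\<exists>k. P k x" if x: "x \<in> U" for x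
  proof -
    obtain k where "cell k x \<subseteq> U" using cell_small[OF U x] by blast
    then have "U \<inter> cell k x = cell k x" by auto
    moreover have "measure lborel (cell k x) = (l / 2 ^ k) ^ DIM('a)"
      unfolding cell_def measure_def using l by (subst emeasure_hcube) auto
    moreover have "(l / 2 ^ k) ^ DIM('a) < 2 ^ (DIM('a) + 1) * (l / 2 ^ k) ^ DIM('a)"
      using l mult_strict_right_mono[of 1 "2 ^ (DIM('a) + 1)" "(l / 2 ^ k) ^ DIM('a)"]
        one_less_power[of "2::real" "DIM('a) + 1"] by simp
    ultimately have "P k x" unfolding P_def by simp
    then show ?thesis ..
  qed
  have P\<kappa>: "P (\<kappa> x) x" if "x \<in> U" for x
    unfolding \<kappa>_def using ex[OF that] by (rule LeastI_ex)
  have \<kappa>_le: "P k x \<Longrightarrow> \<kappa> x \<le> k" for k x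
    unfolding \<kappa>_def by (rule Least_le)
  have Pcong: "P k x \<longleftrightarrow> P k y" if "index k x = index k y" for k x y
    using that by (simp add: P_def cell_def)
  define g where "g x = (corner (\<kappa> x) (index (\<kappa> x) x), l / 2 ^ \<kappa> x)" for x
  define I where "I = g ` (U \<inter> hcube a l)"
  have gcell: "hcube (fst (g x)) (snd (g x)) = cell (\<kappa> x) x" for x
    by (simp add: g_def cell_def)
  \<comment> \<open>If two selected cells meet, y has the same index as x at the coarser generation
    and passes the density test there. Minimality of the stopping generation of y then makes the
    generations, and with them the cells, equal.\<close>
  have geq: "g x = g y" if "x \<in> U" "y \<in> U" "\<kappa> x \<le> \<kappa> y" "z \<in> cell (\<kappa> x) x" "z \<in> cell (\<kappa> y) y" for x y z
  proof -
    have i: "index (\<kappa> x) y = index (\<kappa> x) x"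
      using that(4,5) index_mono[OF that(3), of z y] unfolding mem_cell_iff by simp
    then have "P (\<kappa> x) y" using P\<kappa>[OF that(1)] Pcong by blast
    then have "\<kappa> y = \<kappa> x" using \<kappa>_le that(3) by fastforce
    then show ?thesis using i by (simp add: g_def)
  qed
  show thesis
  proof (rule that[of I])
    have "g x \<in> (\<lambda>(k, m). (corner k m, l / 2 ^ k)) ` (UNIV \<times> (Basis \<rightarrow>\<^sub>E UNIV))" for x
      unfolding g_def by (rule image_eqI[of _ _ "(\<kappa> x, index (\<kappa> x) x)"]) (auto simp: index_def)
    then have "I \<subseteq> (\<lambda>(k, m). (corner k m, l / 2 ^ k)) ` (UNIV \<times> (Basis \<rightarrow>\<^sub>E UNIV))"
      by (auto simp: I_def)
    then show "countable I"
      by (rule countable_subset) (intro countable_image countable_SIGMA countable_PiE; simp)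
    show "disjoint_family_on (\<lambda>i. hcube (fst i) (snd i)) I"
      unfolding disjoint_family_on_def
    proof (intro ballI impI)
      fix i j assume "i \<in> I" "j \<in> I" and ne: "i \<noteq> j"
      then obtain x y where xy: "x \<in> U" "y \<in> U" "i = g x" "j = g y"
        unfolding I_def by blast
      show "hcube (fst i) (snd i) \<inter> hcube (fst j) (snd j) = {}"
      proof (rule ccontr)
        assume "\<not> ?thesis"
        then obtain z where "z \<in> cell (\<kappa> x) x" "z \<in> cell (\<kappa> y) y"
          using xy gcell by blast
        then have "g x = g y"
          using geq[of x y z] geq[of y x z] xy(1,2) by (metis nat_le_linear)
        with ne xy show False by simp
      qed
    qed
    show "U \<inter> hcube a l \<subseteq> (\<Union>i\<in>I. hcube (fst i) (snd i))"
    proof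
      fix x assume "x \<in> U \<inter> hcube a l"
      then have "g x \<in> I" "x \<in> hcube (fst (g x)) (snd (g x))"
        by (simp_all only: I_def gcell mem_cell_iff imageI)
      then show "x \<in> (\<Union>i\<in>I. hcube (fst i) (snd i))" by blast
    qed
  next
    fix c r assume "(c, r) \<in> I"
    then obtain x where x: "x \<in> U" "x \<in> hcube a l" "(c, r) = g x"
      by (auto simp: I_def)
    have cr: "hcube c r = cell (\<kappa> x) x" "r = l / 2 ^ \<kappa> x"
      using gcell[of x] x(3)[symmetric] by (simp_all add: g_def)
    show "0 < r \<and> hcube c r \<subseteq> hcube a l"
      using l cell_antimono[of 0 "\<kappa> x" x] cell_0[OF x(2)] cr by auto
    show "r ^ DIM('a) < 2 ^ (DIM('a) + 1) * measure lborel (U \<inter> hcube c r)"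
      using P\<kappa>[OF x(1)] unfolding P_def cr(1) unfolding cr(2) .
    \<comment> \<open>The hypothesis \<open>small\<close> rules out stopping at the cube itself. The
      parent therefore exists and fails the test; its volume is 2^n times that of the cell, which
      turns the threshold 2^-(n+1) into density at most 1/2.\<close>
    have "\<kappa> x \<noteq> 0"
    proof
      assume "\<kappa> x = 0"
      then show False
        using P\<kappa>[OF x(1)] small by (simp add: P_def cell_0[OF x(2)])
    qed
    then obtain k where k: "\<kappa> x = Suc k" using not0_implies_Suc by blast
    have "\<not> P k x" using \<kappa>_le[of k x] unfolding k by linarith
    then have "2 ^ (DIM('a) + 1) * measure lborel (U \<inter> cell k x) \<le> (2 * r) ^ DIM('a)"
      unfolding P_def not_less cr(2) k by (simp add: power_divide)
    moreover have "measure lborel (U \<inter> hcube c r) \<le> measure lborel (U \<inter> cell k x)"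
      using cell_antimono[of k "\<kappa> x" x] k l unfolding cr(1) unfolding cell_def
      by (intro mono) auto
    ultimately have "2 ^ (DIM('a) + 1) * measure lborel (U \<inter> hcube c r) \<le> (2 * r) ^ DIM('a)"
      by (meson mult_left_mono order_trans zero_le_numeral zero_le_power)
    then show "2 * measure lborel (U \<inter> hcube c r) \<le> r ^ DIM('a)"
      by (simp add: power_mult_distrib)
  qed
qed

section \<open>The John-Nirenberg inequality for measures satisfying the A-infinity condition\<close>

text \<open>Under equality f - K would have integral zero over E and so vanish a.e. there, although
  it is positive on a set of positive measure. The strict inequality is what contradicts an
  oscillation bound that may be exactly attained.\<close>

lemma mult_emeasure_less_nn_integral:
  fixes K :: ennreal
  assumes f: "f \<in> borel_measurable M" and E: "E \<in> sets M" "emeasure M E \<noteq> 0"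
    and le: "\<And>x. x \<in> E \<Longrightarrow> K < f x" and KE: "K < top" "emeasure M E < top"
  shows "K * emeasure M E < (\<integral>\<^sup>+x\<in>E. f x \<partial>M)"
proof (rule ccontr)
  assume "\<not> ?thesis"
  then have *: "(\<integral>\<^sup>+x\<in>E. f x \<partial>M) \<le> K * emeasure M E" by simp
  have "(\<integral>\<^sup>+x\<in>E. f x \<partial>M) = (\<integral>\<^sup>+x\<in>E. (f x - K) \<partial>M) + (\<integral>\<^sup>+x\<in>E. K \<partial>M)"
    using f E le
    by (subst nn_integral_add[symmetric])
       (auto intro!: nn_integral_cong simp: indicator_def diff_add_cancel_ennreal less_imp_le)
  then have "(\<integral>\<^sup>+x\<in>E. (f x - K) \<partial>M) + K * emeasure M E \<le> 0 + K * emeasure M E"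
    using * E by (simp add: nn_integral_cmult_indicator)
  then have "(\<integral>\<^sup>+x\<in>E. (f x - K) \<partial>M) = 0"
    using ennreal_mult_less_top[of K "emeasure M E"] KE by (auto simp: top.not_eq_extremum)
  then have "AE x in M. (f x - K) * indicator E x = 0"
    using f E by (subst (asm) nn_integral_0_iff_AE) auto
  then have "AE x in M. x \<notin> E"
  proof eventually_elim
    fix x assume "(f x - K) * indicator E x = 0"
    then show "x \<notin> E"
      using le[of x] by (auto simp: indicator_def diff_eq_0_iff_ennreal split: if_splits)
  qed
  then show False
    using E AE_iff_measurable[OF E(1), of "\<lambda>x. x \<notin> E"] sets.sets_into_space[OF E(1)] by auto
qed

text \<open>Oscillation is measured by Lebesgue measure, level sets by \<open>M\<close>. The last
  assumption links them: a subset with at most half the volume of a cube carries at most the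
  fraction \<delta> < 1 of its \<open>M\<close>-mass. The constants c are arbitrary instead of mean
  values, so each cube may use its own.\<close>

locale John_Nirenberg =
  fixes M :: "'a::euclidean_space measure" and \<beta> :: "'a \<Rightarrow> real" and D \<delta> :: real
  assumes sets_M [measurable_cong]: "sets M = sets borel"
    and \<beta> [measurable]: "\<beta> \<in> borel_measurable borel"
    and D_pos: "0 < D" and \<delta>: "0 < \<delta>" "\<delta> < 1"
    and osc: "0 < l \<Longrightarrow> \<exists>c. (\<integral>\<^sup>+x\<in>hcube a l. ennreal \<bar>\<beta> x - c\<bar> \<partial>lborel) \<le> ennreal (D * l ^ DIM('a))"
    and A_infinity: "0 < l \<Longrightarrow> E \<in> sets borel \<Longrightarrow> E \<subseteq> hcube a l \<Longrightarrow>
      2 * emeasure lborel E \<le> ennreal (l ^ DIM('a)) \<Longrightarrow> emeasure M E \<le> ennreal \<delta> * emeasure M (hcube a l)"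
begin

text \<open>The drop in level per generation. The part 2^(n+3) D makes the exceptional set small by
  Chebyshev's inequality; the part 4 D leaves room to compare the constants of a cube and of a
  selected subcube.\<close>

definition L :: real where "L = (2 ^ (DIM('a) + 3) + 4) * D"

lemma L_pos: "0 < L"
  using D_pos by (simp add: L_def add_pos_pos)

text \<open>The induction runs over all cubes and all admissible constants at once, since the
  selected subcubes carry constants of their own. A point where |\<beta> - c| is large lies in a
  selected cube; moving to the constant of that cube costs one level \<open>L\<close>, and the
  selected cubes together carry at most the fraction \<delta> of the \<open>M\<close>-mass.\<close>

lemma decay:
  assumes "0 < l" "(\<integral>\<^sup>+x\<in>hcube a l. ennreal \<bar>\<beta> x - c\<bar> \<partial>lborel) \<le> ennreal (D * l ^ DIM('a))"
  shows "emeasure M {x \<in> hcube a l. real k * L < \<bar>\<beta> x - c\<bar>} \<le> ennreal (\<delta> ^ k) * emeasure M (hcube a l)"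
  using assms
proof (induction k arbitrary: a l c)
  case 0
  then show ?case
    by (simp add: emeasure_mono sets_M)
next
  case (Suc k)
  note l = Suc.prems(1) and c = Suc.prems(2)
  define n where "n = DIM('a)"
  define \<Lambda> where "\<Lambda> = 2 ^ (n + 3) * D"
  have \<Lambda>: "0 < \<Lambda>" "L = \<Lambda> + 4 * D"
    using D_pos by (simp_all add: \<Lambda>_def L_def n_def algebra_simps)
  define S where "S = {x \<in> hcube a l. \<Lambda> < \<bar>\<beta> x - c\<bar>}"
  have [measurable]: "S \<in> sets borel"
    unfolding S_def using hcube_measurable[of a l] by measurable
  have "ennreal \<Lambda> * emeasure lborel S = (\<integral>\<^sup>+x. ennreal \<Lambda> * indicator S x \<partial>lborel)"
    by (simp add: nn_integral_cmult_indicator)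
  also have "\<dots> \<le> (\<integral>\<^sup>+x\<in>hcube a l. ennreal \<bar>\<beta> x - c\<bar> \<partial>lborel)"
    by (intro nn_integral_mono) (auto simp: S_def indicator_def intro!: ennreal_leI)
  also have "\<dots> \<le> ennreal (D * l ^ n)" using c by (simp add: n_def)
  also have "\<dots> = ennreal \<Lambda> * ennreal (l ^ n / 2 ^ (n + 3))"
    using D_pos l by (simp add: \<Lambda>_def flip: ennreal_mult)
  finally have S_small: "emeasure lborel S \<le> ennreal (l ^ n / 2 ^ (n + 3))"
    using \<Lambda> by (simp add: ennreal_mult_le_mult_iff)
  \<comment> \<open>The stopping argument requires an open set. Its excess over S is kept below the
    Chebyshev bound for S, so |U| is at most 2^-(n+2) times the volume of the cube, and the selected
    cubes, each with density above 2^-(n+1), fill at most half of it.\<close>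
  obtain U where U: "open U" "S \<subseteq> U" "emeasure lebesgue (U - S) < ennreal (l ^ n / 2 ^ (n + 3))"
    using sets_lebesgue_outer_open[of S "l ^ n / 2 ^ (n + 3)"] l by auto
  have [measurable]: "U \<in> sets borel" using U by simp
  have "emeasure lborel U \<le> emeasure lborel S + emeasure lborel (U - S)"
    using U by (subst emeasure_Un_Int) (auto simp: Un_absorb1 )
  also have "\<dots> \<le> ennreal (l ^ n / 2 ^ (n + 3)) + ennreal (l ^ n / 2 ^ (n + 3))"
    using U by (intro add_mono S_small) (simp add: less_imp_le)
  also have "\<dots> = ennreal (l ^ n / 2 ^ (n + 2))"
    using l by (simp add: field_simps power_add flip: ennreal_plus)
  finally have U_small: "emeasure lborel U \<le> ennreal (l ^ n / 2 ^ (n + 2))" .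
  have UI: "measure lborel (U \<inter> hcube a l) \<le> l ^ n / 2 ^ (n + 2)"
    using l order_trans[OF emeasure_mono[of "U \<inter> hcube a l" U lborel] U_small]
    by (simp add: measure_def enn2real_leI)
  have "2 ^ (n + 1) * measure lborel (U \<inter> hcube a l) \<le> 2 ^ (n + 1) * (l ^ n / 2 ^ (n + 2))"
    by (intro mult_left_mono UI) simp
  also have "\<dots> \<le> l ^ n" using l by simp
  finally have small: "2 ^ (DIM('a) + 1) * measure lborel (U \<inter> hcube a l) \<le> l ^ DIM('a)"
    by (simp add: n_def)
  obtain I where I: "countable I" "\<And>c r. (c, r) \<in> I \<Longrightarrow> 0 < r \<and> hcube c r \<subseteq> hcube a l"
    "disjoint_family_on (\<lambda>i. hcube (fst i) (snd i)) I"
    "U \<inter> hcube a l \<subseteq> (\<Union>i\<in>I. hcube (fst i) (snd i))"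
    "\<And>c r. (c, r) \<in> I \<Longrightarrow> 2 * measure lborel (U \<inter> hcube c r) \<le> r ^ DIM('a)"
    "\<And>c r. (c, r) \<in> I \<Longrightarrow> r ^ DIM('a) < 2 ^ (DIM('a) + 1) * measure lborel (U \<inter> hcube c r)"
    by (rule Calderon_Zygmund_cubes[OF U(1) l small]) (rule that; (assumption | blast))
  define E where "E = (\<Union>i\<in>I. hcube (fst i) (snd i))"
  have [measurable]: "E \<in> sets borel"
    unfolding E_def using I(1) by (intro sets.countable_UN'') auto
  have fin: "emeasure lborel (V \<inter> hcube z r) < top" if "0 \<le> r" for V and z :: 'a and r
    using that le_less_trans[OF emeasure_mono[of "V \<inter> hcube z r" "hcube z r" lborel]]
    by (simp add: emeasure_hcube)
  have E_half: "2 * emeasure lborel E \<le> ennreal (l ^ n)"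
  proof -
    have "emeasure lborel E = (\<integral>\<^sup>+i. emeasure lborel (hcube (fst i) (snd i)) \<partial>count_space I)"
      unfolding E_def using I by (intro emeasure_UN_countable) auto
    also have "\<dots> \<le> (\<integral>\<^sup>+i. ennreal (2 ^ (n + 1)) * emeasure lborel (U \<inter> hcube (fst i) (snd i)) \<partial>count_space I)"
    proof (rule nn_integral_mono)
      fix i assume "i \<in> space (count_space I)"
      then have i: "(fst i, snd i) \<in> I" by simp
      then have "0 < snd i" using I(2) by blast
      then have "emeasure lborel (hcube (fst i) (snd i)) = ennreal (snd i ^ n)"
        by (simp add: emeasure_hcube n_def)
      also have "\<dots> \<le> ennreal (2 ^ (n + 1) * measure lborel (U \<inter> hcube (fst i) (snd i)))"
        using I(6)[OF i] by (intro ennreal_leI) (simp add: n_def)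
      also have "\<dots> = ennreal (2 ^ (n + 1)) * emeasure lborel (U \<inter> hcube (fst i) (snd i))"
        using fin[of "snd i" U "fst i"] \<open>0 < snd i\<close>
        by (subst emeasure_eq_ennreal_measure) (auto simp: ennreal_mult)
      finally show "emeasure lborel (hcube (fst i) (snd i))
          \<le> ennreal (2 ^ (n + 1)) * emeasure lborel (U \<inter> hcube (fst i) (snd i))" .
    qed
    also have "\<dots> = ennreal (2 ^ (n + 1)) * emeasure lborel (\<Union>i\<in>I. U \<inter> hcube (fst i) (snd i))"
    proof -
      have "disjoint_family_on (\<lambda>i. U \<inter> hcube (fst i) (snd i)) I"
        using I(3) unfolding disjoint_family_on_def by blast
      then show ?thesis
        using I(1) by (subst emeasure_UN_countable) (auto simp: nn_integral_cmult)
    qed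
    also have "\<dots> \<le> ennreal (2 ^ (n + 1)) * emeasure lborel U"
      by (intro mult_left_mono emeasure_mono) auto
    also have "\<dots> \<le> ennreal (2 ^ (n + 1)) * ennreal (l ^ n / 2 ^ (n + 2))"
      by (intro mult_left_mono U_small) simp
    also have "\<dots> = ennreal (l ^ n / 2)"
      using l by (simp flip: ennreal_mult)
    finally have "2 * emeasure lborel E \<le> 2 * ennreal (l ^ n / 2)"
      by (rule mult_left_mono) simp
    also have "2 * ennreal (l ^ n / 2) = ennreal (2 * (l ^ n / 2))"
      using l by (subst ennreal_mult) auto
    finally show ?thesis by simp
  qed
  have "E \<subseteq> hcube a l"
    unfolding E_def using I(2) by force
  then have ME: "emeasure M E \<le> ennreal \<delta> * emeasure M (hcube a l)"
    using A_infinity[OF l, of E a] E_half by (simp add: n_def)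
  have "{x \<in> hcube a l. real (Suc k) * L < \<bar>\<beta> x - c\<bar>}
      \<subseteq> (\<Union>i\<in>I. {x \<in> hcube (fst i) (snd i). real (Suc k) * L < \<bar>\<beta> x - c\<bar>})"
  proof
    fix x assume x: "x \<in> {x \<in> hcube a l. real (Suc k) * L < \<bar>\<beta> x - c\<bar>}"
    have "\<Lambda> \<le> L" using \<Lambda> D_pos by simp
    also have "L \<le> real (Suc k) * L" using L_pos by (simp add: algebra_simps)
    finally have "x \<in> S" using x by (simp add: S_def)
    then have "x \<in> U \<inter> hcube a l" using U x by auto
    then show "x \<in> (\<Union>i\<in>I. {x \<in> hcube (fst i) (snd i). real (Suc k) * L < \<bar>\<beta> x - c\<bar>})"
      using I(4) x by blast
  qed
  then have "emeasure M {x \<in> hcube a l. real (Suc k) * L < \<bar>\<beta> x - c\<bar>}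
     \<le> emeasure M (\<Union>i\<in>I. {x \<in> hcube (fst i) (snd i). real (Suc k) * L < \<bar>\<beta> x - c\<bar>})"
    using I(1) by (intro emeasure_mono) (auto simp: sets_M intro!: sets.countable_UN'')
  also have "\<dots> \<le> (\<integral>\<^sup>+i. emeasure M {x \<in> hcube (fst i) (snd i). real (Suc k) * L < \<bar>\<beta> x - c\<bar>} \<partial>count_space I)"
    using I(1) by (intro emeasure_UN_le_count_space) (auto simp: sets_M)
  also have "\<dots> \<le> (\<integral>\<^sup>+i. ennreal (\<delta> ^ k) * emeasure M (hcube (fst i) (snd i)) \<partial>count_space I)"
  proof (rule nn_integral_mono)
    fix i assume "i \<in> space (count_space I)"
    then have i: "(fst i, snd i) \<in> I" by simp
    define z r where "z = fst i" and "r = snd i"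
    have zr: "(z, r) \<in> I" using i by (simp add: z_def r_def)
    have r: "0 < r" "hcube z r \<subseteq> hcube a l" using I(2)[OF zr] by auto
    obtain c' where c': "(\<integral>\<^sup>+x\<in>hcube z r. ennreal \<bar>\<beta> x - c'\<bar> \<partial>lborel) \<le> ennreal (D * r ^ DIM('a))"
      using osc[OF r(1)] by blast
    text \<open>At least half of the cube lies outside \<open>U\<close>, where \<open>\<beta>\<close> is close to \<open>c\<close>.\<close>
    have "\<bar>c - c'\<bar> \<le> L"
    proof (rule ccontr)
      assume "\<not> \<bar>c - c'\<bar> \<le> L"
      then have far: "ennreal (2 * D) < ennreal \<bar>\<beta> x - c'\<bar>" if "x \<in> hcube z r - U" for x
      proof -
        have "x \<notin> S" "x \<in> hcube a l" using that U r by auto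
        then have "\<bar>\<beta> x - c\<bar> \<le> \<Lambda>" by (simp add: S_def not_less)
        then have "2 * D < \<bar>\<beta> x - c'\<bar>"
          using \<open>\<not> \<bar>c - c'\<bar> \<le> L\<close> \<Lambda> D_pos by linarith
        then show ?thesis using D_pos by (simp add: ennreal_less_iff)
      qed
      have "measure lborel (hcube z r) = r ^ n"
        using r by (simp add: measure_def emeasure_hcube n_def)
      moreover have "measure lborel (hcube z r - U) = measure lborel (hcube z r) - measure lborel (U \<inter> hcube z r)"
        using fin[of r UNIV z] r measure_Diff[of lborel "hcube z r" "U \<inter> hcube z r"]
        by (simp add: Diff_Int less_top)
      ultimately have half: "r ^ n / 2 \<le> measure lborel (hcube z r - U)"
        using I(5)[OF zr] by (simp add: n_def)
      have fin': "emeasure lborel (hcube z r - U) < top"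
        using fin[of r "- U" z] r by (simp add: Diff_eq Int_commute)
      have "0 < measure lborel (hcube z r - U)"
        using half r by (intro less_le_trans[OF _ half]) simp
      then have "ennreal (2 * D) * emeasure lborel (hcube z r - U)
          < (\<integral>\<^sup>+x\<in>hcube z r - U. ennreal \<bar>\<beta> x - c'\<bar> \<partial>lborel)"
        using fin' by (intro mult_emeasure_less_nn_integral far) (auto simp: measure_def)
      also have "\<dots> \<le> (\<integral>\<^sup>+x\<in>hcube z r. ennreal \<bar>\<beta> x - c'\<bar> \<partial>lborel)"
        by (intro nn_integral_mono) (auto simp: indicator_def)
      also have "\<dots> \<le> ennreal (2 * D) * ennreal (r ^ n / 2)"
        using c' D_pos r by (simp add: n_def flip: ennreal_mult)
      also have "\<dots> \<le> ennreal (2 * D) * emeasure lborel (hcube z r - U)"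
        using half fin' by (intro mult_left_mono) (auto simp: emeasure_eq_ennreal_measure intro!: ennreal_leI)
      finally show False by simp
    qed
    then have "{x \<in> hcube z r. real (Suc k) * L < \<bar>\<beta> x - c\<bar>} \<subseteq> {x \<in> hcube z r. real k * L < \<bar>\<beta> x - c'\<bar>}"
      by (auto simp: algebra_simps)
    then have "emeasure M {x \<in> hcube z r. real (Suc k) * L < \<bar>\<beta> x - c\<bar>}
        \<le> emeasure M {x \<in> hcube z r. real k * L < \<bar>\<beta> x - c'\<bar>}"
      by (intro emeasure_mono) (auto simp: sets_M)
    also have "\<dots> \<le> ennreal (\<delta> ^ k) * emeasure M (hcube z r)"
      by (rule Suc.IH[OF r(1) c'])
    finally show "emeasure M {x \<in> hcube (fst i) (snd i). real (Suc k) * L < \<bar>\<beta> x - c\<bar>}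
        \<le> ennreal (\<delta> ^ k) * emeasure M (hcube (fst i) (snd i))"
      by (simp add: z_def r_def)
  qed
  also have "\<dots> = ennreal (\<delta> ^ k) * emeasure M E"
    unfolding E_def using I by (subst emeasure_UN_countable) (auto simp: nn_integral_cmult sets_M)
  also have "\<dots> \<le> ennreal (\<delta> ^ k) * (ennreal \<delta> * emeasure M (hcube a l))"
    by (intro mult_left_mono ME) simp
  also have "\<dots> = ennreal (\<delta> ^ Suc k) * emeasure M (hcube a l)"
    using \<delta> by (simp add: mult_ac ennreal_mult)
  finally show ?case .
qed

text \<open>On the k-th layer the exponential is at most \<rho>^-(k+1), while the layer has relative
  mass at most \<delta>^k = \<rho>^(2k). With \<rho> the square root of \<delta>, half of the decay
  pays for the exponential and the other half sums the series. Neither \<epsilon> nor C depends on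
  the cube.\<close>

theorem exponential_integrability:
  "\<exists>\<epsilon>>0. \<exists>C>0. \<forall>a l c. 0 < l \<longrightarrow>
     (\<integral>\<^sup>+x\<in>hcube a l. ennreal \<bar>\<beta> x - c\<bar> \<partial>lborel) \<le> ennreal (D * l ^ DIM('a)) \<longrightarrow>
     (\<integral>\<^sup>+x\<in>hcube a l. ennreal (exp (\<epsilon> * \<bar>\<beta> x - c\<bar>)) \<partial>M) \<le> ennreal C * emeasure M (hcube a l)"
proof -
  define \<rho> where "\<rho> = sqrt \<delta>"
  have \<rho>: "0 < \<rho>" "\<rho> < 1" "\<delta> = \<rho> * \<rho>"
    using \<delta> by (simp_all add: \<rho>_def)
  define \<epsilon> where "\<epsilon> = - ln \<rho> / L"
  have \<epsilon>: "0 < \<epsilon>" using \<rho> L_pos by (simp add: \<epsilon>_def divide_less_0_iff)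
  have exp_L: "exp (\<epsilon> * (real k * L)) = 1 / \<rho> ^ k" for k
  proof -
    have "\<epsilon> * (real k * L) = real k * (- ln \<rho>)"
      using L_pos by (simp add: \<epsilon>_def)
    then show ?thesis
      using \<rho> exp_of_nat_mult[of k "- ln \<rho>"] by (simp add: exp_minus power_one_over inverse_eq_divide)
  qed
  define C where "C = 1 + (1 / \<rho>) * (1 / (1 - \<rho>))"
  have "0 < C" using \<rho> by (simp add: C_def add_pos_pos)
  have "(\<integral>\<^sup>+x\<in>hcube a l. ennreal (exp (\<epsilon> * \<bar>\<beta> x - c\<bar>)) \<partial>M) \<le> ennreal C * emeasure M (hcube a l)"
    if l: "0 < l" and c: "(\<integral>\<^sup>+x\<in>hcube a l. ennreal \<bar>\<beta> x - c\<bar> \<partial>lborel) \<le> ennreal (D * l ^ DIM('a))"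
    for a l c
  proof -
    define A where "A k = {x \<in> hcube a l. real k * L < \<bar>\<beta> x - c\<bar>}" for k
    have [measurable]: "A k \<in> sets M" for k
      unfolding A_def sets_M by measurable
    have [measurable]: "hcube a l \<in> sets M" by (simp add: sets_M)
    have "ennreal (exp (\<epsilon> * \<bar>\<beta> x - c\<bar>)) * indicator (hcube a l) x
       \<le> indicator (hcube a l) x + (\<Sum>k. ennreal (1 / \<rho> ^ Suc k) * indicator (A k) x)" for x
    proof (cases "x \<in> hcube a l")
      case True
      define t where "t = \<bar>\<beta> x - c\<bar>"
      show ?thesis
      proof (cases "t = 0")
        case False
        \<comment> \<open>This k satisfies k L < t \<le> (k + 1) L, the strict lower bound being the
          one in \<open>A k\<close>. No such k exists for t = 0, which the indicator of the cube
          covers.\<close>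
        define k where "k = nat (\<lceil>t / L\<rceil> - 1)"
        have "0 < t" using False by (simp add: t_def)
        then have "1 \<le> \<lceil>t / L\<rceil>" using L_pos by simp
        then have k: "real k = of_int \<lceil>t / L\<rceil> - 1" by (simp add: k_def)
        have "real k < t / L" "t / L \<le> real (Suc k)"
          unfolding of_nat_Suc k using ceiling_correct[of "t / L"] by linarith+
        then have kt: "real k * L < t" "t \<le> real (Suc k) * L"
          using L_pos by (simp_all add: field_simps)
        have "ennreal (exp (\<epsilon> * t)) \<le> ennreal (exp (\<epsilon> * (real (Suc k) * L)))"
          using \<epsilon> kt by (intro ennreal_leI) simp
        also have "\<dots> = ennreal (1 / \<rho> ^ Suc k) * indicator (A k) x"
          using kt True unfolding exp_L by (simp add: A_def t_def)
        also have "\<dots> \<le> (\<Sum>k. ennreal (1 / \<rho> ^ Suc k) * indicator (A k) x)"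
        proof -
          define F where "F j = ennreal (1 / \<rho> ^ Suc j) * indicator (A j) x" for j
          have "sum F {k} \<le> suminf F" by (rule sum_le_suminf) auto
          then have "F k \<le> suminf F" by simp
          then show ?thesis unfolding F_def .
        qed
        finally have "ennreal (exp (\<epsilon> * t)) \<le> (\<Sum>k. ennreal (1 / \<rho> ^ Suc k) * indicator (A k) x)" .
        then show ?thesis
          using True by (simp add: t_def add_increasing)
      qed (use True in \<open>simp add: t_def\<close>)
    qed simp
    then have "(\<integral>\<^sup>+x\<in>hcube a l. ennreal (exp (\<epsilon> * \<bar>\<beta> x - c\<bar>)) \<partial>M)
      \<le> (\<integral>\<^sup>+x. indicator (hcube a l) x + (\<Sum>k. ennreal (1 / \<rho> ^ Suc k) * indicator (A k) x) \<partial>M)"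
      by (intro nn_integral_mono)
    also have "\<dots> = emeasure M (hcube a l) + (\<Sum>k. ennreal (1 / \<rho> ^ Suc k) * emeasure M (A k))"
      by (simp add: nn_integral_add nn_integral_suminf nn_integral_cmult_indicator del: power_Suc)
    also have "\<dots> \<le> emeasure M (hcube a l) + (\<Sum>k. ennreal (1 / \<rho> * \<rho> ^ k) * emeasure M (hcube a l))"
    proof (intro add_left_mono suminf_le summableI)
      fix k
      have "ennreal (1 / \<rho> ^ Suc k) * emeasure M (A k)
          \<le> ennreal (1 / \<rho> ^ Suc k) * (ennreal (\<delta> ^ k) * emeasure M (hcube a l))"
        unfolding A_def by (intro mult_left_mono decay l c) simp
      also have "\<dots> = ennreal (1 / \<rho> ^ Suc k * \<delta> ^ k) * emeasure M (hcube a l)"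
        using \<delta> \<rho> by (subst ennreal_mult) (auto simp: mult.assoc)
      also have "1 / \<rho> ^ Suc k * \<delta> ^ k = 1 / \<rho> * \<rho> ^ k"
        using \<rho> by (simp add: power_mult_distrib field_simps)
      finally show "ennreal (1 / \<rho> ^ Suc k) * emeasure M (A k) \<le> ennreal (1 / \<rho> * \<rho> ^ k) * emeasure M (hcube a l)" .
    qed
    also have "(\<Sum>k. ennreal (1 / \<rho> * \<rho> ^ k) * emeasure M (hcube a l))
        = ennreal (\<Sum>k. 1 / \<rho> * \<rho> ^ k) * emeasure M (hcube a l)"
      using \<rho> by (subst ennreal_suminf_multc, subst suminf_ennreal2)
        (auto intro!: summable_mult summable_geometric)
    also have "(\<Sum>k. 1 / \<rho> * \<rho> ^ k) = (1 / \<rho>) * (1 / (1 - \<rho>))"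
      using \<rho> by (subst suminf_mult) (auto simp: suminf_geometric intro!: summable_geometric)
    also have "emeasure M (hcube a l) + ennreal (1 / \<rho> * (1 / (1 - \<rho>))) * emeasure M (hcube a l)
       = ennreal C * emeasure M (hcube a l)"
      using \<rho> by (simp add: C_def ennreal_plus distrib_right)
    finally show ?thesis .
  qed
  with \<epsilon> \<open>0 < C\<close> show ?thesis by blast
qed

end

section \<open>Muckenhoupt weights\<close>

definition wmeasure :: "('a::euclidean_space \<Rightarrow> real) \<Rightarrow> 'a measure" where
  "wmeasure u = density lborel (\<lambda>x. ennreal (u x))"

abbreviation ball_mass :: "('a::euclidean_space \<Rightarrow> real) \<Rightarrow> 'a \<Rightarrow> real \<Rightarrow> real" where
  "ball_mass u z r \<equiv> measure (wmeasure u) (ball z r)"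

lemma sets_wmeasure [simp, measurable_cong]: "sets (wmeasure u) = sets borel"
  by (simp add: wmeasure_def)

lemma nn_integral_wmeasure:
  assumes [measurable]: "u \<in> borel_measurable borel" "f \<in> borel_measurable borel"
  shows "(\<integral>\<^sup>+x. f x \<partial>wmeasure u) = (\<integral>\<^sup>+x. ennreal (u x) * f x \<partial>lborel)"
  by (simp add: wmeasure_def nn_integral_density)

lemma emeasure_wmeasure:
  assumes [measurable]: "u \<in> borel_measurable borel" "E \<in> sets borel"
  shows "emeasure (wmeasure u) E = (\<integral>\<^sup>+x\<in>E. ennreal (u x) \<partial>lborel)"
  by (simp add: wmeasure_def emeasure_density)

lemma measure_lborel_ball:
  "0 \<le> r \<Longrightarrow> measure lborel (ball (z::'a::euclidean_space) r) = unit_ball_vol (DIM('a)) * r ^ DIM('a)"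
  by (simp add: measure_def emeasure_ball unit_ball_vol_nonneg)

lemma measure_lborel_ball_pos: "0 < r \<Longrightarrow> 0 < measure lborel (ball (z::'a::euclidean_space) r)"
  by (simp add: measure_lborel_ball)

lemma emeasure_lborel_ball_finite: "emeasure lborel (ball (z::'a::euclidean_space) r) < top"
  using emeasure_bounded_finite[OF bounded_ball] by simp

lemma emeasure_lborel_ball:
  "emeasure lborel (ball (z::'a::euclidean_space) r) = ennreal (measure lborel (ball z r))"
  using emeasure_lborel_ball_finite[of z r] by (intro emeasure_eq_ennreal_measure) auto

lemma emeasure_wmeasure_pos:
  assumes [measurable]: "u \<in> borel_measurable borel" and u_pos: "\<And>x. 0 < u x"
    and E: "E \<in> sets borel" "emeasure lborel E \<noteq> 0"
  shows "0 < emeasure (wmeasure u) E"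
proof -
  have "emeasure (wmeasure u) E \<noteq> 0"
  proof
    assume "emeasure (wmeasure u) E = 0"
    then have "AE x in lborel. ennreal (u x) * indicator E x = 0"
      using E by (subst (asm) emeasure_wmeasure) (auto simp: nn_integral_0_iff_AE)
    then have "AE x in lborel. x \<notin> E"
    proof eventually_elim
      fix x assume "ennreal (u x) * indicator E x = 0"
      then show "x \<notin> E"
        using u_pos[of x] by (auto simp: indicator_def split: if_splits)
    qed
    then show False
      using E AE_iff_measurable[of E lborel "\<lambda>x. x \<notin> E"] by auto
  qed
  then show ?thesis by (simp add: zero_less_iff_neq_zero)
qed

text \<open>Muckenhoupt's class \<open>A\<^bsub>1+c\<^esub>\<close>. The dual weight \<open>u\<^sup>-\<^sup>1\<^sup>/\<^sup>c\<close> lies in \<open>A\<^bsub>1+1/c\<^esub>\<close>, and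
  \<open>w \<in> A(p,q)\<close> if and only if \<open>w\<^sup>q \<in> A\<^bsub>1+q/p'\<^esub>\<close>.\<close>

locale muckenhoupt =
  fixes u :: "'a::euclidean_space \<Rightarrow> real" and c K :: real
  assumes u_measurable [measurable]: "u \<in> borel_measurable borel"
    and u_pos: "0 < u x"
    and c_pos: "0 < c" and K_pos: "0 < K"
    and u_finite: "emeasure (wmeasure u) (ball z r) < top"
    and dual_finite: "emeasure (wmeasure (\<lambda>x. u x powr (- 1 / c))) (ball z r) < top"
    and A_bound: "0 < r \<Longrightarrow> ball_mass u z r *
        ball_mass (\<lambda>x. u x powr (- 1 / c)) z r powr c
      \<le> K * measure lborel (ball z r) powr (1 + c)"
begin

abbreviation "\<sigma> \<equiv> \<lambda>x. u x powr (- 1 / c)"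

lemma emeasure_ball_eq: "emeasure (wmeasure u) (ball z r) = ennreal (ball_mass u z r)"
  using u_finite by (intro emeasure_eq_ennreal_measure) (auto simp: less_top)

lemma ball_pos: "0 < r \<Longrightarrow> 0 < ball_mass u z r"
  using emeasure_wmeasure_pos[OF u_measurable u_pos, of "ball z r"] emeasure_ball_eq[of z r] measure_lborel_ball_pos[of r z]
  by (auto simp: emeasure_lborel_ball)

text \<open>Raising the defining bound to the power 1/c exchanges \<open>u\<close> and
  \<open>\<sigma>\<close>. Whatever is proved for \<open>u\<close> thereby holds for
  \<open>\<sigma>\<close>, in particular doubling and the John-Nirenberg inequality.\<close>

lemma dual_muckenhoupt: "muckenhoupt \<sigma> (1 / c) (K powr (1 / c))"
proof
  have dd: "(\<lambda>x. \<sigma> x powr (- 1 / (1 / c))) = u"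
    using u_pos c_pos by (auto simp: fun_eq_iff powr_powr less_imp_le)
  show "\<sigma> \<in> borel_measurable borel" by measurable
  show "0 < \<sigma> x" for x using u_pos[of x] by simp
  show "0 < 1 / c" "0 < K powr (1 / c)" using c_pos K_pos by auto
  show "emeasure (wmeasure \<sigma>) (ball z r) < top" for z r by (rule dual_finite)
  show "emeasure (wmeasure (\<lambda>x. \<sigma> x powr (- 1 / (1 / c)))) (ball z r) < top" for z r
    unfolding dd by (rule u_finite)
  show "ball_mass \<sigma> z r *
        ball_mass (\<lambda>x. \<sigma> x powr (- 1 / (1 / c))) z r powr (1 / c)
      \<le> K powr (1 / c) * measure lborel (ball z r) powr (1 + 1 / c)" if r: "0 < r" for z r
  proof -
    define V S B where "V = ball_mass u z r" and "S = ball_mass \<sigma> z r"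
      and "B = measure lborel (ball z r)"
    have "(V * S powr c) powr (1 / c) \<le> (K * B powr (1 + c)) powr (1 / c)"
      using A_bound[OF r, of z] c_pos by (intro powr_mono2) (auto simp: V_def S_def B_def)
    then show ?thesis
      unfolding dd using c_pos K_pos
      by (simp add: V_def[symmetric] S_def[symmetric] B_def[symmetric] powr_mult powr_powr
          mult.commute add_divide_distrib) (simp add: V_def S_def B_def mult.commute add.commute)
  qed
qed

lemma dual_ball_pos: "0 < r \<Longrightarrow> 0 < ball_mass \<sigma> z r"
  using muckenhoupt.ball_pos[OF dual_muckenhoupt] .

lemma dual_emeasure_ball_eq:
  "emeasure (wmeasure \<sigma>) (ball z r) = ennreal (ball_mass \<sigma> z r)"
  using muckenhoupt.emeasure_ball_eq[OF dual_muckenhoupt] .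

lemma sub_finite: "E \<subseteq> ball z r \<Longrightarrow> emeasure (wmeasure u) E < top"
  by (rule le_less_trans[OF emeasure_mono u_finite[of z r]]) auto

lemma measure_mono_ball: "E \<subseteq> ball z r \<Longrightarrow> F \<subseteq> E \<Longrightarrow> E \<in> sets borel \<Longrightarrow>
    measure (wmeasure u) F \<le> measure (wmeasure u) E"
  unfolding measure_def
  by (intro enn2real_mono emeasure_mono) (auto intro: sub_finite)

text \<open>For t = 1 / (1 + c) the function u^t \<sigma>^(1-t) is identically 1, so its integral
  over E is |E| and Hoelder's inequality applies.\<close>

lemma Holder_sets:
  assumes [measurable]: "E \<in> sets borel" and E: "E \<subseteq> ball z r"
  shows "measure lborel E powr (1 + c)
    \<le> measure (wmeasure u) E * measure (wmeasure \<sigma>) E powr c"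
proof -
  define t where "t = 1 / (1 + c)"
  have t: "0 < t" "t < 1" "1 - t = c / (1 + c)"
    using c_pos by (auto simp: t_def field_simps)
  have one: "epow (ennreal (u x)) t * epow (ennreal (\<sigma> x)) (1 - t) = 1" for x
  proof -
    have "u x powr t * \<sigma> x powr (1 - t) = u x powr (t + (- 1 / c) * (1 - t))"
      using u_pos[of x] by (simp add: powr_powr flip: powr_add)
    also have "t + (- 1 / c) * (1 - t) = 0"
      using c_pos by (simp add: t_def t(3)[unfolded t_def])
    finally show ?thesis
      using u_pos[of x] by (simp add: epow_ennreal less_imp_le flip: ennreal_mult)
  qed
  have "emeasure lborel E = (\<integral>\<^sup>+x. epow (ennreal (u x) * indicator E x) t *
      epow (ennreal (\<sigma> x) * indicator E x) (1 - t) \<partial>lborel)"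
  proof -
    have "indicator E x = epow (ennreal (u x) * indicator E x) t *
      epow (ennreal (\<sigma> x) * indicator E x) (1 - t)" for x
      using one[of x] by (cases "x \<in> E") simp_all
    then show ?thesis by (simp flip: nn_integral_indicator)
  qed
  also have "\<dots> \<le> epow (emeasure (wmeasure u) E) t * epow (emeasure (wmeasure \<sigma>) E) (1 - t)"
    unfolding emeasure_wmeasure[OF u_measurable \<open>E \<in> sets borel\<close>]
    by (subst emeasure_wmeasure) (auto intro!: Holder_nn_integral t)
  also have "\<dots> = ennreal (measure (wmeasure u) E powr t * measure (wmeasure \<sigma>) E powr (1 - t))"
    using sub_finite[OF E] muckenhoupt.sub_finite[OF dual_muckenhoupt E]
    by (simp add: emeasure_eq_ennreal_measure less_top epow_ennreal ennreal_mult)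
  finally have "measure lborel E \<le> measure (wmeasure u) E powr t * measure (wmeasure \<sigma>) E powr (1 - t)"
    by (simp add: measure_def enn2real_leI)
  then have "measure lborel E powr (1 + c)
      \<le> (measure (wmeasure u) E powr t * measure (wmeasure \<sigma>) E powr (1 - t)) powr (1 + c)"
    using c_pos by (intro powr_mono2) auto
  also have "\<dots> = measure (wmeasure u) E * measure (wmeasure \<sigma>) E powr c"
    using c_pos unfolding t(3) by (simp add: powr_mult powr_powr t_def)
  finally show ?thesis .
qed

text \<open>\<open>Holder_sets\<close> on E combined with the defining bound on the ball eliminates
  \<open>\<sigma>\<close>: the share u(E) / u(B) is at least (|E| / |B|)^(1+c) / K. Doubling,
  reverse doubling and the A-infinity property of cubes all come from special choices of E.\<close>

lemma A_infinity_lower: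
  assumes E: "E \<in> sets borel" "E \<subseteq> ball z r" and r: "0 < r"
  shows "measure lborel E powr (1 + c) * ball_mass u z r
    \<le> K * measure (wmeasure u) E * measure lborel (ball z r) powr (1 + c)"
proof -
  define S where "S = ball_mass \<sigma> z r"
  have "measure (wmeasure \<sigma>) E \<le> S"
    unfolding S_def using E by (intro muckenhoupt.measure_mono_ball[OF dual_muckenhoupt, of _ z r]) auto
  then have "measure (wmeasure \<sigma>) E powr c \<le> S powr c"
    using c_pos by (intro powr_mono2) auto
  then have "measure lborel E powr (1 + c) \<le> measure (wmeasure u) E * S powr c"
    by (intro order_trans[OF Holder_sets[OF E]] mult_left_mono) auto
  then have "measure lborel E powr (1 + c) * ball_mass u z r
      \<le> measure (wmeasure u) E * S powr c * ball_mass u z r"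
    by (rule mult_right_mono) simp
  also have "\<dots> = measure (wmeasure u) E * (ball_mass u z r * S powr c)"
    by simp
  also have "\<dots> \<le> measure (wmeasure u) E * (K * measure lborel (ball z r) powr (1 + c))"
    unfolding S_def by (intro mult_left_mono A_bound r) simp
  finally show ?thesis by (simp add: mult_ac)
qed

text \<open>This is \<open>A_infinity_lower\<close> with the smaller ball as E; the volumes have the
  ratio (r / s)^n.\<close>

lemma ball_growth:
  assumes s: "0 < s" and sub: "ball x s \<subseteq> ball z r"
  shows "ball_mass u z r
    \<le> K * ((r / s) ^ DIM('a)) powr (1 + c) * ball_mass u x s"
proof -
  have r: "0 < r" using s sub by (metis ball_eq_empty not_le subset_empty)
  define b where "b = measure lborel (ball x s) powr (1 + c)"
  have b: "0 < b" unfolding b_def using measure_lborel_ball_pos[OF s, of x] by simp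
  have eq: "measure lborel (ball z r) = (r / s) ^ DIM('a) * measure lborel (ball x s)"
    using r s by (simp add: measure_lborel_ball power_divide)
  have "b * ball_mass u z r
      \<le> K * ball_mass u x s * (((r / s) ^ DIM('a)) powr (1 + c) * b)"
    using A_infinity_lower[OF _ sub r] r s unfolding b_def eq
    by (simp add: powr_mult)
  then have "b * ball_mass u z r
      \<le> b * (K * ((r / s) ^ DIM('a)) powr (1 + c) * ball_mass u x s)"
    by (simp add: mult_ac)
  then show ?thesis using b by simp
qed

lemma sigma_finite_wmeasure: "sigma_finite_measure (wmeasure u)"
  unfolding wmeasure_def using u_measurable
  by (subst sigma_finite_measure.sigma_finite_iff_density_finite[OF sigma_finite_lborel]) auto

lemma doubling: "doubling_measure (wmeasure u) (K * (5 ^ DIM('a)) powr (1 + c))"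
proof -
  interpret sigma_finite_measure "wmeasure u" by (rule sigma_finite_wmeasure)
  show ?thesis
  proof
    show "0 < K * (5 ^ DIM('a)) powr (1 + c)" using K_pos by simp
    show "emeasure (wmeasure u) (ball z r) < top" for z r by (rule u_finite)
    show "0 < emeasure (wmeasure u) (ball z r)" if "0 < r" for z r
      using ball_pos[OF that, of z] emeasure_ball_eq[of z r] by simp
    show "emeasure (wmeasure u) (ball z (5 * r))
        \<le> ennreal (K * (5 ^ DIM('a)) powr (1 + c)) * emeasure (wmeasure u) (ball z r)" if "0 < r" for z r
    proof -
      have "ball z r \<subseteq> ball z (5 * r)" using that by (intro subset_ball) simp
      from ball_growth[OF that this] that show ?thesis
        by (simp add: emeasure_ball_eq ennreal_leI flip: ennreal_mult'')
    qed
  qed simp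
qed

text \<open>The annulus between B and 2B has at least half the volume of 2B, hence by
  \<open>A_infinity_lower\<close> at least a fixed share \<gamma> of its mass; \<delta> is 1 -
  \<gamma>. The minimum with 1/2 keeps \<gamma> below 1.\<close>

lemma reverse_doubling:
  obtains \<delta> where "0 < \<delta>" "\<delta> < 1"
    "\<And>z r. 0 < r \<Longrightarrow> ball_mass u z r \<le> \<delta> * ball_mass u z (2 * r)"
proof -
  define \<gamma> where "\<gamma> = min (1 / 2) (1 / (K * 2 powr (1 + c)))"
  have \<gamma>: "0 < \<gamma>" "\<gamma> < 1" using K_pos by (auto simp: \<gamma>_def)
  have "ball_mass u z r \<le> (1 - \<gamma>) * ball_mass u z (2 * r)"
    if r: "0 < r" for z r
  proof -
    define B where "B = measure lborel (ball z (2 * r))"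
    define E where "E = ball z (2 * r) - ball z r"
    have B: "0 < B" unfolding B_def using r by (intro measure_lborel_ball_pos) simp
    have sub: "ball z r \<subseteq> ball z (2 * r)" using r by (intro subset_ball) simp
    have "measure lborel E = B - measure lborel (ball z r)"
      unfolding E_def B_def using emeasure_lborel_ball_finite sub
      by (intro measure_Diff) (auto simp: less_top)
    moreover have "2 * measure lborel (ball z r) \<le> B"
    proof -
      have "(2::real) \<le> 2 ^ DIM('a)"
        using power_increasing[of 1 "DIM('a)" "2::real"] DIM_positive[where 'a='a] by simp
      then show ?thesis
        using r mult_right_mono[of 2 "2 ^ DIM('a)" "unit_ball_vol (DIM('a)) * r ^ DIM('a)"]
        by (simp add: B_def measure_lborel_ball power_mult_distrib mult_ac)
    qed
    ultimately have "B / 2 \<le> measure lborel E" by simp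
    then have "(B / 2) powr (1 + c) \<le> measure lborel E powr (1 + c)"
      using B c_pos by (intro powr_mono2) auto
    then have "(B / 2) powr (1 + c) * ball_mass u z (2 * r)
       \<le> measure lborel E powr (1 + c) * ball_mass u z (2 * r)"
      by (rule mult_right_mono) simp
    also have "\<dots> \<le> K * measure (wmeasure u) E * B powr (1 + c)"
      unfolding B_def using r by (intro A_infinity_lower) (auto simp: E_def)
    finally have "ball_mass u z (2 * r) / (K * 2 powr (1 + c)) \<le> measure (wmeasure u) E"
      using B K_pos by (simp add: powr_divide field_simps)
    moreover have "\<gamma> * ball_mass u z (2 * r)
        \<le> 1 / (K * 2 powr (1 + c)) * ball_mass u z (2 * r)"
      by (intro mult_right_mono) (auto simp: \<gamma>_def)
    moreover have "measure (wmeasure u) E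
        = ball_mass u z (2 * r) - ball_mass u z r"
      unfolding E_def using u_finite sub
      by (intro measure_Diff) (auto simp: less_top)
    ultimately show ?thesis by (simp add: algebra_simps)
  qed
  with \<gamma> show ?thesis by (intro that[of "1 - \<gamma>"]) auto
qed

text \<open>The lower bound is applied to the complement of E in the cube, inside the ball of radius
  l n about the centre of the cube. \<open>N\<close> is the volume of that ball divided by half the
  volume of the cube.\<close>

lemma A_infinity_cubes:
  obtains \<delta> where "0 < \<delta>" "\<delta> < 1"
    "\<And>E a l. 0 < l \<Longrightarrow> E \<in> sets borel \<Longrightarrow> E \<subseteq> hcube a l \<Longrightarrow>
      2 * emeasure lborel E \<le> ennreal (l ^ DIM('a)) \<Longrightarrow>
      emeasure (wmeasure u) E \<le> ennreal \<delta> * emeasure (wmeasure u) (hcube a l)"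
proof -
  define N where "N = 2 * unit_ball_vol (DIM('a)) * real DIM('a) ^ DIM('a)"
  have N: "0 < N" by (simp add: N_def)
  define \<gamma> where "\<gamma> = min (1 / 2) (1 / (K * N powr (1 + c)))"
  have \<gamma>: "0 < \<gamma>" "\<gamma> < 1" using K_pos N by (auto simp: \<gamma>_def)
  have "emeasure (wmeasure u) E \<le> ennreal (1 - \<gamma>) * emeasure (wmeasure u) (hcube a l)"
    if l: "0 < l" and [measurable]: "E \<in> sets borel" and E: "E \<subseteq> hcube a l"
      "2 * emeasure lborel E \<le> ennreal (l ^ DIM('a))" for E a l
  proof -
    define z r where "z = a + (l / 2) *\<^sub>R One" and "r = l * DIM('a)"
    have zr: "hcube a l \<subseteq> ball z r" "0 < r"
      using hcube_subset_ball[OF l, of a] l by (auto simp: z_def r_def)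
    define F where "F = hcube a l - E"
    have eQ: "emeasure lborel (hcube a l) = ennreal (l ^ DIM('a))"
      using l by (simp add: emeasure_hcube)
    have fE: "emeasure lborel E < top"
      using le_less_trans[OF emeasure_mono[OF E(1), of lborel]] eQ by simp
    have "measure lborel F = l ^ DIM('a) - measure lborel E"
      unfolding F_def using E eQ fE l by (subst measure_Diff) (auto simp: measure_def less_top)
    moreover have "2 * measure lborel E \<le> l ^ DIM('a)"
    proof -
      have "ennreal (2 * measure lborel E) = 2 * emeasure lborel E"
        using fE by (simp add: emeasure_eq_ennreal_measure less_top ennreal_mult)
      then have "ennreal (2 * measure lborel E) \<le> ennreal (l ^ DIM('a))" using E(2) by simp
      then show ?thesis using l by (subst (asm) ennreal_le_iff) auto
    qed
    ultimately have "l ^ DIM('a) / 2 \<le> measure lborel F" by simp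
    then have "(l ^ DIM('a) / 2) powr (1 + c) \<le> measure lborel F powr (1 + c)"
      using l c_pos by (intro powr_mono2) auto
    then have "(l ^ DIM('a) / 2) powr (1 + c) * ball_mass u z r
       \<le> measure lborel F powr (1 + c) * ball_mass u z r"
      by (rule mult_right_mono) simp
    also have "\<dots> \<le> K * measure (wmeasure u) F * measure lborel (ball z r) powr (1 + c)"
      using zr by (intro A_infinity_lower) (auto simp: F_def)
    also have "measure lborel (ball z r) = N * (l ^ DIM('a) / 2)"
      using zr(2) by (simp add: measure_lborel_ball N_def r_def power_mult_distrib)
    also have "\<dots> powr (1 + c) = N powr (1 + c) * (l ^ DIM('a) / 2) powr (1 + c)"
      using N l by (simp add: powr_mult del: times_divide_eq_right)
    finally have "(l ^ DIM('a) / 2) powr (1 + c) * ball_mass u z r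
        \<le> (l ^ DIM('a) / 2) powr (1 + c) * (K * N powr (1 + c) * measure (wmeasure u) F)"
      by (simp add: mult_ac)
    then have "ball_mass u z r \<le> K * N powr (1 + c) * measure (wmeasure u) F"
      using l by (subst (asm) mult_le_cancel_left_pos) auto
    then have "ball_mass u z r / (K * N powr (1 + c)) \<le> measure (wmeasure u) F"
      using K_pos N by (simp add: field_simps)
    moreover have "measure (wmeasure u) (hcube a l) \<le> ball_mass u z r"
      using zr by (intro measure_mono_ball[of _ z r]) auto
    then have "\<gamma> * measure (wmeasure u) (hcube a l)
        \<le> 1 / (K * N powr (1 + c)) * ball_mass u z r"
      using \<gamma> K_pos N by (intro mult_mono) (auto simp: \<gamma>_def)
    moreover have "measure (wmeasure u) F = measure (wmeasure u) (hcube a l) - measure (wmeasure u) E"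
      unfolding F_def using sub_finite[OF zr(1)] E by (intro measure_Diff) (auto simp: less_top)
    ultimately have "measure (wmeasure u) E \<le> (1 - \<gamma>) * measure (wmeasure u) (hcube a l)"
      by (simp add: algebra_simps)
    then have "ennreal (measure (wmeasure u) E) \<le> ennreal (1 - \<gamma>) * ennreal (measure (wmeasure u) (hcube a l))"
      using \<gamma> by (subst ennreal_mult[symmetric]) (auto intro: ennreal_leI)
    then show ?thesis
      using sub_finite[OF zr(1)] sub_finite[of E z r] E zr
      by (simp add: emeasure_eq_ennreal_measure less_top)
  qed
  with \<gamma> show ?thesis by (intro that[of "1 - \<gamma>"]) auto
qed

end

section \<open>Mean oscillation and exponential integrability on balls\<close>

lemma ball_measurable [measurable]: "ball (z::'a::euclidean_space) r \<in> sets borel"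
  by simp

text \<open>Any constant m may take the place of the mean value, so that constants belonging to
  different balls can be compared; for ln u the logarithm of the average of u serves. Using r^n in
  place of the volume only rescales D.\<close>

definition osc_le :: "('a::euclidean_space \<Rightarrow> real) \<Rightarrow> real \<Rightarrow> real \<Rightarrow> 'a \<Rightarrow> real \<Rightarrow> bool" where
  "osc_le \<beta> D m z r \<longleftrightarrow>
     (\<integral>\<^sup>+x\<in>ball z r. ennreal \<bar>\<beta> x - m\<bar> \<partial>lborel) \<le> ennreal (D * r ^ DIM('a))"

lemma osc_le_subset:
  fixes \<beta> :: "'a::euclidean_space \<Rightarrow> real"
  assumes "osc_le \<beta> D m z R" "ball x r \<subseteq> ball z R" "0 < r"
  shows "osc_le \<beta> (D * (R / r) ^ DIM('a)) m x r"
proof -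
  have "(\<integral>\<^sup>+y\<in>ball x r. ennreal \<bar>\<beta> y - m\<bar> \<partial>lborel) \<le> (\<integral>\<^sup>+y\<in>ball z R. ennreal \<bar>\<beta> y - m\<bar> \<partial>lborel)"
    using assms(2) by (intro nn_integral_mono) (auto simp: indicator_def)
  also have "\<dots> \<le> ennreal (D * R ^ DIM('a))"
    using assms(1) by (simp add: osc_le_def)
  also have "D * R ^ DIM('a) = D * (R / r) ^ DIM('a) * r ^ DIM('a)"
    using assms(3) by (simp add: power_divide)
  finally show ?thesis by (simp add: osc_le_def)
qed

text \<open>Both constants approximate \<beta> in the mean on the same ball, so the triangle
  inequality under the integral bounds their distance. For consecutive dyadic balls this controls
  the drift of the constants.\<close>

lemma osc_le_diff:
  fixes \<beta> :: "'a::euclidean_space \<Rightarrow> real"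
  assumes [measurable]: "\<beta> \<in> borel_measurable borel"
    and m: "osc_le \<beta> D m z r" "osc_le \<beta> D' m' z r" and r: "0 < r" and D: "0 \<le> D" "0 \<le> D'"
  shows "\<bar>m - m'\<bar> \<le> (D + D') / unit_ball_vol (DIM('a))"
proof -
  have "ennreal \<bar>m - m'\<bar> * emeasure lborel (ball z r)
      = (\<integral>\<^sup>+x\<in>ball z r. ennreal \<bar>m - m'\<bar> \<partial>lborel)"
    by (simp add: nn_integral_cmult_indicator)
  also have "\<dots> \<le> (\<integral>\<^sup>+x. ennreal \<bar>\<beta> x - m\<bar> * indicator (ball z r) x
      + ennreal \<bar>\<beta> x - m'\<bar> * indicator (ball z r) x \<partial>lborel)"
    by (intro nn_integral_mono)
       (auto simp: indicator_def simp flip: ennreal_plus intro!: ennreal_leI)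
  also have "\<dots> = (\<integral>\<^sup>+x\<in>ball z r. ennreal \<bar>\<beta> x - m\<bar> \<partial>lborel) + (\<integral>\<^sup>+x\<in>ball z r. ennreal \<bar>\<beta> x - m'\<bar> \<partial>lborel)"
    by (rule nn_integral_add) (simp_all add: ball_measurable)
  also have "\<dots> \<le> ennreal (D * r ^ DIM('a)) + ennreal (D' * r ^ DIM('a))"
    using m unfolding osc_le_def by (rule add_mono)
  finally have "ennreal (\<bar>m - m'\<bar> * (unit_ball_vol (DIM('a)) * r ^ DIM('a))) \<le> ennreal ((D + D') * r ^ DIM('a))"
    using r D by (simp add: emeasure_ball ennreal_mult algebra_simps)
  then have "\<bar>m - m'\<bar> * (unit_ball_vol (DIM('a)) * r ^ DIM('a)) \<le> (D + D') * r ^ DIM('a)"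
    using r D by (subst (asm) ennreal_le_iff) auto
  then have "\<bar>m - m'\<bar> * unit_ball_vol (DIM('a)) \<le> D + D'"
    using r by (simp flip: mult.assoc)
  then show ?thesis by (simp add: field_simps)
qed

context muckenhoupt
begin

text \<open>The stopping argument lives on cubes, the rest of the proof on balls. A ball of radius r
  lies in a cube of side 2 r, which lies in the ball of radius 2 r n, and \<open>ball_growth\<close>
  returns to the original ball. The constants of the small and of the large ball differ by at most
  \<Delta>, which is absorbed as exp (\<epsilon> \<Delta>).\<close>

lemma exponential_integrability_balls:
  assumes [measurable]: "\<beta> \<in> borel_measurable borel" and D: "0 < D"
    and osc: "\<And>z r. 0 < r \<Longrightarrow> \<exists>m. osc_le \<beta> D m z r"
  obtains \<epsilon> C where "0 < \<epsilon>" "0 < C"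
    "\<And>z r m t. 0 < r \<Longrightarrow> osc_le \<beta> D m z r \<Longrightarrow> \<bar>t\<bar> \<le> \<epsilon> \<Longrightarrow>
      (\<integral>\<^sup>+x\<in>ball z r. ennreal (exp (t * (\<beta> x - m)) * u x) \<partial>lborel)
        \<le> ennreal (C * ball_mass u z r)"
proof -
  define n where "n = DIM('a)"
  obtain \<delta> where \<delta>: "0 < \<delta>" "\<delta> < 1"
    "\<And>E a l. 0 < l \<Longrightarrow> E \<in> sets borel \<Longrightarrow> E \<subseteq> hcube a l \<Longrightarrow>
      2 * emeasure lborel E \<le> ennreal (l ^ DIM('a)) \<Longrightarrow>
      emeasure (wmeasure u) E \<le> ennreal \<delta> * emeasure (wmeasure u) (hcube a l)"
    using A_infinity_cubes by blast
  \<comment> \<open>A cube of side l sits in the ball of radius l n, whose oscillation bound D (l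
    n)^n is rewritten as a multiple of l^n.\<close>
  define D' where "D' = D * real n ^ n"
  have D': "0 < D'" using D by (simp add: D'_def n_def)
  have cube: "(\<integral>\<^sup>+x\<in>hcube a l. ennreal \<bar>\<beta> x - m\<bar> \<partial>lborel) \<le> ennreal (D' * l ^ DIM('a))"
    if "0 < l" "osc_le \<beta> D m (a + (l / 2) *\<^sub>R One) (l * DIM('a))" for a l m
  proof -
    have "(\<integral>\<^sup>+x\<in>hcube a l. ennreal \<bar>\<beta> x - m\<bar> \<partial>lborel)
        \<le> (\<integral>\<^sup>+x\<in>ball (a + (l / 2) *\<^sub>R One) (l * DIM('a)). ennreal \<bar>\<beta> x - m\<bar> \<partial>lborel)"
      using hcube_subset_ball[OF that(1), of a] by (intro nn_integral_mono) (auto simp: indicator_def)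
    also have "\<dots> \<le> ennreal (D * (l * DIM('a)) ^ DIM('a))"
      using that(2) by (simp add: osc_le_def)
    finally show ?thesis by (simp add: D'_def n_def power_mult_distrib mult_ac)
  qed
  interpret JN: John_Nirenberg "wmeasure u" \<beta> D' \<delta>
  proof
    show "\<exists>m. (\<integral>\<^sup>+x\<in>hcube a l. ennreal \<bar>\<beta> x - m\<bar> \<partial>lborel) \<le> ennreal (D' * l ^ DIM('a))" if "0 < l" for a l
      using osc[of "l * DIM('a)" "a + (l / 2) *\<^sub>R One"] cube[OF that] that by auto
  qed (use D' \<delta> in auto)
  obtain \<epsilon> C where \<epsilon>: "0 < \<epsilon>" "0 < C" and exp_int:
    "\<And>a l m. 0 < l \<Longrightarrow> (\<integral>\<^sup>+x\<in>hcube a l. ennreal \<bar>\<beta> x - m\<bar> \<partial>lborel) \<le> ennreal (D' * l ^ DIM('a)) \<Longrightarrow>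
       (\<integral>\<^sup>+x\<in>hcube a l. ennreal (exp (\<epsilon> * \<bar>\<beta> x - m\<bar>)) \<partial>wmeasure u)
          \<le> ennreal C * emeasure (wmeasure u) (hcube a l)"
    using JN.exponential_integrability by blast
  define \<Delta> where "\<Delta> = (D + D * (2 * real n) ^ n) / unit_ball_vol (DIM('a))"
  define C' where "C' = exp (\<epsilon> * \<Delta>) * C * (K * ((2 * real n) ^ n) powr (1 + c))"
  have C': "0 < C'" using \<epsilon> K_pos by (simp add: C'_def n_def)
  have "(\<integral>\<^sup>+x\<in>ball z r. ennreal (exp (t * (\<beta> x - m)) * u x) \<partial>lborel)
        \<le> ennreal (C' * ball_mass u z r)"
    if r: "0 < r" and m: "osc_le \<beta> D m z r" and t: "\<bar>t\<bar> \<le> \<epsilon>" for z r m t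
  proof -
    define a where "a = z - r *\<^sub>R (One::'a)"
    have center: "a + (2 * r / 2) *\<^sub>R One = z" by (simp add: a_def)
    have big: "hcube a (2 * r) \<subseteq> ball z (2 * r * DIM('a))"
      using hcube_subset_ball[of "2 * r" a] r unfolding center by simp
    have small: "ball z r \<subseteq> hcube a (2 * r)"
      unfolding a_def by (rule ball_subset_hcube)
    have pos: "0 < 2 * r * DIM('a)" using r by simp
    obtain m' where m': "osc_le \<beta> D m' z (2 * r * DIM('a))"
      using osc[OF pos] by blast
    have "osc_le \<beta> (D * (2 * r * DIM('a) / r) ^ DIM('a)) m' z r"
      using small big by (intro osc_le_subset[OF m' _ r]) auto
    then have "osc_le \<beta> (D * (2 * real n) ^ n) m' z r"
      using r by (simp add: n_def)
    then have mm: "\<bar>m - m'\<bar> \<le> \<Delta>"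
      unfolding \<Delta>_def using D by (intro osc_le_diff[OF _ m _ r]) auto
    have "(\<integral>\<^sup>+x\<in>ball z r. ennreal (exp (t * (\<beta> x - m)) * u x) \<partial>lborel)
        \<le> (\<integral>\<^sup>+x. ennreal (exp (\<epsilon> * \<Delta>)) * (ennreal (u x) *
            (ennreal (exp (\<epsilon> * \<bar>\<beta> x - m'\<bar>)) * indicator (hcube a (2 * r)) x)) \<partial>lborel)"
    proof (intro nn_integral_mono)
      fix x
      have "t * (\<beta> x - m) \<le> \<bar>t\<bar> * \<bar>\<beta> x - m\<bar>"
        using abs_ge_self[of "t * (\<beta> x - m)"] by (simp add: abs_mult)
      also have "\<dots> \<le> \<epsilon> * (\<Delta> + \<bar>\<beta> x - m'\<bar>)"
        using t mm \<epsilon> by (intro mult_mono) auto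
      finally have "exp (t * (\<beta> x - m)) \<le> exp (\<epsilon> * \<Delta>) * exp (\<epsilon> * \<bar>\<beta> x - m'\<bar>)"
        by (simp add: distrib_left flip: exp_add)
      then have "exp (t * (\<beta> x - m)) * u x \<le> exp (\<epsilon> * \<Delta>) * exp (\<epsilon> * \<bar>\<beta> x - m'\<bar>) * u x"
        using u_pos[of x] by (intro mult_right_mono) auto
      then have "ennreal (exp (t * (\<beta> x - m)) * u x)
         \<le> ennreal (exp (\<epsilon> * \<Delta>)) * (ennreal (u x) * ennreal (exp (\<epsilon> * \<bar>\<beta> x - m'\<bar>)))"
        using u_pos[of x] by (simp add: ennreal_leI mult_ac flip: ennreal_mult)
      then show "ennreal (exp (t * (\<beta> x - m)) * u x) * indicator (ball z r) x \<le>
        ennreal (exp (\<epsilon> * \<Delta>)) * (ennreal (u x) *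
            (ennreal (exp (\<epsilon> * \<bar>\<beta> x - m'\<bar>)) * indicator (hcube a (2 * r)) x))"
        using small by (cases "x \<in> ball z r") (auto simp: indicator_def)
    qed
    also have "\<dots> = ennreal (exp (\<epsilon> * \<Delta>)) *
        (\<integral>\<^sup>+x\<in>hcube a (2 * r). ennreal (exp (\<epsilon> * \<bar>\<beta> x - m'\<bar>)) \<partial>wmeasure u)"
      by (subst nn_integral_wmeasure) (auto simp: nn_integral_cmult)
    also have "\<dots> \<le> ennreal (exp (\<epsilon> * \<Delta>)) * (ennreal C * emeasure (wmeasure u) (hcube a (2 * r)))"
      using r m' center by (intro mult_left_mono exp_int cube) auto
    also have "\<dots> \<le> ennreal (exp (\<epsilon> * \<Delta>)) * (ennreal C * emeasure (wmeasure u) (ball z (2 * r * DIM('a))))"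
      by (intro mult_left_mono emeasure_mono big) auto
    also have "\<dots> = ennreal (exp (\<epsilon> * \<Delta>) * C * ball_mass u z (2 * r * DIM('a)))"
      using \<epsilon> by (simp add: emeasure_ball_eq ennreal_mult mult_ac)
    also have "\<dots> \<le> ennreal (exp (\<epsilon> * \<Delta>) * C * (K * ((2 * r * DIM('a) / r) ^ DIM('a)) powr (1 + c) *
        ball_mass u z r))"
      using small big \<epsilon> by (intro ennreal_leI mult_left_mono ball_growth r) auto
    also have "\<dots> = ennreal (C' * ball_mass u z r)"
      using r by (simp add: C'_def n_def mult_ac)
    finally show ?thesis .
  qed
  with \<epsilon>(1) C' show ?thesis by (rule that)
qed

text \<open>With A = u(B) / |B|, the inequality ln x \<le> x is used for x = u / A, which has mean
  1, and for x = (A / u)^(1/c), whose mean is bounded by the Muckenhoupt condition. Together they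
  bound both signs of ln u - ln A.\<close>

lemma log_osc_le:
  assumes r: "0 < r"
  shows "osc_le (\<lambda>x. ln (u x)) ((1 + c * K powr (1 / c)) * unit_ball_vol (DIM('a)))
    (ln (ball_mass u z r / measure lborel (ball z r))) z r"
proof -
  define V S B where "V = ball_mass u z r" and "S = ball_mass \<sigma> z r"
      and "B = measure lborel (ball z r)"
  have pos: "0 < V" "0 < S" "0 < B"
    using ball_pos[OF r] dual_ball_pos[OF r] measure_lborel_ball_pos[OF r] by (auto simp: V_def S_def B_def)
  define A where "A = V / B"
  have A: "0 < A" using pos by (simp add: A_def)
  have pt: "\<bar>ln (u x) - ln A\<bar> \<le> (1 / A) * u x + c * A powr (1 / c) * \<sigma> x" for x
  proof -
    have u: "0 < u x" by (rule u_pos)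
    have "ln (u x / A) \<le> u x / A" using ln_bound[of "u x / A"] u A by simp
    then have 1: "ln (u x) - ln A \<le> u x / A" using u A by (simp add: ln_div)
    have "ln ((A / u x) powr (1 / c)) \<le> (A / u x) powr (1 / c)"
      using u A by (intro ln_bound) simp
    then have "ln A - ln (u x) \<le> c * (A / u x) powr (1 / c)"
      using u A c_pos by (simp add: ln_powr ln_div field_simps)
    moreover have "(A / u x) powr (1 / c) = A powr (1 / c) * \<sigma> x"
      using u A by (simp add: powr_divide powr_minus_divide)
    moreover have "0 \<le> u x / A" "0 \<le> c * (A powr (1 / c) * \<sigma> x)" using u A c_pos by auto
    ultimately show ?thesis using 1 by (simp add: abs_le_iff)
  qed
  have "(\<integral>\<^sup>+x\<in>ball z r. ennreal \<bar>ln (u x) - ln A\<bar> \<partial>lborel)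
     \<le> (\<integral>\<^sup>+x. ennreal (1 / A) * (ennreal (u x) * indicator (ball z r) x)
          + ennreal (c * A powr (1 / c)) * (ennreal (\<sigma> x) * indicator (ball z r) x) \<partial>lborel)"
  proof (intro nn_integral_mono)
    fix x
    have "ennreal \<bar>ln (u x) - ln A\<bar> \<le> ennreal ((1 / A) * u x + c * A powr (1 / c) * \<sigma> x)"
      by (intro ennreal_leI pt)
    also have "\<dots> = ennreal (1 / A) * ennreal (u x) + ennreal (c * A powr (1 / c)) * ennreal (\<sigma> x)"
    proof -
      have "ennreal ((1 / A) * u x + c * A powr (1 / c) * \<sigma> x)
          = ennreal ((1 / A) * u x) + ennreal (c * A powr (1 / c) * \<sigma> x)"
        using A u_pos[of x] c_pos by (intro ennreal_plus) (auto intro: less_imp_le)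
      also have "ennreal ((1 / A) * u x) = ennreal (1 / A) * ennreal (u x)"
        using A u_pos[of x] by (intro ennreal_mult) (auto intro: less_imp_le)
      also have "ennreal (c * A powr (1 / c) * \<sigma> x) = ennreal (c * A powr (1 / c)) * ennreal (\<sigma> x)"
        using c_pos by (intro ennreal_mult) auto
      finally show ?thesis .
    qed
    finally show "ennreal \<bar>ln (u x) - ln A\<bar> * indicator (ball z r) x \<le>
       ennreal (1 / A) * (ennreal (u x) * indicator (ball z r) x)
          + ennreal (c * A powr (1 / c)) * (ennreal (\<sigma> x) * indicator (ball z r) x)"
      by (auto simp: indicator_def)
  qed
  also have "\<dots> = ennreal (1 / A) * ennreal V + ennreal (c * A powr (1 / c)) * ennreal S"
    using emeasure_ball_eq[of z r] dual_emeasure_ball_eq[of z r]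
    by (subst nn_integral_add)
       (simp_all add: nn_integral_cmult emeasure_wmeasure V_def S_def)
  also have "\<dots> = ennreal (V / A + c * (A powr (1 / c) * S))"
    using A pos c_pos by (simp add: ennreal_plus ennreal_mult'' divide_inverse mult_ac)
  also have "\<dots> \<le> ennreal ((1 + c * K powr (1 / c)) * B)"
  proof (intro ennreal_leI)
    have "A powr (1 / c) * S = (V * S powr c / B) powr (1 / c)"
      using pos c_pos by (simp add: A_def powr_divide powr_mult powr_powr)
    also have "\<dots> \<le> (K * B powr (1 + c) / B) powr (1 / c)"
      using A_bound[OF r, of z] pos c_pos
      by (intro powr_mono2 divide_right_mono) (auto simp: V_def S_def B_def)
    also have "K * B powr (1 + c) / B = K * B powr c"
      using pos by (simp add: powr_add)
    also have "(K * B powr c) powr (1 / c) = K powr (1 / c) * B"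
      using pos c_pos K_pos by (simp add: powr_mult powr_powr)
    finally have "A powr (1 / c) * S \<le> K powr (1 / c) * B" .
    then have "c * (A powr (1 / c) * S) \<le> c * (K powr (1 / c) * B)"
      using c_pos by (intro mult_left_mono) auto
    moreover have "V / A = B" using pos by (simp add: A_def)
    ultimately show "V / A + c * (A powr (1 / c) * S) \<le> (1 + c * K powr (1 / c)) * B"
      by (simp add: algebra_simps)
  qed
  finally show ?thesis
    using r unfolding osc_le_def A_def V_def B_def by (simp add: measure_lborel_ball mult_ac)
qed

text \<open>The relation c = q (p - 1) / p makes u^(1/q) \<sigma>^(1 - 1/p) identically 1. In terms
  of w = u^(1/q) the two weights are w^p and w^-p', the usual pair for the A(p,q) condition.\<close>

lemma Holder_ball:
  assumes [measurable]: "f \<in> borel_measurable borel" and p: "1 < p" "p < q" and c: "c = q * (p - 1) / p"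
  shows "(\<integral>\<^sup>+x\<in>ball z r. f x \<partial>lborel)
    \<le> epow (\<integral>\<^sup>+x\<in>ball z r. epow (f x) p * ennreal (u x powr (p / q)) \<partial>lborel) (1 / p)
       * ennreal (ball_mass \<sigma> z r powr (1 - 1 / p))"
proof -
  have one: "u x powr (1 / q) * \<sigma> x powr (1 - 1 / p) = 1" for x
  proof -
    have "u x powr (1 / q) * \<sigma> x powr (1 - 1 / p) = u x powr (1 / q + (- 1 / c) * (1 - 1 / p))"
      by (simp add: powr_powr flip: powr_add)
    also have "1 / q + (- 1 / c) * (1 - 1 / p) = 0"
      using p by (simp add: c field_simps)
    finally show ?thesis using u_pos[of x] by simp
  qed
  have "f x * indicator (ball z r) x =
     epow (epow (f x) p * ennreal (u x powr (p / q)) * indicator (ball z r) x) (1 / p)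
     * epow (ennreal (\<sigma> x) * indicator (ball z r) x) (1 - 1 / p)" for x
  proof (cases "x \<in> ball z r")
    case True
    have "epow (epow (f x) p * ennreal (u x powr (p / q))) (1 / p) * epow (ennreal (\<sigma> x)) (1 - 1 / p)
      = f x * ennreal (u x powr (1 / q) * \<sigma> x powr (1 - 1 / p))"
      using p by (simp add: epow_mult epow_epow epow_ennreal powr_powr ennreal_mult mult.assoc)
    then show ?thesis using True one by simp
  qed simp
  then have "(\<integral>\<^sup>+x\<in>ball z r. f x \<partial>lborel) = (\<integral>\<^sup>+x. epow (epow (f x) p * ennreal (u x powr (p / q)) * indicator (ball z r) x) (1 / p)
     * epow (ennreal (\<sigma> x) * indicator (ball z r) x) (1 - 1 / p) \<partial>lborel)"
    by simp
  also have "\<dots> \<le> epow (\<integral>\<^sup>+x\<in>ball z r. epow (f x) p * ennreal (u x powr (p / q)) \<partial>lborel) (1 / p)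
     * epow (\<integral>\<^sup>+x\<in>ball z r. ennreal (\<sigma> x) \<partial>lborel) (1 - 1 / p)"
    using p by (intro Holder_nn_integral; (measurable | simp))
  also have "(\<integral>\<^sup>+x\<in>ball z r. ennreal (\<sigma> x) \<partial>lborel) = ennreal (ball_mass \<sigma> z r)"
    using dual_emeasure_ball_eq[of z r] by (simp add: emeasure_wmeasure)
  finally show ?thesis by (simp add: epow_ennreal)
qed

text \<open>Hoelder's inequality leaves a power of \<sigma>(B), which the Muckenhoupt condition
  raised to 1/q exchanges for u(B)^(-1/q). The exponent (1 + c) / q equals 1/q + 1 - 1/p, so the
  left-hand side is a fractional average of the order linking p to q. This gives the pointwise bound
  on the far part of the Morrey estimate.\<close>

lemma fractional_average_le:
  assumes [measurable]: "f \<in> borel_measurable borel" and p: "1 < p" "p < q" and c: "c = q * (p - 1) / p"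
    and r: "0 < r"
  shows "ennreal (measure lborel (ball z r) powr (- (1 + c) / q)) * (\<integral>\<^sup>+x\<in>ball z r. f x \<partial>lborel)
    \<le> ennreal (K powr (1 / q) * ball_mass u z r powr (- 1 / q))
      * epow (\<integral>\<^sup>+x\<in>ball z r. epow (f x) p * ennreal (u x powr (p / q)) \<partial>lborel) (1 / p)"
proof -
  define V S B where "V = ball_mass u z r" and "S = ball_mass \<sigma> z r"
      and "B = measure lborel (ball z r)"
  have pos: "0 < V" "0 < S" "0 < B"
    using ball_pos[OF r] dual_ball_pos[OF r] measure_lborel_ball_pos[OF r] by (auto simp: V_def S_def B_def)
  have "(V * S powr c) powr (1 / q) \<le> (K * B powr (1 + c)) powr (1 / q)"
    using A_bound[OF r, of z] p pos by (intro powr_mono2) (auto simp: V_def S_def B_def)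
  then have "V powr (1 / q) * S powr (c / q) \<le> K powr (1 / q) * B powr ((1 + c) / q)"
    using pos K_pos by (simp add: powr_mult powr_powr)
  moreover have "c / q = 1 - 1 / p" using p by (simp add: c field_simps)
  ultimately have main: "V powr (1 / q) * S powr (1 - 1 / p) \<le> K powr (1 / q) * B powr ((1 + c) / q)"
    by simp
  have "B powr (- (1 + c) / q) * S powr (1 - 1 / p) \<le> K powr (1 / q) * V powr (- 1 / q)"
  proof -
    define b v where "b = B powr ((1 + c) / q)" and "v = V powr (1 / q)"
    have e: "B powr (- (1 + c) / q) = 1 / b" "V powr (- 1 / q) = 1 / v"
      unfolding b_def v_def by (metis minus_divide_left powr_minus_divide)+
    have "0 < b" "0 < v" using pos by (auto simp: b_def v_def)
    then show ?thesis
      using main unfolding e by (simp add: field_simps flip: b_def v_def)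
  qed
  then have *: "ennreal (B powr (- (1 + c) / q)) * ennreal (S powr (1 - 1 / p)) \<le> ennreal (K powr (1 / q) * V powr (- 1 / q))"
    by (simp add: ennreal_leI flip: ennreal_mult)
  have "ennreal (B powr (- (1 + c) / q)) * (\<integral>\<^sup>+x\<in>ball z r. f x \<partial>lborel)
    \<le> ennreal (B powr (- (1 + c) / q)) *
       (epow (\<integral>\<^sup>+x\<in>ball z r. epow (f x) p * ennreal (u x powr (p / q)) \<partial>lborel) (1 / p) * ennreal (S powr (1 - 1 / p)))"
    unfolding S_def by (intro mult_left_mono Holder_ball assms) auto
  also have "\<dots> = ennreal (B powr (- (1 + c) / q)) * ennreal (S powr (1 - 1 / p)) *
      epow (\<integral>\<^sup>+x\<in>ball z r. epow (f x) p * ennreal (u x powr (p / q)) \<partial>lborel) (1 / p)"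
    by (simp only: mult_ac)
  also have "\<dots> \<le> ennreal (K powr (1 / q) * V powr (- 1 / q)) *
      epow (\<integral>\<^sup>+x\<in>ball z r. epow (f x) p * ennreal (u x powr (p / q)) \<partial>lborel) (1 / p)"
    by (intro mult_right_mono *) simp
  finally show ?thesis by (simp add: V_def B_def)
qed


text \<open>Lerner's argument: a fractional average over a ball is controlled, at every point of the ball,
  by the maximal function with respect to the dual weight, and integrating a small power of this
  bound against Lebesgue measure produces an average with respect to \<open>u\<close>.\<close>

lemma fractional_maximal_strong_type:
  assumes p: "1 < p" "p < q" and c: "c = q * (p - 1) / p"
  obtains C where "0 < C" "\<And>f. f \<in> borel_measurable borel \<Longrightarrow>
    (\<integral>\<^sup>+x. epow (supball (\<lambda>z r. ennreal (measure lborel (ball z r) powr (- (1 + c) / q)) *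
        (\<integral>\<^sup>+y\<in>ball z r. f y \<partial>lborel)) x) q * ennreal (u x) \<partial>lborel)
      \<le> ennreal C * epow (\<integral>\<^sup>+x. epow (f x) p * ennreal (u x powr (p / q)) \<partial>lborel) (q / p)"
proof -
  interpret u: doubling_measure "wmeasure u" "K * (5 ^ DIM('a)) powr (1 + c)"
    by (rule doubling)
  interpret s: doubling_measure "wmeasure \<sigma>" "K powr (1 / c) * (5 ^ DIM('a)) powr (1 + 1 / c)"
    by (rule muckenhoupt.doubling[OF dual_muckenhoupt])
  \<comment> \<open>The choice (1 + c) \<eta> = c turns the power q \<eta> of a fractional average
    into |B|^-c times a power of the integral, which fits the Muckenhoupt condition; 1 / \<eta> = 1
    + 1/c > 1 is the exponent at which the maximal function for u is then bounded.\<close>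
  define \<eta> where "\<eta> = c / (1 + c)"
  have \<eta>: "0 < \<eta>" "\<eta> < 1" "1 < 1 / \<eta>" "(1 + c) * \<eta> = c" "1 - 1 / \<eta> = - 1 / c"
    using c_pos by (auto simp: \<eta>_def field_simps)
  define e where "e = (q - p) * \<eta> / p"
  have e: "0 < e" "e / \<eta> = (q - p) / p" using p \<eta> by (auto simp: e_def)
  obtain Cu where Cu: "0 \<le> Cu" "\<And>f. f \<in> borel_measurable borel \<Longrightarrow>
     (\<integral>\<^sup>+x. epow (maximal (wmeasure u) f x) (1 / \<eta>) \<partial>wmeasure u)
       \<le> ennreal Cu * (\<integral>\<^sup>+x. epow (f x) (1 / \<eta>) \<partial>wmeasure u)"
    using u.maximal_strong_type[OF _ \<eta>(3)] u.D_pos \<eta> by (metis ennreal_neg le_cases)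
  obtain Cs where Cs: "0 \<le> Cs" "\<And>f. f \<in> borel_measurable borel \<Longrightarrow>
     (\<integral>\<^sup>+x. epow (maximal (wmeasure \<sigma>) f x) p \<partial>wmeasure \<sigma>)
       \<le> ennreal Cs * (\<integral>\<^sup>+x. epow (f x) p \<partial>wmeasure \<sigma>)"
    using s.maximal_strong_type[OF _ p(1)] by (metis ennreal_neg le_cases)
  define C where "C = K powr (1 / \<eta>) * Cu * Cs + 1"
  have "0 < C" using Cu Cs by (simp add: C_def add_nonneg_pos)
  moreover have "(\<integral>\<^sup>+x. epow (supball (\<lambda>z r. ennreal (measure lborel (ball z r) powr (- (1 + c) / q)) *
        (\<integral>\<^sup>+y\<in>ball z r. f y \<partial>lborel)) x) q * ennreal (u x) \<partial>lborel)
      \<le> ennreal C * epow (\<integral>\<^sup>+x. epow (f x) p * ennreal (u x powr (p / q)) \<partial>lborel) (q / p)"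
    if f [measurable]: "f \<in> borel_measurable borel" for f
  proof -
    define N where "N = (\<integral>\<^sup>+x. epow (f x) p * ennreal (u x powr (p / q)) \<partial>lborel)"
    \<comment> \<open>g is f / \<sigma>, so its average for the measure \<sigma> is the Lebesgue
      integral of f over the ball divided by \<sigma>(B).\<close>
    define g where "g x = f x * ennreal (u x powr (1 / c))" for x
    have [measurable]: "g \<in> borel_measurable borel" unfolding g_def by measurable
    define G where "G = maximal (wmeasure \<sigma>) g"
    have [measurable]: "G \<in> borel_measurable borel"
      unfolding G_def maximal_def by (rule supball_measurable)
    \<comment> \<open>The factor 1 / u converts Lebesgue integrals of G^(p \<eta>) over balls into
      integrals of H for the measure u.\<close>
    define H where "H x = epow (G x) (p * \<eta>) * ennreal (1 / u x)" for x
    have [measurable]: "H \<in> borel_measurable borel" unfolding H_def by measurable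
    define A where "A z r = ennreal (measure lborel (ball z r) powr (- (1 + c) / q)) *
        (\<integral>\<^sup>+y\<in>ball z r. f y \<partial>lborel)" for z r
    have key: "epow (supball A x) (q * \<eta>) \<le> ennreal K * epow N e * maximal (wmeasure u) H x" for x
    proof -
      have "supball A x \<le> epow (ennreal K * epow N e * maximal (wmeasure u) H x) (1 / (q * \<eta>))"
      proof (rule supball_least)
        fix z r assume r: "0 < (r::real)" and x: "x \<in> ball z r"
        define V S B where "V = ball_mass u z r" and "S = ball_mass \<sigma> z r"
          and "B = measure lborel (ball z r)"
        define I where "I = (\<integral>\<^sup>+y\<in>ball z r. f y \<partial>lborel)"
        have pos: "0 < V" "0 < S" "0 < B"
          using ball_pos[OF r] dual_ball_pos[OF r] measure_lborel_ball_pos[OF r] by (auto simp: V_def S_def B_def)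
        have I_le: "I \<le> ennreal S * G y" if y: "y \<in> ball z r" for y
        proof -
          have sg: "ennreal (\<sigma> x) * g x = f x" for x
          proof -
            have "ennreal (\<sigma> x) * ennreal (u x powr (1 / c)) = 1"
              using u_pos[of x] by (simp flip: ennreal_mult powr_add)
            then show ?thesis unfolding g_def by (metis mult.assoc mult.commute mult.right_neutral)
          qed
          have "(\<integral>\<^sup>+y\<in>ball z r. g y \<partial>wmeasure \<sigma>)
              = (\<integral>\<^sup>+y. ennreal (\<sigma> y) * (g y * indicator (ball z r) y) \<partial>lborel)"
            by (rule nn_integral_wmeasure) measurable
          also have "\<dots> = I"
            unfolding I_def by (simp only: sg flip: mult.assoc)
          finally have "(\<integral>\<^sup>+y\<in>ball z r. g y \<partial>wmeasure \<sigma>) = I" .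
          then have "I / ennreal S \<le> G y"
            using supball_upper[OF y, of "\<lambda>z r. (\<integral>\<^sup>+y\<in>ball z r. g y \<partial>wmeasure \<sigma>) / emeasure (wmeasure \<sigma>) (ball z r)"]
            unfolding G_def maximal_def S_def dual_emeasure_ball_eq by simp
          then have "ennreal S * (I / ennreal S) \<le> ennreal S * G y"
            by (rule mult_left_mono) simp
          moreover have "ennreal S * (I / ennreal S) = I"
            using pos mult_divide_eq_ennreal[of "ennreal S" I] by (simp add: ennreal_times_divide mult.commute)
          ultimately show ?thesis by simp
        qed
        have I_Holder: "I \<le> epow N (1 / p) * ennreal (S powr (1 - 1 / p))"
        proof -
          have "(\<integral>\<^sup>+x\<in>ball z r. epow (f x) p * ennreal (u x powr (p / q)) \<partial>lborel) \<le> N"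
            unfolding N_def by (intro nn_integral_mono) (auto simp: indicator_def)
          then have "epow (\<integral>\<^sup>+x\<in>ball z r. epow (f x) p * ennreal (u x powr (p / q)) \<partial>lborel) (1 / p) \<le> epow N (1 / p)"
            using p by (intro epow_mono) auto
          then show ?thesis
            unfolding I_def S_def using Holder_ball[OF f p c, of z r]
            by (meson mult_right_mono order_trans zero_le)
        qed
        define X where "X = epow (A z r) (q * \<eta>)"
        have X_eq: "X = ennreal (B powr - c) * epow I (q * \<eta>)"
        proof -
          have "- (1 + c) / q * (q * \<eta>) = - ((1 + c) * \<eta>)"
            using p by (simp add: minus_divide_left[symmetric] del: minus_add_distrib)
          then have "- (1 + c) / q * (q * \<eta>) = - c" unfolding \<eta>(4) .
          then show ?thesis
            using p \<eta> unfolding X_def A_def I_def[symmetric] B_def[symmetric]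
            by (simp only: epow_mult mult_pos_pos epow_ennreal powr_ge_zero powr_powr)
        qed
        \<comment> \<open>Of the power q \<eta> of the integral I, the part (q - p) \<eta> is
          estimated by Hoelder's inequality, producing a power of the global norm N, and the part p
          \<eta> by the maximal function at an arbitrary point y of the ball. The powers of
          \<sigma>(B) add up to (1 + c) \<eta> = c.\<close>
        have X_le: "X \<le> ennreal (K * B / V) * epow N e * epow (G y) (p * \<eta>)" if y: "y \<in> ball z r" for y
        proof -
          have "epow I (q * \<eta>) = epow I ((q - p) * \<eta>) * epow I (p * \<eta>)"
            using p \<eta> by (subst epow_add[symmetric]) (auto simp: algebra_simps)
          also have "\<dots> \<le> epow (epow N (1 / p) * ennreal (S powr (1 - 1 / p))) ((q - p) * \<eta>)
               * epow (ennreal S * G y) (p * \<eta>)"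
            using p \<eta> by (intro mult_mono epow_mono I_Holder I_le y) auto
          also have "\<dots> = epow N e * ennreal (S powr ((1 - 1 / p) * ((q - p) * \<eta>)))
              * (ennreal (S powr (p * \<eta>)) * epow (G y) (p * \<eta>))"
            using p \<eta> pos by (simp add: epow_mult epow_epow epow_ennreal powr_powr e_def)
          also have "\<dots> = epow N e * ennreal (S powr ((1 - 1 / p) * ((q - p) * \<eta>) + p * \<eta>)) * epow (G y) (p * \<eta>)"
            by (simp add: powr_add ennreal_mult mult_ac)
          also have "(1 - 1 / p) * ((q - p) * \<eta>) + p * \<eta> = (1 + c) * \<eta>"
            using p by (simp add: c field_simps)
          finally have "epow I (q * \<eta>) \<le> epow N e * ennreal (S powr c) * epow (G y) (p * \<eta>)"
            by (simp add: \<eta>(4))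
          then have "X \<le> ennreal (B powr - c) * (epow N e * ennreal (S powr c) * epow (G y) (p * \<eta>))"
            unfolding X_eq by (rule mult_left_mono) simp
          also have "\<dots> = ennreal (B powr - c * S powr c) * (epow N e * epow (G y) (p * \<eta>))"
            by (simp add: ennreal_mult mult_ac)
          also have "\<dots> \<le> ennreal (K * B / V) * (epow N e * epow (G y) (p * \<eta>))"
          proof (intro mult_right_mono ennreal_leI)
            have "V * S powr c \<le> K * (B * B powr c)"
              using A_bound[OF r, of z] pos by (simp add: V_def S_def B_def powr_add)
            then show "B powr - c * S powr c \<le> K * B / V"
              using pos by (simp add: powr_minus field_simps)
          qed simp
          finally show ?thesis by (simp add: mult.assoc)
        qed
        define J where "J = (\<integral>\<^sup>+y\<in>ball z r. H y \<partial>wmeasure u)"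
        have J: "J = (\<integral>\<^sup>+y\<in>ball z r. epow (G y) (p * \<eta>) \<partial>lborel)"
        proof -
          have "ennreal (u y) * H y = epow (G y) (p * \<eta>)" for y
          proof -
            have "ennreal (u y) * ennreal (1 / u y) = 1"
              using u_pos[of y] by (simp flip: ennreal_mult)
            then show ?thesis unfolding H_def by (metis mult.left_commute mult.right_neutral)
          qed
          moreover have "J = (\<integral>\<^sup>+y. ennreal (u y) * (H y * indicator (ball z r) y) \<partial>lborel)"
            unfolding J_def by (rule nn_integral_wmeasure) measurable
          ultimately show ?thesis
            by (simp only: flip: mult.assoc)
        qed
        \<comment> \<open>X is free of y, so averaging the bound over the ball keeps the left-hand
          side and leaves a u-average of H on the right, which the maximal function at x
          dominates.\<close>
        have "ennreal B * X = (\<integral>\<^sup>+y\<in>ball z r. X \<partial>lborel)"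
          by (simp add: nn_integral_cmult_indicator emeasure_lborel_ball B_def mult.commute)
        also have "\<dots> \<le> (\<integral>\<^sup>+y. ennreal (K * B / V) * epow N e * (epow (G y) (p * \<eta>) * indicator (ball z r) y) \<partial>lborel)"
          using X_le by (intro nn_integral_mono) (auto simp: indicator_def)
        also have "\<dots> = ennreal (K * B / V) * epow N e * J"
          unfolding J by (rule nn_integral_cmult) measurable
        also have "\<dots> = ennreal B * (ennreal K * epow N e * (J / ennreal V))"
        proof -
          have "ennreal (K * B / V) = ennreal B * ennreal K * inverse (ennreal V)"
            using pos K_pos by (simp add: inverse_ennreal divide_inverse mult_ac flip: ennreal_mult)
          then show ?thesis by (simp add: divide_ennreal_def mult_ac)
        qed
        finally have "X \<le> ennreal K * epow N e * (J / ennreal V)"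
          using pos by (subst (asm) ennreal_mult_le_mult_iff) auto
        also have "\<dots> \<le> ennreal K * epow N e * maximal (wmeasure u) H x"
          using supball_upper[OF x, of "\<lambda>z r. (\<integral>\<^sup>+y\<in>ball z r. H y \<partial>wmeasure u) / emeasure (wmeasure u) (ball z r)"]
          unfolding maximal_def J_def V_def emeasure_ball_eq by (intro mult_left_mono) auto
        finally show "A z r \<le> epow (ennreal K * epow N e * maximal (wmeasure u) H x) (1 / (q * \<eta>))"
          using p \<eta> by (subst epow_le_iff_le_epow[symmetric]) (auto simp: X_def)
      qed
      then show ?thesis
        using p \<eta> by (subst epow_le_iff_le_epow) auto
    qed
    have "epow (supball A x) q \<le> ennreal (K powr (1 / \<eta>)) * epow N ((q - p) / p) * epow (maximal (wmeasure u) H x) (1 / \<eta>)" for x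
    proof -
      have "epow (supball A x) q = epow (epow (supball A x) (q * \<eta>)) (1 / \<eta>)"
        using p \<eta> by (simp add: epow_epow)
      also have "\<dots> \<le> epow (ennreal K * epow N e * maximal (wmeasure u) H x) (1 / \<eta>)"
        using \<eta> by (intro epow_mono key) auto
      also have "\<dots> = ennreal (K powr (1 / \<eta>)) * epow N (e / \<eta>) * epow (maximal (wmeasure u) H x) (1 / \<eta>)"
        using \<eta> e K_pos by (simp add: epow_mult epow_epow epow_ennreal)
      finally show ?thesis by (simp add: e(2))
    qed
    then have "(\<integral>\<^sup>+x. epow (supball A x) q * ennreal (u x) \<partial>lborel)
      \<le> (\<integral>\<^sup>+x. ennreal (K powr (1 / \<eta>)) * epow N ((q - p) / p) * (ennreal (u x) * epow (maximal (wmeasure u) H x) (1 / \<eta>)) \<partial>lborel)"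
      by (intro nn_integral_mono) (metis mult.assoc mult.commute mult_right_mono zero_le)
    also have "\<dots> = ennreal (K powr (1 / \<eta>)) * epow N ((q - p) / p) *
        (\<integral>\<^sup>+x. epow (maximal (wmeasure u) H x) (1 / \<eta>) \<partial>wmeasure u)"
    proof -
      have [measurable]: "maximal (wmeasure u) H \<in> borel_measurable borel"
        unfolding maximal_def by (rule supball_measurable)
      show ?thesis
        by (subst nn_integral_wmeasure) (auto intro!: nn_integral_cmult)
    qed
    also have "\<dots> \<le> ennreal (K powr (1 / \<eta>)) * epow N ((q - p) / p) * (ennreal Cu * (ennreal Cs * N))"
    proof (intro mult_left_mono)
      have "(\<integral>\<^sup>+x. epow (H x) (1 / \<eta>) \<partial>wmeasure u) = (\<integral>\<^sup>+x. epow (G x) p \<partial>wmeasure \<sigma>)"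
      proof -
        \<comment> \<open>Here u (1 / u)^(1/\<eta>) = \<sigma> because 1 - 1/\<eta> = - 1/c, so the
          norm of H for u is a norm of G for \<sigma>, ready for the second maximal
          inequality.\<close>
        have "ennreal (u x) * epow (H x) (1 / \<eta>) = ennreal (\<sigma> x) * epow (G x) p" for x
        proof -
          have "u x * (1 / u x) powr (1 / \<eta>) = u x powr (1 - 1 / \<eta>)"
            using u_pos[of x] by (simp add: powr_divide powr_diff)
          then have "u x * (1 / u x) powr (1 / \<eta>) = \<sigma> x" unfolding \<eta>(5) .
          then have "ennreal (u x) * ennreal ((1 / u x) powr (1 / \<eta>)) = ennreal (\<sigma> x)"
            using u_pos[of x] by (simp flip: ennreal_mult)
          moreover have "epow (H x) (1 / \<eta>) = epow (G x) p * ennreal ((1 / u x) powr (1 / \<eta>))"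
            using \<eta> p u_pos[of x] by (simp add: H_def epow_mult epow_epow epow_ennreal)
          ultimately show ?thesis by (metis mult.assoc mult.commute)
        qed
        then show ?thesis by (simp add: nn_integral_wmeasure)
      qed
      also have "\<dots> \<le> ennreal Cs * (\<integral>\<^sup>+x. epow (g x) p \<partial>wmeasure \<sigma>)"
        unfolding G_def by (rule Cs(2)) measurable
      also have "(\<integral>\<^sup>+x. epow (g x) p \<partial>wmeasure \<sigma>) = N"
      proof -
        have "ennreal (\<sigma> x) * epow (g x) p = epow (f x) p * ennreal (u x powr (p / q))" for x
        proof -
          have "- 1 / c + 1 / c * p = (p - 1) / c" by (simp add: diff_divide_distrib)
          also have "\<dots> = p / q" using p by (simp add: c)
          finally have "- 1 / c + 1 / c * p = p / q" .
          then have "\<sigma> x * (u x powr (1 / c)) powr p = u x powr (p / q)"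
            by (metis powr_add powr_powr)
          then have "ennreal (\<sigma> x) * ennreal ((u x powr (1 / c)) powr p) = ennreal (u x powr (p / q))"
            by (metis ennreal_mult powr_ge_zero)
          moreover have "epow (g x) p = epow (f x) p * ennreal ((u x powr (1 / c)) powr p)"
            using p by (simp add: g_def epow_mult epow_ennreal)
          ultimately show ?thesis by (metis mult.left_commute)
        qed
        then show ?thesis by (simp add: nn_integral_wmeasure N_def)
      qed
      finally have "ennreal Cu * (\<integral>\<^sup>+x. epow (H x) (1 / \<eta>) \<partial>wmeasure u) \<le> ennreal Cu * (ennreal Cs * N)"
        by (rule mult_left_mono) simp
      then show "(\<integral>\<^sup>+x. epow (maximal (wmeasure u) H x) (1 / \<eta>) \<partial>wmeasure u) \<le> ennreal Cu * (ennreal Cs * N)"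
        by (rule order_trans[OF Cu(2), rotated]) measurable
    qed simp
    also have "\<dots> = ennreal (K powr (1 / \<eta>) * Cu * Cs) * (epow N ((q - p) / p) * N)"
      using Cu Cs by (simp add: ennreal_mult mult_ac)
    also have "epow N ((q - p) / p) * N = epow N (q / p)"
    proof -
      have "epow N ((q - p) / p) * N = epow N ((q - p) / p + 1)"
        using p by (subst epow_add) auto
      also have "(q - p) / p + 1 = q / p" using p by (simp add: field_simps)
      finally show ?thesis .
    qed
    also have "ennreal (K powr (1 / \<eta>) * Cu * Cs) * epow N (q / p) \<le> ennreal C * epow N (q / p)"
      by (intro mult_right_mono ennreal_leI) (auto simp: C_def)
    finally show ?thesis unfolding A_def N_def .
  qed
  ultimately show thesis using that by blast
qed


text \<open>Since \<open>ln u\<close> and \<open>\<beta>\<close> have bounded mean oscillation, the John-Nirenberg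
  inequalities with respect to \<open>u\<close> and \<open>\<sigma>\<close> replace the reverse Hoelder inequality usually behind the openness of the class.\<close>

lemma power_exp_weight:
  assumes [measurable]: "\<beta> \<in> borel_measurable borel" and D: "0 < D"
    and osc: "\<And>z r. 0 < r \<Longrightarrow> \<exists>m. osc_le \<beta> D m z r"
  obtains \<epsilon> where "0 < \<epsilon>" "\<And>c' s. \<bar>c' - c\<bar> \<le> \<epsilon> \<Longrightarrow> \<bar>s\<bar> \<le> \<epsilon> \<Longrightarrow>
      \<exists>K'. muckenhoupt (\<lambda>x. u x powr (c' / c) * exp (s * \<beta> x)) c' K'"
proof -
  define D1 where "D1 = (1 + c * K powr (1 / c)) * unit_ball_vol (DIM('a))"
  have D1: "0 < D1" unfolding D1_def using c_pos by (intro mult_pos_pos add_pos_nonneg) auto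
  define lg where "lg z r = ln (ball_mass u z r / measure lborel (ball z r))" for z r
  have lg: "osc_le (\<lambda>x. ln (u x)) D1 (lg z r) z r" if "0 < r" for z r
    unfolding D1_def lg_def by (rule log_osc_le[OF that])
  have lnu[measurable]: "(\<lambda>x. ln (u x)) \<in> borel_measurable borel" by measurable
  obtain \<epsilon>1 C1 where 1: "0 < \<epsilon>1" "0 < C1"
    "\<And>z r m t. 0 < r \<Longrightarrow> osc_le (\<lambda>x. ln (u x)) D1 m z r \<Longrightarrow> \<bar>t\<bar> \<le> \<epsilon>1 \<Longrightarrow>
      (\<integral>\<^sup>+x\<in>ball z r. ennreal (exp (t * (ln (u x) - m)) * u x) \<partial>lborel)
        \<le> ennreal (C1 * ball_mass u z r)"
    using exponential_integrability_balls[OF lnu D1] lg by blast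
  obtain \<epsilon>2 C2 where 2: "0 < \<epsilon>2" "0 < C2"
    "\<And>z r m t. 0 < r \<Longrightarrow> osc_le \<beta> D m z r \<Longrightarrow> \<bar>t\<bar> \<le> \<epsilon>2 \<Longrightarrow>
      (\<integral>\<^sup>+x\<in>ball z r. ennreal (exp (t * (\<beta> x - m)) * u x) \<partial>lborel)
        \<le> ennreal (C2 * ball_mass u z r)"
    using exponential_integrability_balls[OF assms(1) D osc] by blast
  obtain \<epsilon>3 C3 where 3: "0 < \<epsilon>3" "0 < C3"
    "\<And>z r m t. 0 < r \<Longrightarrow> osc_le \<beta> D m z r \<Longrightarrow> \<bar>t\<bar> \<le> \<epsilon>3 \<Longrightarrow>
      (\<integral>\<^sup>+x\<in>ball z r. ennreal (exp (t * (\<beta> x - m)) * \<sigma> x) \<partial>lborel)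
        \<le> ennreal (C3 * ball_mass \<sigma> z r)"
    using muckenhoupt.exponential_integrability_balls[OF dual_muckenhoupt assms(1) D osc] by blast
  \<comment> \<open>The first bound keeps c' at least c / 2, which together with the last one keeps
    s / c' within \<open>\<epsilon>3\<close>.\<close>
  define \<epsilon> where "\<epsilon> = min (min (c / 2) (\<epsilon>1 * c / 2)) (min (\<epsilon>2 / 2) (\<epsilon>3 * c / 2))"
  have "0 < \<epsilon>" using c_pos 1 2 3 by (simp add: \<epsilon>_def)
  moreover have "\<exists>K'. muckenhoupt (\<lambda>x. u x powr (c' / c) * exp (s * \<beta> x)) c' K'"
    if cs: "\<bar>c' - c\<bar> \<le> \<epsilon>" "\<bar>s\<bar> \<le> \<epsilon>" for c' s
  proof -
    have c': "c / 2 \<le> c'" "0 < c'"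
    proof -
      have "\<epsilon> \<le> c / 2" by (simp add: \<epsilon>_def)
      then show "c / 2 \<le> c'" using cs(1) by linarith
      then show "0 < c'" using c_pos by linarith
    qed
    \<comment> \<open>For a fixed w and p, changing the exponent q to q' replaces w^q by its power
      q' / q, and c' / c = q' / q. In these terms the perturbation of u is the factor exp (t ln u +
      s \<beta>).\<close>
    define t where "t = c' / c - 1"
    have small: "\<bar>2 * t\<bar> \<le> \<epsilon>1" "\<bar>2 * s\<bar> \<le> \<epsilon>2" "\<bar>- (s / c')\<bar> \<le> \<epsilon>3"
    proof -
      have "\<bar>c' - c\<bar> \<le> \<epsilon>1 * c / 2" using cs(1) by (simp add: \<epsilon>_def)
      moreover have "2 * t = 2 * (c' - c) / c" using c_pos by (simp add: t_def field_simps)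
      then have "\<bar>2 * t\<bar> = 2 * \<bar>c' - c\<bar> / c"
        using c_pos by (simp only: abs_mult abs_divide abs_numeral abs_of_pos)
      moreover have "2 * \<bar>c' - c\<bar> / c \<le> \<epsilon>1" if "\<bar>c' - c\<bar> \<le> \<epsilon>1 * c / 2"
        using that c_pos by (simp add: pos_divide_le_eq)
      ultimately show "\<bar>2 * t\<bar> \<le> \<epsilon>1" by simp
      show "\<bar>2 * s\<bar> \<le> \<epsilon>2" using cs(2) by (simp add: \<epsilon>_def abs_mult)
      have "\<bar>s\<bar> \<le> \<epsilon>3 * c / 2" using cs(2) by (simp add: \<epsilon>_def)
      also have "\<dots> \<le> \<epsilon>3 * c'" using 3(1) mult_left_mono[OF c'(1), of \<epsilon>3] by simp
      finally have "\<bar>s\<bar> / c' \<le> \<epsilon>3" using c' by (simp add: field_simps)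
      then show "\<bar>- (s / c')\<bar> \<le> \<epsilon>3" using c' by simp
    qed
    define C4 where "C4 = (C1 + C2) / 2"
    have C4: "0 < C4" using 1 2 by (simp add: C4_def)
    define u' where "u' x = u x powr (c' / c) * exp (s * \<beta> x)" for x
    have [measurable]: "u' \<in> borel_measurable borel" unfolding u'_def by measurable
    have u'_pos: "0 < u' x" for x using u_pos[of x] by (simp add: u'_def)
    \<comment> \<open>The power of u is such that the dual weight of \<open>u'\<close> differs from
      \<sigma> only by an exponential of \<beta>: the change of c is invisible on the dual
      side.\<close>
    have dual: "u' x powr (- 1 / c') = exp (- (s / c') * \<beta> x) * \<sigma> x" for x
    proof -
      have "u' x powr (- 1 / c') = (u x powr (c' / c)) powr (- 1 / c') * exp (s * \<beta> x) powr (- 1 / c')"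
        using u_pos[of x] by (simp add: u'_def powr_mult)
      also have "(u x powr (c' / c)) powr (- 1 / c') = \<sigma> x"
        using c' by (simp add: powr_powr)
      also have "exp (s * \<beta> x) powr (- 1 / c') = exp (- (s / c') * \<beta> x)"
        by (simp add: powr_def)
      finally show ?thesis by simp
    qed
    have upper: "emeasure (wmeasure u') (ball z r)
        \<le> ennreal (C4 * (exp (t * lg z r + s * m) * ball_mass u z r))"
      if r: "0 < r" and m: "osc_le \<beta> D m z r" for z r m
    proof -
      define E where "E = exp (t * lg z r + s * m)"
      have pt: "u' x \<le> E / 2 * (exp (2 * t * (ln (u x) - lg z r)) * u x + exp (2 * s * (\<beta> x - m)) * u x)" for x
      proof -
        define X Y where "X = exp (t * (ln (u x) - lg z r))" and "Y = exp (s * (\<beta> x - m))"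
        have "u x powr (c' / c) = u x * exp (t * ln (u x))"
        proof -
          have "u x powr (c' / c) = u x powr (1 + t)" by (simp add: t_def)
          also have "\<dots> = u x * u x powr t" using u_pos[of x] by (simp add: powr_add)
          finally show ?thesis using u_pos[of x] by (simp add: powr_def)
        qed
        then have "u' x = E * (X * Y) * u x"
          by (simp add: u'_def E_def X_def Y_def exp_add exp_diff right_diff_distrib field_simps)
        \<comment> \<open>This inequality separates the perturbation by ln u from the one by \<beta>
          at the price of doubling t and s; hence the halves next to \<open>\<epsilon>1\<close> and
          \<open>\<epsilon>2\<close> in the choice of \<epsilon>.\<close>
        moreover have "X * Y \<le> (X\<^sup>2 + Y\<^sup>2) / 2"
          using sum_squares_bound[of X Y] by simp
        then have "E * (X * Y) * u x \<le> E * ((X\<^sup>2 + Y\<^sup>2) / 2) * u x"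
          using u_pos[of x] by (intro mult_right_mono mult_left_mono) (auto simp: E_def)
        moreover have "X\<^sup>2 = exp (2 * t * (ln (u x) - lg z r))" "Y\<^sup>2 = exp (2 * s * (\<beta> x - m))"
          by (simp_all add: X_def Y_def mult.assoc exp_double)
        ultimately show ?thesis by (simp add: algebra_simps)
      qed
      have "emeasure (wmeasure u') (ball z r) = (\<integral>\<^sup>+x\<in>ball z r. ennreal (u' x) \<partial>lborel)"
        by (rule emeasure_wmeasure) measurable
      also have "\<dots> \<le> (\<integral>\<^sup>+x. ennreal (E / 2) *
          (ennreal (exp (2 * t * (ln (u x) - lg z r)) * u x) * indicator (ball z r) x
           + ennreal (exp (2 * s * (\<beta> x - m)) * u x) * indicator (ball z r) x) \<partial>lborel)"
      proof (intro nn_integral_mono)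
        fix x
        have "ennreal (u' x) \<le> ennreal (E / 2 * (exp (2 * t * (ln (u x) - lg z r)) * u x + exp (2 * s * (\<beta> x - m)) * u x))"
          by (intro ennreal_leI pt)
        also have "\<dots> = ennreal (E / 2) * (ennreal (exp (2 * t * (ln (u x) - lg z r)) * u x) + ennreal (exp (2 * s * (\<beta> x - m)) * u x))"
          using u_pos[of x] by (subst ennreal_mult) (auto simp: E_def intro!: arg_cong2[where f="(*)"] ennreal_plus add_nonneg_nonneg)
        finally show "ennreal (u' x) * indicator (ball z r) x \<le> ennreal (E / 2) *
          (ennreal (exp (2 * t * (ln (u x) - lg z r)) * u x) * indicator (ball z r) x
           + ennreal (exp (2 * s * (\<beta> x - m)) * u x) * indicator (ball z r) x)"
          by (cases "x \<in> ball z r") auto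
      qed
      also have "\<dots> = ennreal (E / 2) * ((\<integral>\<^sup>+x\<in>ball z r. ennreal (exp (2 * t * (ln (u x) - lg z r)) * u x) \<partial>lborel)
           + (\<integral>\<^sup>+x\<in>ball z r. ennreal (exp (2 * s * (\<beta> x - m)) * u x) \<partial>lborel))"
      proof (subst nn_integral_cmult)
        show "(\<lambda>x. ennreal (exp (2 * t * (ln (u x) - lg z r)) * u x) * indicator (ball z r) x
           + ennreal (exp (2 * s * (\<beta> x - m)) * u x) * indicator (ball z r) x) \<in> borel_measurable lborel"
          by measurable
      qed (subst nn_integral_add; (measurable | simp))
      also have "\<dots> \<le> ennreal (E / 2) * (ennreal (C1 * ball_mass u z r) + ennreal (C2 * ball_mass u z r))"
        using small r m by (intro mult_left_mono add_mono 1(3) 2(3) lg) auto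
      also have "\<dots> = ennreal (E / 2 * (C1 * ball_mass u z r + C2 * ball_mass u z r))"
        using 1(2) 2(2) by (simp add: E_def flip: ennreal_mult' ennreal_plus)
      also have "E / 2 * (C1 * ball_mass u z r + C2 * ball_mass u z r)
          = C4 * (E * ball_mass u z r)"
        by (simp add: C4_def algebra_simps)
      finally show ?thesis unfolding E_def .
    qed
    have dual_upper: "emeasure (wmeasure (\<lambda>x. u' x powr (- 1 / c'))) (ball z r)
        \<le> ennreal (C3 * (exp (- (s / c') * m) * ball_mass \<sigma> z r))"
      if r: "0 < r" and m: "osc_le \<beta> D m z r" for z r m
    proof -
      have "emeasure (wmeasure (\<lambda>x. u' x powr (- 1 / c'))) (ball z r)
        = (\<integral>\<^sup>+x\<in>ball z r. ennreal (u' x powr (- 1 / c')) \<partial>lborel)"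
        by (rule emeasure_wmeasure) measurable
      also have "\<dots> = (\<integral>\<^sup>+x. ennreal (exp (- (s / c') * m)) *
          (ennreal (exp (- (s / c') * (\<beta> x - m)) * \<sigma> x) * indicator (ball z r) x) \<partial>lborel)"
      proof (intro nn_integral_cong)
        fix x
        have "exp (- (s / c') * \<beta> x) = exp (- (s / c') * m) * exp (- (s / c') * (\<beta> x - m))"
          by (simp add: right_diff_distrib flip: exp_add)
        then have "ennreal (u' x powr (- 1 / c')) = ennreal (exp (- (s / c') * m)) * ennreal (exp (- (s / c') * (\<beta> x - m)) * \<sigma> x)"
          unfolding dual by (subst ennreal_mult[symmetric]) auto
        then show "ennreal (u' x powr (- 1 / c')) * indicator (ball z r) x = ennreal (exp (- (s / c') * m)) *
          (ennreal (exp (- (s / c') * (\<beta> x - m)) * \<sigma> x) * indicator (ball z r) x)"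
          by (simp add: mult.assoc)
      qed
      also have "\<dots> = ennreal (exp (- (s / c') * m)) *
          (\<integral>\<^sup>+x\<in>ball z r. ennreal (exp (- (s / c') * (\<beta> x - m)) * \<sigma> x) \<partial>lborel)"
        by (rule nn_integral_cmult) measurable
      also have "\<dots> \<le> ennreal (exp (- (s / c') * m)) * ennreal (C3 * ball_mass \<sigma> z r)"
        using small r m by (intro mult_left_mono 3(3)) auto
      also have "\<dots> = ennreal (exp (- (s / c') * m) * (C3 * ball_mass \<sigma> z r))"
        using 3(2) by (simp add: ennreal_mult)
      finally show ?thesis by (simp add: mult_ac)
    qed
    define K' where "K' = C4 * C3 powr c' * K powr (c' / c)"
    have "muckenhoupt u' c' K'"
    proof
      show "u' \<in> borel_measurable borel" by measurable
      show "0 < u' x" for x by (rule u'_pos)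
      show "0 < c'" "0 < K'" using c' C4 3 K_pos by (auto simp: K'_def)
      show "emeasure (wmeasure u') (ball z r) < top" for z r
      proof (cases "0 < r")
        case True
        then show ?thesis using osc[OF True, of z] upper[OF True] le_less_trans by (metis ennreal_less_top)
      qed (simp add: not_less ball_empty)
      show "emeasure (wmeasure (\<lambda>x. u' x powr (- 1 / c'))) (ball z r) < top" for z r
      proof (cases "0 < r")
        case True
        then show ?thesis using osc[OF True, of z] dual_upper[OF True] le_less_trans by (metis ennreal_less_top)
      qed (simp add: not_less ball_empty)
      show "ball_mass u' z r *
        ball_mass (\<lambda>x. u' x powr (- 1 / c')) z r powr c'
        \<le> K' * measure lborel (ball z r) powr (1 + c')" if r: "0 < r" for z r
      proof -
        define V S B where "V = ball_mass u z r" and "S = ball_mass \<sigma> z r"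
          and "B = measure lborel (ball z r)"
        have pos: "0 < V" "0 < S" "0 < B"
          using ball_pos[OF r] dual_ball_pos[OF r] measure_lborel_ball_pos[OF r] by (auto simp: V_def S_def B_def)
        obtain m where m: "osc_le \<beta> D m z r" using osc[OF r] by blast
        have "ball_mass u' z r \<le> C4 * (exp (t * lg z r + s * m) * V)"
          unfolding measure_def[of "wmeasure u'"] V_def using C4
          by (intro enn2real_leI upper r m) auto
        moreover have "ball_mass (\<lambda>x. u' x powr (- 1 / c')) z r \<le> C3 * (exp (- (s / c') * m) * S)"
          unfolding measure_def[of "wmeasure (\<lambda>x. u' x powr (- 1 / c'))"] S_def using 3(2)
          by (intro enn2real_leI dual_upper r m) auto
        ultimately have "ball_mass u' z r *
            ball_mass (\<lambda>x. u' x powr (- 1 / c')) z r powr c'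
            \<le> C4 * (exp (t * lg z r + s * m) * V) * (C3 * (exp (- (s / c') * m) * S)) powr c'"
          using c' by (intro mult_mono powr_mono2) (auto simp: C4_def 1(2) 2(2) pos less_imp_le)
        also have "(C3 * (exp (- (s / c') * m) * S)) powr c' = C3 powr c' * (exp (- (s * m)) * S powr c')"
        proof -
          have "exp (- (s / c') * m) powr c' = exp (- (s * m))"
            using c' by (simp add: powr_def)
          then show ?thesis using 3(2) pos by (simp add: powr_mult)
        qed
        \<comment> \<open>The constant m enters the two masses as exp (s m) and exp (- s m) and
          cancels. What remains is the old Muckenhoupt product to the power c' / c, since (V / B)^t
          V = V^(c' / c) B^-t.\<close>
        also have "exp (t * lg z r + s * m) = (V / B) powr t * exp (s * m)"
          using pos by (simp add: exp_add lg_def powr_def V_def B_def mult.commute)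
        also have "C4 * ((V / B) powr t * exp (s * m) * V) * (C3 powr c' * (exp (- (s * m)) * S powr c'))
           = C4 * C3 powr c' * ((V / B) powr t * V * S powr c')"
          by (simp add: exp_minus field_simps)
        also have "(V / B) powr t * V * S powr c' = (V * S powr c) powr (c' / c) * B powr (- t)"
        proof -
          have "V powr t * V = V powr (c' / c)"
            using pos powr_add[of V t 1] by (simp add: t_def)
          moreover have "(S powr c) powr (c' / c) = S powr c'"
            using c_pos by (simp add: powr_powr)
          ultimately show ?thesis
            using pos by (simp add: powr_mult powr_divide powr_minus field_simps)
        qed
        also have "C4 * C3 powr c' * ((V * S powr c) powr (c' / c) * B powr (- t))
           \<le> C4 * C3 powr c' * ((K * B powr (1 + c)) powr (c' / c) * B powr (- t))"
          using C4 3(2) c' c_pos pos A_bound[OF r, of z]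
          by (intro mult_left_mono mult_right_mono powr_mono2) (auto simp: V_def S_def B_def)
        also have "(K * B powr (1 + c)) powr (c' / c) * B powr (- t) = K powr (c' / c) * B powr (1 + c')"
        proof -
          have "(1 + c) * (c' / c) + - t = 1 + c'"
            using c_pos by (simp add: t_def field_simps)
          then have "B powr ((1 + c) * (c' / c)) * B powr (- t) = B powr (1 + c')"
            by (metis powr_add)
          then show ?thesis
            using K_pos pos by (simp add: powr_mult powr_powr mult.assoc)
        qed
        finally show ?thesis by (simp add: K'_def B_def mult.assoc)
      qed
    qed
    then show ?thesis unfolding u'_def by blast
  qed
  ultimately show thesis using that by blast
qed

text \<open>The upper bound is exponential integrability. The lower bound uses exponential
  integrability for - s: with a = C exp (s (\<beta> - m)), the inequality 2 \<le> a + 1/a is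
  integrated against u, and the term 1/a contributes at most one u(B), which is absorbed on the
  left.\<close>

lemma exp_weight_comparison:
  assumes [measurable]: "\<beta> \<in> borel_measurable borel" and D: "0 < D"
    and osc: "\<And>z r. 0 < r \<Longrightarrow> \<exists>m. osc_le \<beta> D m z r"
  obtains \<epsilon> C where "0 < \<epsilon>" "0 < C"
    "\<And>z r m s. 0 < r \<Longrightarrow> osc_le \<beta> D m z r \<Longrightarrow> \<bar>s\<bar> \<le> \<epsilon> \<Longrightarrow>
      ball_mass (\<lambda>x. u x * exp (s * \<beta> x)) z r \<le> C * (exp (s * m) * ball_mass u z r)"
    "\<And>z r m s. 0 < r \<Longrightarrow> osc_le \<beta> D m z r \<Longrightarrow> \<bar>s\<bar> \<le> \<epsilon> \<Longrightarrow>
      exp (s * m) * ball_mass u z r \<le> C * ball_mass (\<lambda>x. u x * exp (s * \<beta> x)) z r"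
proof -
  obtain \<epsilon> C where \<epsilon>: "0 < \<epsilon>" "0 < C" and
    int: "\<And>z r m t. 0 < r \<Longrightarrow> osc_le \<beta> D m z r \<Longrightarrow> \<bar>t\<bar> \<le> \<epsilon> \<Longrightarrow>
      (\<integral>\<^sup>+x\<in>ball z r. ennreal (exp (t * (\<beta> x - m)) * u x) \<partial>lborel)
        \<le> ennreal (C * ball_mass u z r)"
    using exponential_integrability_balls[OF assms(1) D osc] by blast
  have U: "emeasure (wmeasure (\<lambda>x. u x * exp (s * \<beta> x))) (ball z r)
      = ennreal (exp (s * m)) * (\<integral>\<^sup>+x\<in>ball z r. ennreal (exp (s * (\<beta> x - m)) * u x) \<partial>lborel)" for s m z r
  proof -
    have "emeasure (wmeasure (\<lambda>x. u x * exp (s * \<beta> x))) (ball z r)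
        = (\<integral>\<^sup>+x\<in>ball z r. ennreal (u x * exp (s * \<beta> x)) \<partial>lborel)"
      by (rule emeasure_wmeasure) measurable
    also have "\<dots> = (\<integral>\<^sup>+x. ennreal (exp (s * m)) * (ennreal (exp (s * (\<beta> x - m)) * u x) * indicator (ball z r) x) \<partial>lborel)"
    proof (intro nn_integral_cong)
      fix x
      have "u x * exp (s * \<beta> x) = exp (s * m) * (exp (s * (\<beta> x - m)) * u x)"
        by (simp add: right_diff_distrib flip: exp_add mult.assoc)
      then have "ennreal (u x * exp (s * \<beta> x)) = ennreal (exp (s * m)) * ennreal (exp (s * (\<beta> x - m)) * u x)"
        using u_pos[of x] by (simp add: ennreal_mult less_imp_le mult_ac)
      then show "ennreal (u x * exp (s * \<beta> x)) * indicator (ball z r) x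
         = ennreal (exp (s * m)) * (ennreal (exp (s * (\<beta> x - m)) * u x) * indicator (ball z r) x)"
        by (simp add: mult.assoc)
    qed
    also have "\<dots> = ennreal (exp (s * m)) * (\<integral>\<^sup>+x\<in>ball z r. ennreal (exp (s * (\<beta> x - m)) * u x) \<partial>lborel)"
      by (rule nn_integral_cmult) measurable
    finally show ?thesis .
  qed
  have up: "emeasure (wmeasure (\<lambda>x. u x * exp (s * \<beta> x))) (ball z r)
      \<le> ennreal (C * (exp (s * m) * ball_mass u z r))"
    if "0 < r" "osc_le \<beta> D m z r" "\<bar>s\<bar> \<le> \<epsilon>" for z r m s
  proof -
    have "emeasure (wmeasure (\<lambda>x. u x * exp (s * \<beta> x))) (ball z r)
      \<le> ennreal (exp (s * m)) * ennreal (C * ball_mass u z r)"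
      unfolding U[of s z r m] using that by (intro mult_left_mono int) auto
    also have "\<dots> = ennreal (exp (s * m) * (C * ball_mass u z r))"
      using \<epsilon>(2) by (simp add: ennreal_mult)
    finally show ?thesis by (simp add: mult_ac)
  qed
  show thesis
  proof (rule that[OF \<epsilon>])
    fix z r m s assume *: "0 < (r::real)" "osc_le \<beta> D m z r" "\<bar>s\<bar> \<le> \<epsilon>"
    let ?U = "ball_mass (\<lambda>x. u x * exp (s * \<beta> x)) z r"
    let ?V = "ball_mass u z r"
    show "?U \<le> C * (exp (s * m) * ?V)"
      using up[OF *] \<epsilon>(2) unfolding measure_def[of "wmeasure (\<lambda>x. u x * exp (s * \<beta> x))"]
      by (intro enn2real_leI) auto
    have Ufin: "emeasure (wmeasure (\<lambda>x. u x * exp (s * \<beta> x))) (ball z r) = ennreal ?U"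
      using le_less_trans[OF up[OF *] ennreal_less_top] by (intro emeasure_eq_ennreal_measure) auto
    have "ennreal (2 * ?V) = (\<integral>\<^sup>+x\<in>ball z r. ennreal (2 * u x) \<partial>lborel)"
    proof -
      have "ennreal (2 * ?V) = 2 * emeasure (wmeasure u) (ball z r)"
        by (simp add: emeasure_ball_eq ennreal_mult)
      also have "\<dots> = (\<integral>\<^sup>+x. 2 * (ennreal (u x) * indicator (ball z r) x) \<partial>lborel)"
        by (subst nn_integral_cmult) (auto simp: emeasure_wmeasure)
      also have "\<dots> = (\<integral>\<^sup>+x\<in>ball z r. ennreal (2 * u x) \<partial>lborel)"
        using u_pos by (intro nn_integral_cong) (simp add: ennreal_mult less_imp_le mult.assoc)
      finally show ?thesis .
    qed
    also have "\<dots> \<le> (\<integral>\<^sup>+x. ennreal C * (ennreal (exp (s * (\<beta> x - m)) * u x) * indicator (ball z r) x)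
        + ennreal (1 / C) * (ennreal (exp (- s * (\<beta> x - m)) * u x) * indicator (ball z r) x) \<partial>lborel)"
    proof (intro nn_integral_mono)
      fix x
      define a where "a = C * exp (s * (\<beta> x - m))"
      have a: "0 < a" using \<epsilon> by (simp add: a_def)
      have "0 \<le> (a - 1)\<^sup>2" by simp
      then have "2 * a \<le> a * a + 1" by (simp add: power2_eq_square algebra_simps)
      then have "2 \<le> a + 1 / a" using a by (simp add: field_simps)
      then have "2 * u x \<le> (a + 1 / a) * u x"
        using u_pos[of x] by (intro mult_right_mono) auto
      also have "\<dots> = C * (exp (s * (\<beta> x - m)) * u x) + 1 / C * (exp (- s * (\<beta> x - m)) * u x)"
      proof -
        have "exp (- s * (\<beta> x - m)) = 1 / exp (s * (\<beta> x - m))"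
          by (simp add: exp_minus divide_inverse)
        then have "1 / a = 1 / C * exp (- s * (\<beta> x - m))" by (simp add: a_def)
        then show ?thesis by (simp only: a_def distrib_right mult.assoc)
      qed
      finally have "ennreal (2 * u x) \<le> ennreal (C * (exp (s * (\<beta> x - m)) * u x) + 1 / C * (exp (- s * (\<beta> x - m)) * u x))"
        by (rule ennreal_leI)
      also have "\<dots> = ennreal (C * (exp (s * (\<beta> x - m)) * u x)) + ennreal (1 / C * (exp (- s * (\<beta> x - m)) * u x))"
        using u_pos[of x] \<epsilon> by (intro ennreal_plus) (auto intro: less_imp_le)
      also have "\<dots> = ennreal C * ennreal (exp (s * (\<beta> x - m)) * u x) + ennreal (1 / C) * ennreal (exp (- s * (\<beta> x - m)) * u x)"
        using u_pos[of x] \<epsilon> by (intro arg_cong2[where f="(+)"] ennreal_mult) (auto intro: less_imp_le)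
      finally show "ennreal (2 * u x) * indicator (ball z r) x \<le> ennreal C * (ennreal (exp (s * (\<beta> x - m)) * u x) * indicator (ball z r) x)
        + ennreal (1 / C) * (ennreal (exp (- s * (\<beta> x - m)) * u x) * indicator (ball z r) x)"
        by (cases "x \<in> ball z r") auto
    qed
    also have "\<dots> = ennreal C * (\<integral>\<^sup>+x\<in>ball z r. ennreal (exp (s * (\<beta> x - m)) * u x) \<partial>lborel)
        + ennreal (1 / C) * (\<integral>\<^sup>+x\<in>ball z r. ennreal (exp (- s * (\<beta> x - m)) * u x) \<partial>lborel)"
    proof -
      have cm: "(\<integral>\<^sup>+x. ennreal k * (ennreal (exp (t * (\<beta> x - m)) * u x) * indicator (ball z r) x) \<partial>lborel)
         = ennreal k * (\<integral>\<^sup>+x\<in>ball z r. ennreal (exp (t * (\<beta> x - m)) * u x) \<partial>lborel)" for k t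
        by (rule nn_integral_cmult) measurable
      show ?thesis unfolding cm[symmetric] by (rule nn_integral_add) measurable
    qed
    also have "\<dots> \<le> ennreal C * ennreal (exp (- s * m) * ?U) + ennreal (1 / C) * ennreal (C * ?V)"
    proof (intro add_mono mult_left_mono int)
      have "ennreal (exp (- s * m)) * (ennreal (exp (s * m)) * (\<integral>\<^sup>+x\<in>ball z r. ennreal (exp (s * (\<beta> x - m)) * u x) \<partial>lborel))
         = (\<integral>\<^sup>+x\<in>ball z r. ennreal (exp (s * (\<beta> x - m)) * u x) \<partial>lborel)"
        by (simp flip: mult.assoc ennreal_mult exp_add)
      then have "(\<integral>\<^sup>+x\<in>ball z r. ennreal (exp (s * (\<beta> x - m)) * u x) \<partial>lborel) = ennreal (exp (- s * m)) * ennreal ?U"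
        using U[of s z r m] Ufin by simp
      then show "(\<integral>\<^sup>+x\<in>ball z r. ennreal (exp (s * (\<beta> x - m)) * u x) \<partial>lborel) \<le> ennreal (exp (- s * m) * ?U)"
        by (simp add: ennreal_mult)
    qed (use * in auto)
    also have "\<dots> = ennreal (C * (exp (- s * m) * ?U) + ?V)"
      using \<epsilon> by (simp add: ennreal_plus flip: ennreal_mult)
    finally have "2 * ?V \<le> C * (exp (- s * m) * ?U) + ?V"
      using \<epsilon> by (subst (asm) ennreal_le_iff) auto
    then have "?V \<le> C * (exp (- s * m) * ?U)" by simp
    then have "exp (s * m) * ?V \<le> exp (s * m) * (C * (exp (- s * m) * ?U))"
      by (intro mult_left_mono) auto
    then show "exp (s * m) * ?V \<le> C * ?U"
      by (simp add: exp_minus field_simps)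
  qed
qed

end

section \<open>The rough fractional integral\<close>

lemma distr_lborel_reflect: "distr lborel borel (\<lambda>y. x - y) = (lborel :: 'a::euclidean_space measure)"
proof -
  have "lborel = distr lborel borel (\<lambda>y. x - y)"
    using lborel_affine[of "- 1" x] by (simp add: density_1)
  then show ?thesis by (rule sym)
qed

lemma nn_integral_lborel_reflect:
  fixes x :: "'a::euclidean_space"
  assumes [measurable]: "h \<in> borel_measurable borel"
  shows "(\<integral>\<^sup>+y. h (x - y) \<partial>lborel) = (\<integral>\<^sup>+y. h y \<partial>lborel)"
proof -
  have "(\<integral>\<^sup>+y. h y \<partial>distr lborel borel (\<lambda>y. x - y)) = (\<integral>\<^sup>+y. h (x - y) \<partial>lborel)"
    by (rule nn_integral_distr) measurable
  then show ?thesis unfolding distr_lborel_reflect by simp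
qed

lemma integral_lborel_reflect:
  fixes x :: "'a::euclidean_space" and h :: "'a \<Rightarrow> complex"
  assumes [measurable]: "h \<in> borel_measurable borel"
  shows "(LINT y|lborel. h (x - y)) = (LINT y|lborel. h y)"
proof -
  have "(LINT y|distr lborel borel (\<lambda>y. x - y). h y) = (LINT y|lborel. h (x - y))"
    by (rule integral_distr) measurable
  then show ?thesis unfolding distr_lborel_reflect by simp
qed

lemma AE_lborel_reflect:
  fixes x :: "'a::euclidean_space"
  assumes "AE y in lborel. P y"
  shows "AE y in lborel. P (x - y)"
proof -
  have "AE y in distr lborel borel (\<lambda>y. x - y). P y"
    unfolding distr_lborel_reflect by (rule assms)
  then show ?thesis by (rule AE_distrD[rotated]) simp
qed

text \<open>\<open>\<Theta>\<close> stands for |\<Omega>(y')| as a function on the whole space and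
  \<rho> for s'. The interface to \<Omega> is Hoelder's inequality on balls about the origin; its
  power R^(n (1 - 1/\<rho>)) = R^(n/s) is what homogeneity of degree zero yields. The value \<rho> =
  1 corresponds to bounded \<Omega>.\<close>

locale rough_kernel =
  fixes \<Theta> :: "'a::euclidean_space \<Rightarrow> real" and \<alpha> \<rho> A :: real
  assumes \<Theta>_measurable [measurable]: "\<Theta> \<in> borel_measurable borel"
    and \<Theta>_nonneg: "0 \<le> \<Theta> y"
    and \<alpha>: "0 < \<alpha>" "\<alpha> < DIM('a)" and \<rho>: "1 \<le> \<rho>" and A_pos: "0 < A"
    and \<Theta>_Holder: "0 < R \<Longrightarrow> h \<in> borel_measurable borel \<Longrightarrow>
      (\<integral>\<^sup>+y\<in>ball 0 R. ennreal (\<Theta> y) * h y \<partial>lborel)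
        \<le> ennreal (A * R powr (DIM('a) * (1 - 1 / \<rho>))) * epow (\<integral>\<^sup>+y\<in>ball 0 R. epow (h y) \<rho> \<partial>lborel) (1 / \<rho>)"
begin

text \<open>Acting on functions with values in [0,\<infinity>], T has a value everywhere; questions
  of convergence are deferred to the commutator.\<close>

definition T :: "('a \<Rightarrow> ennreal) \<Rightarrow> 'a \<Rightarrow> ennreal" where
  "T f x = (\<integral>\<^sup>+y. ennreal (\<Theta> y / norm y powr (DIM('a) - \<alpha>)) * f (x - y) \<partial>lborel)"

lemma T_measurable [measurable]:
  assumes [measurable]: "f \<in> borel_measurable borel"
  shows "T f \<in> borel_measurable borel"
  unfolding T_def by measurable

lemma T_add:
  assumes [measurable]: "f \<in> borel_measurable borel" "g \<in> borel_measurable borel"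
  shows "T (\<lambda>x. f x + g x) x = T f x + T g x"
  unfolding T_def distrib_left by (rule nn_integral_add) measurable

lemma T_reflect:
  assumes [measurable]: "f \<in> borel_measurable borel"
  shows "T f x = (\<integral>\<^sup>+y. ennreal (\<Theta> (x - y) / norm (x - y) powr (DIM('a) - \<alpha>)) * f y \<partial>lborel)"
proof -
  have "(\<integral>\<^sup>+y. ennreal (\<Theta> (x - y) / norm (x - y) powr (DIM('a) - \<alpha>)) * f (x - (x - y)) \<partial>lborel)
    = (\<integral>\<^sup>+y. ennreal (\<Theta> y / norm y powr (DIM('a) - \<alpha>)) * f (x - y) \<partial>lborel)"
    by (rule nn_integral_lborel_reflect) measurable
  then show ?thesis by (simp add: T_def)
qed

text \<open>After Hoelder's inequality this bounds, up to constants, the part of the integral with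
  |y| comparable to t. The exponent of t is (\<alpha> - n) + n (1 - 1/\<rho>).\<close>

definition piece :: "('a \<Rightarrow> ennreal) \<Rightarrow> 'a \<Rightarrow> real \<Rightarrow> ennreal" where
  "piece f x t = ennreal (t powr (\<alpha> - DIM('a) / \<rho>)) * epow (\<integral>\<^sup>+y\<in>ball x t. epow (f y) \<rho> \<partial>lborel) (1 / \<rho>)"

text \<open>y lies in a ball of radius t = 2^k R with |y| < t \<le> 2 |y|, and the kernel is at most
  2^(n-\<alpha>) t^(\<alpha>-n) there. The integer k is distributed over two series over the natural
  numbers, radii growing from R and radii shrinking from R, because the two are later estimated
  differently.\<close>

lemma kernel_le_sum:
  assumes R: "0 < R" and y: "y \<noteq> (0::'a)"
  shows "ennreal (1 / norm y powr (DIM('a) - \<alpha>)) \<le> ennreal (2 powr (DIM('a) - \<alpha>)) *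
    (\<Sum>j. ennreal ((2 ^ j * R) powr (\<alpha> - DIM('a))) * indicator (ball 0 (2 ^ j * R)) y
       + ennreal ((R / 2 ^ j) powr (\<alpha> - DIM('a))) * indicator (ball 0 (R / 2 ^ j)) y)"
proof -
  define \<gamma> where "\<gamma> = DIM('a) - \<alpha>"
  have \<gamma>: "0 < \<gamma>" "\<alpha> - DIM('a) = - \<gamma>" using \<alpha> by (auto simp: \<gamma>_def)
  define F where "F j = ennreal ((2 ^ j * R) powr - \<gamma>) * indicator (ball 0 (2 ^ j * R)) y
       + ennreal ((R / 2 ^ j) powr - \<gamma>) * indicator (ball 0 (R / 2 ^ j)) y" for j :: nat
  have F_le: "F j \<le> (\<Sum>j. F j)" for j
  proof -
    have "sum F {j} \<le> suminf F" by (rule sum_le_suminf) auto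
    then show ?thesis by simp
  qed
  define L where "L = log 2 (norm y / R)"
  have ny: "0 < norm y" using y by simp
  have yL: "norm y = R * 2 powr L" using R ny by (simp add: L_def)
  define k where "k = \<lfloor>L\<rfloor> + 1"
  define t where "t = R * 2 powr (real_of_int k)"
  have t: "0 < t" "norm y < t" "t \<le> 2 * norm y"
  proof -
    have kL: "L < real_of_int k" "real_of_int k \<le> 1 + L" unfolding k_def by linarith+
    show "0 < t" using R by (simp add: t_def)
    show "norm y < t" unfolding t_def yL using R kL by simp
    have "2 powr real_of_int k \<le> 2 powr (1 + L)" using kL by simp
    then show "t \<le> 2 * norm y" unfolding t_def yL using R by (simp add: powr_add)
  qed
  have "\<exists>j. ennreal (t powr - \<gamma>) \<le> F j"
  proof (cases "0 \<le> k")
    case True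
    then have "t = 2 ^ nat k * R"
      by (simp add: t_def powr_real_of_int)
    then have "ennreal (t powr - \<gamma>) \<le> F (nat k)"
      using t by (simp add: F_def)
    then show ?thesis ..
  next
    case False
    then have "t = R / 2 ^ nat (- k)"
      by (simp add: t_def powr_real_of_int divide_inverse)
    then have "ennreal (t powr - \<gamma>) \<le> F (nat (- k))"
      using t by (simp add: F_def add_increasing)
    then show ?thesis ..
  qed
  then obtain j where j: "ennreal (t powr - \<gamma>) \<le> F j" ..
  have "(t / 2) powr \<gamma> \<le> norm y powr \<gamma>"
    using t \<gamma> by (intro powr_mono2) auto
  then have "1 / norm y powr \<gamma> \<le> 1 / (t / 2) powr \<gamma>"
    using t ny by (intro divide_left_mono) auto
  also have "\<dots> = 2 powr \<gamma> * t powr - \<gamma>"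
    using t by (simp add: powr_divide powr_minus_divide)
  finally have "ennreal (1 / norm y powr \<gamma>) \<le> ennreal (2 powr \<gamma>) * ennreal (t powr - \<gamma>)"
    by (simp add: ennreal_leI flip: ennreal_mult)
  also have "\<dots> \<le> ennreal (2 powr \<gamma>) * (\<Sum>j. F j)"
    using j F_le by (intro mult_left_mono) (auto intro: order_trans)
  finally show ?thesis
    unfolding F_def \<gamma>(2) \<gamma>_def .
qed

text \<open>The series for the kernel is integrated term by term, and Hoelder's inequality for
  \<Theta> estimates each term. R stays free, to be adapted to the point x or to the ball under
  consideration.\<close>

lemma T_le_pieces:
  assumes [measurable]: "f \<in> borel_measurable borel" and R: "0 < R"
  shows "T f x \<le> ennreal (2 powr (DIM('a) - \<alpha>) * A) *
    (\<Sum>j. piece f x (2 ^ j * R) + piece f x (R / 2 ^ j))"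
proof -
  define P where "P t = (\<integral>\<^sup>+y. ennreal (t powr (\<alpha> - DIM('a))) * (ennreal (\<Theta> y) * f (x - y) * indicator (ball 0 t) y) \<partial>lborel)" for t
  have P_le: "P t \<le> ennreal A * piece f x t" if t: "0 < t" for t
  proof -
    have "P t = ennreal (t powr (\<alpha> - DIM('a))) * (\<integral>\<^sup>+y\<in>ball 0 t. ennreal (\<Theta> y) * f (x - y) \<partial>lborel)"
      unfolding P_def by (rule nn_integral_cmult) measurable
    also have "\<dots> \<le> ennreal (t powr (\<alpha> - DIM('a))) * (ennreal (A * t powr (DIM('a) * (1 - 1 / \<rho>)))
        * epow (\<integral>\<^sup>+y\<in>ball 0 t. epow (f (x - y)) \<rho> \<partial>lborel) (1 / \<rho>))"
    proof (rule mult_left_mono)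
      have [measurable]: "(\<lambda>y. f (x - y)) \<in> borel_measurable borel" by measurable
      show "(\<integral>\<^sup>+y\<in>ball 0 t. ennreal (\<Theta> y) * f (x - y) \<partial>lborel)
        \<le> ennreal (A * t powr (DIM('a) * (1 - 1 / \<rho>))) * epow (\<integral>\<^sup>+y\<in>ball 0 t. epow (f (x - y)) \<rho> \<partial>lborel) (1 / \<rho>)"
        by (rule \<Theta>_Holder[OF t]) measurable
    qed simp
    also have "(\<integral>\<^sup>+y\<in>ball 0 t. epow (f (x - y)) \<rho> \<partial>lborel) = (\<integral>\<^sup>+y\<in>ball x t. epow (f y) \<rho> \<partial>lborel)"
    proof -
      have "(\<integral>\<^sup>+y\<in>ball x t. epow (f y) \<rho> \<partial>lborel) = (\<integral>\<^sup>+y. epow (f (x - y)) \<rho> * indicator (ball x t) (x - y) \<partial>lborel)"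
        by (rule nn_integral_lborel_reflect[symmetric]) measurable
      then show ?thesis by (simp add: indicator_def dist_norm)
    qed
    also have "ennreal (t powr (\<alpha> - DIM('a))) * (ennreal (A * t powr (DIM('a) * (1 - 1 / \<rho>)))
        * epow (\<integral>\<^sup>+y\<in>ball x t. epow (f y) \<rho> \<partial>lborel) (1 / \<rho>)) =
        ennreal A * (ennreal (t powr (\<alpha> - DIM('a)) * t powr (DIM('a) * (1 - 1 / \<rho>)))
        * epow (\<integral>\<^sup>+y\<in>ball x t. epow (f y) \<rho> \<partial>lborel) (1 / \<rho>))"
      using A_pos by (simp add: ennreal_mult mult_ac)
    also have "t powr (\<alpha> - DIM('a)) * t powr (DIM('a) * (1 - 1 / \<rho>)) = t powr (\<alpha> - DIM('a) / \<rho>)"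
      by (simp add: right_diff_distrib flip: powr_add)
    finally show ?thesis unfolding piece_def .
  qed
  have "T f x \<le> (\<integral>\<^sup>+y. ennreal (2 powr (DIM('a) - \<alpha>)) * (\<Sum>j.
      ennreal ((2 ^ j * R) powr (\<alpha> - DIM('a))) * (ennreal (\<Theta> y) * f (x - y) * indicator (ball 0 (2 ^ j * R)) y)
    + ennreal ((R / 2 ^ j) powr (\<alpha> - DIM('a))) * (ennreal (\<Theta> y) * f (x - y) * indicator (ball 0 (R / 2 ^ j)) y)) \<partial>lborel)"
    unfolding T_def
  proof (intro nn_integral_mono)
    fix y :: 'a
    define E where "E j = ennreal ((2 ^ j * R) powr (\<alpha> - DIM('a))) * indicator (ball 0 (2 ^ j * R)) y
       + ennreal ((R / 2 ^ j) powr (\<alpha> - DIM('a))) * indicator (ball 0 (R / 2 ^ j)) y" for j :: nat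
    have eq: "ennreal ((2 ^ j * R) powr (\<alpha> - DIM('a))) * (ennreal (\<Theta> y) * f (x - y) * indicator (ball 0 (2 ^ j * R)) y)
      + ennreal ((R / 2 ^ j) powr (\<alpha> - DIM('a))) * (ennreal (\<Theta> y) * f (x - y) * indicator (ball 0 (R / 2 ^ j)) y)
      = E j * (ennreal (\<Theta> y) * f (x - y))" for j
      by (simp add: E_def distrib_left distrib_right mult_ac)
    show "ennreal (\<Theta> y / norm y powr (DIM('a) - \<alpha>)) * f (x - y) \<le> ennreal (2 powr (DIM('a) - \<alpha>)) * (\<Sum>j.
      ennreal ((2 ^ j * R) powr (\<alpha> - DIM('a))) * (ennreal (\<Theta> y) * f (x - y) * indicator (ball 0 (2 ^ j * R)) y)
    + ennreal ((R / 2 ^ j) powr (\<alpha> - DIM('a))) * (ennreal (\<Theta> y) * f (x - y) * indicator (ball 0 (R / 2 ^ j)) y))"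
    proof (cases "y = 0")
      case False
      have "ennreal (\<Theta> y / norm y powr (DIM('a) - \<alpha>)) * f (x - y)
          = ennreal (1 / norm y powr (DIM('a) - \<alpha>)) * (ennreal (\<Theta> y) * f (x - y))"
      proof -
        have "ennreal (\<Theta> y / norm y powr (DIM('a) - \<alpha>)) = ennreal (1 / norm y powr (DIM('a) - \<alpha>) * \<Theta> y)"
          by simp
        also have "\<dots> = ennreal (1 / norm y powr (DIM('a) - \<alpha>)) * ennreal (\<Theta> y)"
          using \<Theta>_nonneg[of y] by (intro ennreal_mult) auto
        finally show ?thesis by (simp only: mult.assoc)
      qed
      also have "\<dots> \<le> ennreal (2 powr (DIM('a) - \<alpha>)) * (\<Sum>j. E j) * (ennreal (\<Theta> y) * f (x - y))"
        unfolding E_def by (intro mult_right_mono kernel_le_sum R False) simp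
      also have "\<dots> = ennreal (2 powr (DIM('a) - \<alpha>)) * (\<Sum>j. E j * (ennreal (\<Theta> y) * f (x - y)))"
        by (simp add: mult.assoc)
      finally show ?thesis unfolding eq .
    qed simp
  qed
  also have "\<dots> = ennreal (2 powr (DIM('a) - \<alpha>)) * (\<Sum>j. P (2 ^ j * R) + P (R / 2 ^ j))"
  proof (subst nn_integral_cmult)
    show "(\<lambda>y. \<Sum>j. ennreal ((2 ^ j * R) powr (\<alpha> - DIM('a))) * (ennreal (\<Theta> y) * f (x - y) * indicator (ball 0 (2 ^ j * R)) y)
    + ennreal ((R / 2 ^ j) powr (\<alpha> - DIM('a))) * (ennreal (\<Theta> y) * f (x - y) * indicator (ball 0 (R / 2 ^ j)) y)) \<in> borel_measurable lborel"
      by measurable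
  next
    have "(\<integral>\<^sup>+y. (\<Sum>j. ennreal ((2 ^ j * R) powr (\<alpha> - DIM('a))) * (ennreal (\<Theta> y) * f (x - y) * indicator (ball 0 (2 ^ j * R)) y)
    + ennreal ((R / 2 ^ j) powr (\<alpha> - DIM('a))) * (ennreal (\<Theta> y) * f (x - y) * indicator (ball 0 (R / 2 ^ j)) y)) \<partial>lborel)
     = (\<Sum>j. (\<integral>\<^sup>+y. ennreal ((2 ^ j * R) powr (\<alpha> - DIM('a))) * (ennreal (\<Theta> y) * f (x - y) * indicator (ball 0 (2 ^ j * R)) y)
    + ennreal ((R / 2 ^ j) powr (\<alpha> - DIM('a))) * (ennreal (\<Theta> y) * f (x - y) * indicator (ball 0 (R / 2 ^ j)) y) \<partial>lborel))"
      by (rule nn_integral_suminf) measurable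
    also have "\<dots> = (\<Sum>j. P (2 ^ j * R) + P (R / 2 ^ j))"
      unfolding P_def by (intro suminf_cong nn_integral_add) measurable
    finally show "ennreal (2 powr (DIM('a) - \<alpha>)) * (\<integral>\<^sup>+y. (\<Sum>j. ennreal ((2 ^ j * R) powr (\<alpha> - DIM('a))) * (ennreal (\<Theta> y) * f (x - y) * indicator (ball 0 (2 ^ j * R)) y)
    + ennreal ((R / 2 ^ j) powr (\<alpha> - DIM('a))) * (ennreal (\<Theta> y) * f (x - y) * indicator (ball 0 (R / 2 ^ j)) y)) \<partial>lborel)
     = ennreal (2 powr (DIM('a) - \<alpha>)) * (\<Sum>j. P (2 ^ j * R) + P (R / 2 ^ j))" by simp
  qed
  also have "\<dots> \<le> ennreal (2 powr (DIM('a) - \<alpha>)) * (\<Sum>j. ennreal A * (piece f x (2 ^ j * R) + piece f x (R / 2 ^ j)))"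
  proof (intro mult_left_mono suminf_le summableI)
    fix j :: nat
    have "P (2 ^ j * R) + P (R / 2 ^ j) \<le> ennreal A * piece f x (2 ^ j * R) + ennreal A * piece f x (R / 2 ^ j)"
      using R by (intro add_mono P_le) auto
    then show "P (2 ^ j * R) + P (R / 2 ^ j) \<le> ennreal A * (piece f x (2 ^ j * R) + piece f x (R / 2 ^ j))"
      by (simp only: distrib_left)
  qed simp
  also have "\<dots> = ennreal (2 powr (DIM('a) - \<alpha>) * A) * (\<Sum>j. piece f x (2 ^ j * R) + piece f x (R / 2 ^ j))"
    using A_pos by (simp add: ennreal_mult mult.assoc)
  finally show ?thesis .
qed

text \<open>At \<open>\<tau>\<^sub>0\<close> this is the fractional average of order \<alpha> \<rho>
  of f^\<rho>. Shifting the exponent by \<theta> shifts the order by n \<theta>; the order is the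
  higher one for \<open>\<tau>\<^sub>0 - \<theta>\<close>.\<close>

definition frac_avg :: "real \<Rightarrow> ('a \<Rightarrow> ennreal) \<Rightarrow> 'a \<Rightarrow> real \<Rightarrow> ennreal" where
  "frac_avg \<tau> f z r = ennreal (measure lborel (ball z r) powr - \<tau>) * (\<integral>\<^sup>+y\<in>ball z r. epow (f y) \<rho> \<partial>lborel)"

definition \<tau>\<^sub>0 :: real where "\<tau>\<^sub>0 = 1 - \<alpha> * \<rho> / DIM('a)"

lemma piece_eq:
  assumes t: "0 < t"
  shows "piece f x t = ennreal (unit_ball_vol DIM('a) powr (\<tau>\<^sub>0 / \<rho>)) * epow (frac_avg \<tau>\<^sub>0 f x t) (1 / \<rho>)"
proof -
  define I where "I = (\<integral>\<^sup>+y\<in>ball x t. epow (f y) \<rho> \<partial>lborel)"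
  define \<omega> where "\<omega> = unit_ball_vol (real DIM('a))"
  have \<omega>: "0 < \<omega>" by (simp add: \<omega>_def)
  have "epow (frac_avg \<tau>\<^sub>0 f x t) (1 / \<rho>) = ennreal ((\<omega> * t ^ DIM('a)) powr (- \<tau>\<^sub>0 / \<rho>)) * epow I (1 / \<rho>)"
    using \<rho> t by (simp add: frac_avg_def epow_mult epow_ennreal powr_powr I_def measure_lborel_ball \<omega>_def)
  also have "(\<omega> * t ^ DIM('a)) powr (- \<tau>\<^sub>0 / \<rho>) = \<omega> powr (- \<tau>\<^sub>0 / \<rho>) * t powr (\<alpha> - DIM('a) / \<rho>)"
  proof -
    have "(t ^ DIM('a)) powr (- \<tau>\<^sub>0 / \<rho>) = t powr (DIM('a) * (- \<tau>\<^sub>0 / \<rho>))"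
      using t by (simp add: powr_powr flip: powr_realpow)
    also have "DIM('a) * (- \<tau>\<^sub>0 / \<rho>) = \<alpha> - DIM('a) / \<rho>"
      using \<rho> by (simp add: \<tau>\<^sub>0_def field_simps)
    finally show ?thesis using t \<omega> by (simp add: powr_mult)
  qed
  finally have "ennreal (\<omega> powr (\<tau>\<^sub>0 / \<rho>)) * epow (frac_avg \<tau>\<^sub>0 f x t) (1 / \<rho>)
     = ennreal (\<omega> powr (\<tau>\<^sub>0 / \<rho>) * (\<omega> powr (- \<tau>\<^sub>0 / \<rho>) * t powr (\<alpha> - DIM('a) / \<rho>))) * epow I (1 / \<rho>)"
    by (simp add: ennreal_mult mult.assoc)
  also have "\<omega> powr (\<tau>\<^sub>0 / \<rho>) * (\<omega> powr (- \<tau>\<^sub>0 / \<rho>) * t powr (\<alpha> - DIM('a) / \<rho>)) = t powr (\<alpha> - DIM('a) / \<rho>)"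
    using \<omega> by (simp flip: mult.assoc powr_add)
  finally show ?thesis unfolding piece_def I_def \<omega>_def by simp
qed

text \<open>The radius \<open>R\<close> is chosen to balance the two maximal functions.\<close>

lemma Welland:
  assumes \<theta>: "0 < \<theta>"
  obtains C where "0 < C" "\<And>f x. f \<in> borel_measurable borel \<Longrightarrow>
    T f x \<le> ennreal C * epow (supball (frac_avg (\<tau>\<^sub>0 - \<theta>) f) x * supball (frac_avg (\<tau>\<^sub>0 + \<theta>) f) x) (1 / (2 * \<rho>))"
proof -
  define \<omega> where "\<omega> = unit_ball_vol (real DIM('a))"
  have \<omega>: "0 < \<omega>" by (simp add: \<omega>_def)
  \<comment> \<open>One dyadic step in the radius changes the volume by 2^n, hence its \<theta>-th
    power, taken to 1/\<rho>, by this factor: the ratio of both geometric series.\<close>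
  define \<nu> where "\<nu> = 2 powr (- (DIM('a) * \<theta> / \<rho>))"
  have \<nu>: "0 < \<nu>" "\<nu> < 1"
    using \<theta> \<rho> by (auto simp: \<nu>_def powr_less_one)
  define C where "C = 2 powr (DIM('a) - \<alpha>) * A * (2 * \<omega> powr (\<tau>\<^sub>0 / \<rho>) / (1 - \<nu>))"
  have C: "0 < C" unfolding C_def using A_pos \<omega> \<nu> by (intro mult_pos_pos divide_pos_pos) auto
  have "T f x \<le> ennreal C * epow (supball (frac_avg (\<tau>\<^sub>0 - \<theta>) f) x * supball (frac_avg (\<tau>\<^sub>0 + \<theta>) f) x) (1 / (2 * \<rho>))"
    if [measurable]: "f \<in> borel_measurable borel" for f x
  proof -
    define N1 N2 where "N1 = supball (frac_avg (\<tau>\<^sub>0 - \<theta>) f) x" and "N2 = supball (frac_avg (\<tau>\<^sub>0 + \<theta>) f) x"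
    have fa: "frac_avg \<tau>\<^sub>0 f x t = ennreal ((\<omega> * t ^ DIM('a)) powr h) * frac_avg (\<tau>\<^sub>0 + h) f x t"
      if "0 < t" for t h
    proof -
      have "measure lborel (ball x t) powr - \<tau>\<^sub>0 = (\<omega> * t ^ DIM('a)) powr h * measure lborel (ball x t) powr - (\<tau>\<^sub>0 + h)"
        using that \<omega> by (simp add: measure_lborel_ball \<omega>_def flip: powr_add)
      then show ?thesis unfolding frac_avg_def by (simp add: ennreal_mult mult.assoc)
    qed
    have fa1: "frac_avg \<tau>\<^sub>0 f x t \<le> ennreal ((\<omega> * t ^ DIM('a)) powr - \<theta>) * N1" if t: "0 < t" for t
      using supball_upper[of x x t "frac_avg (\<tau>\<^sub>0 - \<theta>) f"] t unfolding fa[OF t, of "- \<theta>"] N1_def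
      by (intro mult_left_mono) auto
    have fa2: "frac_avg \<tau>\<^sub>0 f x t \<le> ennreal ((\<omega> * t ^ DIM('a)) powr \<theta>) * N2" if t: "0 < t" for t
      using supball_upper[of x x t "frac_avg (\<tau>\<^sub>0 + \<theta>) f"] t unfolding fa[OF t, of "\<theta>"] N2_def
      by (intro mult_left_mono) auto
    consider "N1 = 0 \<or> N2 = 0" | "N1 \<noteq> 0" "N2 \<noteq> 0" "N1 = top \<or> N2 = top"
      | "N1 \<noteq> 0" "N2 \<noteq> 0" "N1 < top" "N2 < top"
      using top.not_eq_extremum by blast
    then show ?thesis
    proof cases
      case 1
      have "frac_avg \<tau>\<^sub>0 f x t = 0" if "0 < t" for t
        using fa1[OF that] fa2[OF that] 1 by auto
      then have "piece f x t = 0" if "0 < t" for t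
        using that by (simp add: piece_eq)
      then have "T f x \<le> 0" using T_le_pieces[of f 1 x] by simp
      then show ?thesis by simp
    next
      case 2
      then have "epow (N1 * N2) (1 / (2 * \<rho>)) = top"
        by (auto simp: ennreal_mult_top ennreal_top_mult)
      then show ?thesis using C by (simp add: N1_def[symmetric] N2_def[symmetric] ennreal_mult_top)
    next
      case 3
      then obtain n1 n2 where n: "N1 = ennreal n1" "N2 = ennreal n2" "0 < n1" "0 < n2"
        by (cases N1; cases N2) (auto simp: less_le)
      \<comment> \<open>Q is the volume of the balancing ball up to nothing but its defining
        property: Q^-\<theta> n1 = Q^\<theta> n2 = sqrt (n1 n2). Large radii are estimated with n1,
        small ones with n2, and both series start at this common value.\<close>
      define Q where "Q = (n1 / n2) powr (1 / (2 * \<theta>))"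
      have Q: "0 < Q" using n by (simp add: Q_def)
      define R where "R = (Q / \<omega>) powr (1 / DIM('a))"
      have R: "0 < R" using Q \<omega> by (simp add: R_def)
      have "R ^ DIM('a) = Q / \<omega>"
        unfolding R_def using Q \<omega> by (simp add: powr_powr flip: powr_realpow)
      then have RQ: "\<omega> * R ^ DIM('a) = Q" using \<omega> by simp
      define g where "g = sqrt (n1 * n2)"
      have g: "0 < g" using n by (simp add: g_def)
      have Q\<theta>: "Q powr \<theta> = sqrt (n1 / n2)"
        unfolding Q_def using n \<theta> by (simp add: powr_powr powr_half_sqrt)
      have g1: "Q powr - \<theta> * n1 = g" and g2: "Q powr \<theta> * n2 = g"
        unfolding powr_minus Q\<theta> g_def using n
        by (simp_all add: real_sqrt_divide real_sqrt_mult field_simps)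
      have scale: "(\<omega> * (l * R) ^ DIM('a)) powr h = l powr (DIM('a) * h) * Q powr h" if "0 < l" for l h :: real
      proof -
        have "\<omega> * (l * R) ^ DIM('a) = l ^ DIM('a) * Q"
          using RQ by (simp add: power_mult_distrib mult_ac)
        then show ?thesis
          using that Q by (simp add: powr_mult powr_powr flip: powr_realpow)
      qed
      define G where "G = ennreal (\<omega> powr (\<tau>\<^sub>0 / \<rho>)) * epow (ennreal g) (1 / \<rho>)"
      have pb: "piece f x t \<le> ennreal (\<nu> ^ j) * G"
        if t: "0 < t" and le: "frac_avg \<tau>\<^sub>0 f x t \<le> ennreal (2 powr (- (j * (DIM('a) * \<theta>))) * g)" for t and j :: nat
      proof -
        have "epow (frac_avg \<tau>\<^sub>0 f x t) (1 / \<rho>) \<le> epow (ennreal (2 powr (- (j * (DIM('a) * \<theta>))) * g)) (1 / \<rho>)"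
          using \<rho> le by (intro epow_mono) auto
        also have "\<dots> = ennreal ((2 powr (- (j * (DIM('a) * \<theta>)))) powr (1 / \<rho>)) * epow (ennreal g) (1 / \<rho>)"
          using \<rho> g by (simp add: ennreal_mult epow_mult epow_ennreal)
        also have "(2 powr (- (j * (DIM('a) * \<theta>)))) powr (1 / \<rho>) = \<nu> ^ j"
          by (simp add: \<nu>_def powr_powr powr_power)
        finally have "piece f x t \<le> ennreal (\<omega> powr (\<tau>\<^sub>0 / \<rho>)) * (ennreal (\<nu> ^ j) * epow (ennreal g) (1 / \<rho>))"
          unfolding piece_eq[OF t] \<omega>_def by (rule mult_left_mono) simp
        then show ?thesis by (simp add: G_def mult_ac)
      qed
      have p1: "piece f x (2 ^ j * R) \<le> ennreal (\<nu> ^ j) * G" for j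
      proof (rule pb)
        show "0 < 2 ^ j * R" using R by simp
        then have "frac_avg \<tau>\<^sub>0 f x (2 ^ j * R) \<le> ennreal ((\<omega> * (2 ^ j * R) ^ DIM('a)) powr - \<theta>) * N1"
          by (rule fa1)
        also have "\<dots> = ennreal ((2 ^ j) powr (DIM('a) * - \<theta>) * (Q powr - \<theta> * n1))"
        proof -
          have "(\<omega> * (2 ^ j * R) ^ DIM('a)) powr - \<theta> = (2 ^ j) powr (DIM('a) * - \<theta>) * Q powr - \<theta>"
            by (rule scale) simp
          then show ?thesis using n by (simp only: ennreal_mult' powr_ge_zero mult.assoc)
        qed
        also have "(2 ^ j) powr (DIM('a) * - \<theta>) = (2::real) powr (- (j * (DIM('a) * \<theta>)))"
          by (simp add: powr_powr flip: powr_realpow)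
        finally show "frac_avg \<tau>\<^sub>0 f x (2 ^ j * R) \<le> ennreal (2 powr (- (j * (DIM('a) * \<theta>))) * g)"
          unfolding g1 .
      qed
      have p2: "piece f x (R / 2 ^ j) \<le> ennreal (\<nu> ^ j) * G" for j
      proof (rule pb)
        show "0 < R / 2 ^ j" using R by simp
        then have "frac_avg \<tau>\<^sub>0 f x (R / 2 ^ j) \<le> ennreal ((\<omega> * (R / 2 ^ j) ^ DIM('a)) powr \<theta>) * N2"
          by (rule fa2)
        also have "ennreal ((\<omega> * (R / 2 ^ j) ^ DIM('a)) powr \<theta>) * N2
            = ennreal ((1 / 2 ^ j) powr (DIM('a) * \<theta>) * (Q powr \<theta> * n2))"
        proof -
          have "(\<omega> * (R / 2 ^ j) ^ DIM('a)) powr \<theta> = (1 / 2 ^ j) powr (DIM('a) * \<theta>) * Q powr \<theta>"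
            using scale[of "1 / 2 ^ j" \<theta>] by simp
          then show ?thesis using n by (simp only: ennreal_mult' powr_ge_zero mult.assoc)
        qed
        also have "(1 / 2 ^ j) powr (DIM('a) * \<theta>) = (2::real) powr (- (j * (DIM('a) * \<theta>)))"
        proof -
          have "(1 / 2 ^ j) = (2::real) powr (- real j)"
            by (simp add: powr_minus powr_realpow divide_inverse)
          then show ?thesis by (simp add: powr_powr)
        qed
        finally show "frac_avg \<tau>\<^sub>0 f x (R / 2 ^ j) \<le> ennreal (2 powr (- (j * (DIM('a) * \<theta>))) * g)"
          unfolding g2 .
      qed
      have "(\<Sum>j. piece f x (2 ^ j * R) + piece f x (R / 2 ^ j)) \<le> (\<Sum>j. ennreal (\<nu> ^ j) * G + ennreal (\<nu> ^ j) * G)"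
        by (intro suminf_le add_mono p1 p2 summableI)
      also have "\<dots> = (\<Sum>j. ennreal (\<nu> ^ j)) * (2 * G)"
      proof -
        have "ennreal (\<nu> ^ j) * G + ennreal (\<nu> ^ j) * G = ennreal (\<nu> ^ j) * (2 * G)" for j
          by (simp only: mult_2 distrib_left)
        then show ?thesis by simp
      qed
      also have "(\<Sum>j. ennreal (\<nu> ^ j)) = ennreal (1 / (1 - \<nu>))"
        using \<nu> by (subst suminf_ennreal2) (auto simp: suminf_geometric intro!: summable_geometric)
      finally have "(\<Sum>j. piece f x (2 ^ j * R) + piece f x (R / 2 ^ j)) \<le> ennreal (1 / (1 - \<nu>)) * (2 * G)" .
      then have "T f x \<le> ennreal (2 powr (DIM('a) - \<alpha>) * A) * (ennreal (1 / (1 - \<nu>)) * (2 * G))"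
        by (intro order_trans[OF T_le_pieces[OF _ R]] mult_left_mono) auto
      also have "\<dots> = ennreal C * epow (ennreal g) (1 / \<rho>)"
      proof -
        have "ennreal C = ennreal (2 powr (DIM('a) - \<alpha>) * A) * (ennreal (1 / (1 - \<nu>)) * (2 * ennreal (\<omega> powr (\<tau>\<^sub>0 / \<rho>))))"
        proof -
          have "C = 2 powr (DIM('a) - \<alpha>) * A * (1 / (1 - \<nu>) * (2 * \<omega> powr (\<tau>\<^sub>0 / \<rho>)))" by (simp add: C_def)
          also have "ennreal \<dots> = ennreal (2 powr (DIM('a) - \<alpha>) * A) * ennreal (1 / (1 - \<nu>) * (2 * \<omega> powr (\<tau>\<^sub>0 / \<rho>)))"
            using A_pos \<nu> by (intro ennreal_mult) auto
          also have "ennreal (1 / (1 - \<nu>) * (2 * \<omega> powr (\<tau>\<^sub>0 / \<rho>))) = ennreal (1 / (1 - \<nu>)) * ennreal (2 * \<omega> powr (\<tau>\<^sub>0 / \<rho>))"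
            using \<nu> by (intro ennreal_mult) auto
          also have "ennreal (2 * \<omega> powr (\<tau>\<^sub>0 / \<rho>)) = 2 * ennreal (\<omega> powr (\<tau>\<^sub>0 / \<rho>))"
            by (simp add: ennreal_mult)
          finally show ?thesis .
        qed
        then show ?thesis by (simp only: G_def mult_ac)
      qed
      also have "epow (ennreal g) (1 / \<rho>) = epow (N1 * N2) (1 / (2 * \<rho>))"
      proof -
        have "g = (n1 * n2) powr (1 / 2)" using n by (simp add: g_def powr_half_sqrt)
        then have "ennreal g = epow (N1 * N2) (1 / 2)"
          using n by (simp add: epow_ennreal flip: ennreal_mult)
        then show ?thesis using \<rho> by (simp add: epow_epow)
      qed
      finally show ?thesis unfolding N1_def N2_def .
    qed
  qed
  with C show thesis using that by blast
qed

end

section \<open>Weighted estimates for the rough fractional integral\<close>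

text \<open>This ratio sums the far pieces of the Morrey estimate. Without perturbation it is (u(B)
  / u(2^j B))^\<xi> with \<xi> = 1/q - \<mu> > 0, at most \<delta>^(\<xi> j) by reverse doubling.
  The perturbation multiplies it, up to a constant, by exp (t (m 0 - m j)), where the oscillation
  constants drift by at most \<Delta> per step.\<close>

lemma (in muckenhoupt) perturbed_ball_ratio:
  assumes [measurable]: "\<beta> \<in> borel_measurable borel" and D: "0 < D"
    and osc: "\<And>z r. 0 < r \<Longrightarrow> \<exists>m. osc_le \<beta> D m z r"
    and q: "0 < q" and \<mu>: "0 < \<mu>" "\<mu> < 1 / q"
  obtains \<epsilon> C \<nu> where "0 < \<epsilon>" "0 < C" "0 < \<nu>" "\<nu> < 1"
    "\<And>t z r j. \<bar>t\<bar> \<le> \<epsilon> \<Longrightarrow> 0 < r \<Longrightarrow>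
      ball_mass (\<lambda>x. u x * exp (t * q * \<beta> x)) z r powr (1 / q) *
        ball_mass u z (2 ^ j * r) powr \<mu>
      \<le> C * \<nu> ^ j * ball_mass (\<lambda>x. u x * exp (t * q * \<beta> x)) z (2 ^ j * r) powr (1 / q) *
        ball_mass u z r powr \<mu>"
proof -
  obtain \<epsilon>' C where \<epsilon>': "0 < \<epsilon>'" and C: "0 < C" and
    up: "\<And>z r m s. 0 < r \<Longrightarrow> osc_le \<beta> D m z r \<Longrightarrow> \<bar>s\<bar> \<le> \<epsilon>' \<Longrightarrow>
      ball_mass (\<lambda>x. u x * exp (s * \<beta> x)) z r \<le> C * (exp (s * m) * ball_mass u z r)" and
    low: "\<And>z r m s. 0 < r \<Longrightarrow> osc_le \<beta> D m z r \<Longrightarrow> \<bar>s\<bar> \<le> \<epsilon>' \<Longrightarrow>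
      exp (s * m) * ball_mass u z r \<le> C * ball_mass (\<lambda>x. u x * exp (s * \<beta> x)) z r"
    using exp_weight_comparison[OF assms(1) D osc] by blast
  obtain \<delta> where \<delta>: "0 < \<delta>" "\<delta> < 1" and
    rd: "\<And>z r. 0 < r \<Longrightarrow> ball_mass u z r \<le> \<delta> * ball_mass u z (2 * r)"
    using reverse_doubling by blast
  define \<Delta> where "\<Delta> = (D + D * 2 ^ DIM('a)) / unit_ball_vol (DIM('a))"
  have \<Delta>: "0 < \<Delta>" using D by (simp add: \<Delta>_def add_pos_pos)
  define \<xi> where "\<xi> = 1 / q - \<mu>"
  have \<xi>: "0 < \<xi>" using \<mu> by (simp add: \<xi>_def)
  define \<nu> where "\<nu> = \<delta> powr (\<xi> / 2)"
  have \<nu>: "0 < \<nu>" "\<nu> < 1"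
    using \<delta> \<xi> powr_less_mono2[of "\<xi> / 2" \<delta> 1] by (auto simp: \<nu>_def)
  \<comment> \<open>The second bound makes exp (|t| \<Delta>) at most \<delta>^(-\<xi>/2), so the
    drift uses up half of the decay \<delta>^\<xi> per step and leaves \<nu> =
    \<delta>^(\<xi>/2).\<close>
  define \<epsilon> where "\<epsilon> = min (\<epsilon>' / q) (- (\<xi> / 2) * ln \<delta> / \<Delta>)"
  have "0 < - (\<xi> / 2) * ln \<delta> / \<Delta>"
    using \<xi> \<delta> \<Delta> by (intro divide_pos_pos mult_neg_neg) auto
  then have \<epsilon>: "0 < \<epsilon>" using \<epsilon>' q by (simp add: \<epsilon>_def)
  have m_step: "\<bar>m - m'\<bar> \<le> \<Delta>" if r: "0 < r" and "osc_le \<beta> D m z r" "osc_le \<beta> D m' z (2 * r)" for m m' z r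
  proof -
    have "osc_le \<beta> (D * (2 * r / r) ^ DIM('a)) m' z r"
      using r by (intro osc_le_subset[OF that(3) _ r] subset_ball) simp
    then show ?thesis
      unfolding \<Delta>_def using r D by (intro osc_le_diff[OF assms(1) that(2) _ r]) auto
  qed
  have "ball_mass (\<lambda>x. u x * exp (t * q * \<beta> x)) z r powr (1 / q) *
        ball_mass u z (2 ^ j * r) powr \<mu>
      \<le> C powr (2 / q) * \<nu> ^ j * ball_mass (\<lambda>x. u x * exp (t * q * \<beta> x)) z (2 ^ j * r) powr (1 / q) *
        ball_mass u z r powr \<mu>" if t: "\<bar>t\<bar> \<le> \<epsilon>" and r: "0 < r" for t z r j
  proof -
    define s where "s = t * q"
    have s: "\<bar>s\<bar> \<le> \<epsilon>'"
    proof -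
      have "\<bar>t\<bar> \<le> \<epsilon>' / q" using t by (simp add: \<epsilon>_def)
      then show ?thesis using q by (simp add: s_def abs_mult field_simps)
    qed
    define V where "V j = ball_mass u z (2 ^ j * r)" for j :: nat
    define U where "U j = ball_mass (\<lambda>x. u x * exp (s * \<beta> x)) z (2 ^ j * r)" for j :: nat
    have rj: "0 < 2 ^ j * r" for j :: nat using r by simp
    have V: "0 < V j" for j unfolding V_def by (rule ball_pos[OF rj])
    have "\<forall>j. \<exists>m. osc_le \<beta> D m z (2 ^ j * r)" using osc rj by blast
    then obtain m where m: "\<And>j::nat. osc_le \<beta> D (m j) z (2 ^ j * r)" by metis
    have mj: "\<bar>m 0 - m j\<bar> \<le> j * \<Delta>" for j
    proof (induction j)
      case (Suc j)
      have "osc_le \<beta> D (m (Suc j)) z (2 * (2 ^ j * r))" using m[of "Suc j"] by (simp add: mult_ac)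
      then have "\<bar>m j - m (Suc j)\<bar> \<le> \<Delta>" by (rule m_step[OF rj m])
      then show ?case using Suc by (simp add: algebra_simps)
    qed simp
    have Vj: "V 0 \<le> \<delta> ^ j * V j" for j
    proof (induction j)
      case (Suc j)
      have "V j \<le> \<delta> * V (Suc j)" using rd[OF rj, of z j] by (simp add: V_def mult_ac)
      then have "\<delta> ^ j * V j \<le> \<delta> ^ j * (\<delta> * V (Suc j))" using \<delta> by (intro mult_left_mono) auto
      then show ?case using Suc by (simp add: mult_ac)
    qed simp
    have U0: "U 0 \<le> C * (exp (s * m 0) * V 0)" unfolding U_def V_def by (rule up[OF rj m s])
    have Uj: "exp (s * m j) * V j \<le> C * U j" unfolding U_def V_def by (rule low[OF rj m s])
    have U_nonneg: "0 \<le> U j" for j by (simp add: U_def)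
    have "U 0 * (exp (s * m j) * V j) \<le> C * (exp (s * m 0) * V 0) * (C * U j)"
      by (rule mult_mono[OF U0 Uj]) (use C V less_imp_le in \<open>auto simp: less_imp_le\<close>)
    then have "U 0 * V j \<le> C\<^sup>2 * exp (s * (m 0 - m j)) * V 0 * U j"
      by (simp add: right_diff_distrib exp_diff field_simps power2_eq_square)
    then have "(U 0 * V j) powr (1 / q) \<le> (C\<^sup>2 * exp (s * (m 0 - m j)) * V 0 * U j) powr (1 / q)"
      using q U_nonneg V[of j] by (intro powr_mono2) (auto intro: less_imp_le)
    also have "\<dots> = C powr (2 / q) * exp (t * (m 0 - m j)) * V 0 powr (1 / q) * U j powr (1 / q)"
    proof -
      have "exp (s * (m 0 - m j)) powr (1 / q) = exp (t * (m 0 - m j))"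
        using q by (simp add: powr_def s_def)
      moreover have "(C\<^sup>2) powr (1 / q) = C powr (2 / q)"
        using C by (simp add: powr_powr flip: powr_numeral)
      ultimately show ?thesis
        using C V[of 0] U_nonneg[of j] by (simp add: powr_mult)
    qed
    finally have "U 0 powr (1 / q) * V j powr (1 / q)
        \<le> C powr (2 / q) * exp (t * (m 0 - m j)) * V 0 powr (1 / q) * U j powr (1 / q)"
      using U_nonneg[of 0] V[of j] by (simp add: powr_mult)
    then have "U 0 powr (1 / q) * V j powr (1 / q) * V j powr - \<xi>
        \<le> C powr (2 / q) * exp (t * (m 0 - m j)) * V 0 powr (1 / q) * U j powr (1 / q) * V j powr - \<xi>"
      by (rule mult_right_mono) simp
    then have main: "U 0 powr (1 / q) * V j powr \<mu>
        \<le> C powr (2 / q) * exp (t * (m 0 - m j)) * V 0 powr (1 / q) * U j powr (1 / q) * V j powr - \<xi>"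
      by (simp add: \<xi>_def mult.assoc flip: powr_add)
    have "exp (t * (m 0 - m j)) * (V 0 powr (1 / q) * V j powr - \<xi>) \<le> \<nu> ^ j * V 0 powr \<mu>"
    proof -
      have "t * (m 0 - m j) \<le> \<bar>t\<bar> * \<bar>m 0 - m j\<bar>"
        using abs_ge_self[of "t * (m 0 - m j)"] by (simp add: abs_mult)
      also have "\<dots> \<le> (- (\<xi> / 2) * ln \<delta> / \<Delta>) * (j * \<Delta>)"
        using t mj[of j] \<epsilon> by (intro mult_mono) (auto simp: \<epsilon>_def)
      also have "\<dots> = - (\<xi> / 2) * ln \<delta> * j" using \<Delta> by simp
      finally have "exp (t * (m 0 - m j)) \<le> exp (- (\<xi> / 2) * ln \<delta> * j)" by simp
      also have "\<dots> = \<delta> powr (- (\<xi> / 2) * j)" using \<delta> by (simp add: powr_def mult_ac)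
      finally have e: "exp (t * (m 0 - m j)) \<le> \<delta> powr (- (\<xi> / 2) * j)" .
      have "V j powr - \<xi> \<le> (V 0 / \<delta> ^ j) powr - \<xi>"
        using Vj[of j] V[of 0] V[of j] \<delta> \<xi> by (intro powr_mono2') (auto simp: field_simps)
      also have "\<dots> = V 0 powr - \<xi> * \<delta> powr (\<xi> * j)"
      proof -
        have "(\<delta> ^ j) powr - \<xi> = \<delta> powr (- (\<xi> * j))"
          using \<delta> by (simp add: powr_powr mult.commute flip: powr_realpow)
        then show ?thesis using V[of 0] \<delta> by (simp add: powr_divide powr_minus_divide)
      qed
      finally have "V 0 powr (1 / q) * V j powr - \<xi> \<le> V 0 powr (1 / q) * (V 0 powr - \<xi> * \<delta> powr (\<xi> * j))"
        by (rule mult_left_mono) simp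
      also have "\<dots> = V 0 powr \<mu> * \<delta> powr (\<xi> * j)"
        by (simp add: \<xi>_def flip: powr_add mult.assoc)
      finally have "exp (t * (m 0 - m j)) * (V 0 powr (1 / q) * V j powr - \<xi>)
         \<le> \<delta> powr (- (\<xi> / 2) * j) * (V 0 powr \<mu> * \<delta> powr (\<xi> * j))"
        by (rule mult_mono[OF e]) auto
      also have "\<dots> = \<delta> powr (- (\<xi> / 2) * j + \<xi> * j) * V 0 powr \<mu>"
        by (simp only: powr_add mult_ac)
      also have "\<delta> powr (- (\<xi> / 2) * j + \<xi> * j) = \<nu> ^ j"
        using \<delta> by (simp add: \<nu>_def powr_powr algebra_simps flip: powr_realpow)
      finally show ?thesis .
    qed
    then have "C powr (2 / q) * U j powr (1 / q) * (exp (t * (m 0 - m j)) * (V 0 powr (1 / q) * V j powr - \<xi>))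
       \<le> C powr (2 / q) * U j powr (1 / q) * (\<nu> ^ j * V 0 powr \<mu>)"
      by (rule mult_left_mono) simp
    with main have "U 0 powr (1 / q) * V j powr \<mu> \<le> C powr (2 / q) * \<nu> ^ j * U j powr (1 / q) * V 0 powr \<mu>"
      by (simp add: mult_ac)
    then show ?thesis by (simp add: U_def V_def s_def)
  qed
  moreover have "0 < C powr (2 / q)" using C by simp
  ultimately show thesis using that \<epsilon> \<nu> by blast
qed

text \<open>Here u stands for w^q, and \<open>c_eq\<close> says c = Q / P' with P = p/\<rho> and Q =
  q/\<rho>. Since u = (w^\<rho>)^Q, this is the condition that w^\<rho> lies in A(P,Q). The function
  \<beta> will be the real or the imaginary part of b.\<close>

locale rough_muckenhoupt = rough_kernel \<Theta> \<alpha> \<rho> A + muckenhoupt u c K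
  for \<Theta> :: "'a::euclidean_space \<Rightarrow> real" and \<alpha> \<rho> A and u :: "'a \<Rightarrow> real" and c K +
  fixes p q :: real and \<beta> :: "'a \<Rightarrow> real" and D :: real
  assumes p: "\<rho> < p" and q: "0 < q" "1 / q = 1 / p - \<alpha> / DIM('a)"
    and c_eq: "c = q / \<rho> * (p / \<rho> - 1) / (p / \<rho>)"
    and \<beta>_measurable [measurable]: "\<beta> \<in> borel_measurable borel" and D_pos: "0 < D"
    and \<beta>_osc: "0 < r \<Longrightarrow> \<exists>m. osc_le \<beta> D m z r"
begin

definition "P = p / \<rho>"
definition "Q = q / \<rho>"

lemma PQ: "1 < P" "P < Q" "0 < p" "p < q" "q / p = Q / P"
proof -
  show p0: "0 < p" using p \<rho> by simp
  show "1 < P" using p \<rho> by (simp add: P_def)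
  have "1 / q < 1 / p" using q \<alpha> by simp
  then show pq: "p < q" using p0 q(1) by (simp add: field_simps)
  show "P < Q" unfolding P_def Q_def using pq \<rho> by (intro divide_strict_right_mono) auto
  show "q / p = Q / P" using \<rho> by (simp add: P_def Q_def)
qed

lemma c_PQ: "c = Q * (P - 1) / P"
  by (simp add: c_eq P_def Q_def)

lemma \<tau>\<^sub>0_eq: "1 / Q + (P - 1) / P = \<tau>\<^sub>0"
proof -
  have "(P - 1) / P = 1 - \<rho> / p" using PQ \<rho> by (simp add: P_def field_simps)
  moreover have "1 / Q = \<rho> * (1 / q)" by (simp add: Q_def)
  ultimately show ?thesis unfolding q(2) \<tau>\<^sub>0_def by (simp add: algebra_simps)
qed

text \<open>Applied to f^\<rho>, the two fractional maximal operators map a weighted L^P into L^Q1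
  and L^Q2 with 1/Q1 = 1/Q - \<theta> and 1/Q2 = 1/Q + \<theta>. The weights u^(Q'/Q) exp (t \<rho>
  Q' \<beta>) are admissible for these exponents by openness of the class, and the corresponding
  weight on the side of f is u^(p/q) exp (t p \<beta>) for both. Hoelder's inequality recombines the
  two estimates.\<close>

lemma T_strong_type:
  obtains \<epsilon> where "0 < \<epsilon>" "\<And>t. \<bar>t\<bar> \<le> \<epsilon> \<Longrightarrow> \<exists>C>0. \<forall>f\<in>borel_measurable borel.
    (\<integral>\<^sup>+x. epow (T f x) q * ennreal (u x * exp (t * q * \<beta> x)) \<partial>lborel)
      \<le> ennreal C * epow (\<integral>\<^sup>+x. epow (f x) p * ennreal (u x powr (p / q) * exp (t * p * \<beta> x)) \<partial>lborel) (q / p)"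
proof -
  obtain \<epsilon>' where \<epsilon>': "0 < \<epsilon>'" and pert: "\<And>c' s. \<bar>c' - c\<bar> \<le> \<epsilon>' \<Longrightarrow> \<bar>s\<bar> \<le> \<epsilon>' \<Longrightarrow>
      \<exists>K'. muckenhoupt (\<lambda>x. u x powr (c' / c) * exp (s * \<beta> x)) c' K'"
    using power_exp_weight[OF \<beta>_measurable D_pos \<beta>_osc] by blast
  have Q0: "0 < Q" using PQ by simp
  \<comment> \<open>The three bounds ensure Q' \<le> 2 Q, then P < Q' as the fractional maximal
    theorem demands, and finally |c' - c| \<le> 2 \<theta> Q^2 \<le> \<epsilon>'.\<close>
  define \<theta> where "\<theta> = min (1 / (2 * Q)) (min ((1 / P - 1 / Q) / 2) (\<epsilon>' / (2 * Q\<^sup>2)))"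
  have PQi: "1 / Q < 1 / P" using PQ by (simp add: field_simps)
  have \<theta>: "0 < \<theta>" using \<epsilon>' Q0 PQi by (simp add: \<theta>_def)
  have \<theta>_le: "\<theta> \<le> 1 / (2 * Q)" "\<theta> \<le> (1 / P - 1 / Q) / 2" "\<theta> \<le> \<epsilon>' / (2 * Q\<^sup>2)"
    unfolding \<theta>_def by linarith+
  have \<theta>Q: "\<theta> * Q \<le> 1 / 2" using \<theta>_le(1) Q0 by (simp add: field_simps)
  define \<epsilon> where "\<epsilon> = \<epsilon>' / (2 * q)"
  have \<epsilon>: "0 < \<epsilon>" using \<epsilon>' q by (simp add: \<epsilon>_def)
  obtain CW where CW: "0 < CW" "\<And>f x. f \<in> borel_measurable borel \<Longrightarrow>
    T f x \<le> ennreal CW * epow (supball (frac_avg (\<tau>\<^sub>0 - \<theta>) f) x * supball (frac_avg (\<tau>\<^sub>0 + \<theta>) f) x) (1 / (2 * \<rho>))"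
    using Welland[OF \<theta>] by blast
  have strong: "\<exists>C>0. \<forall>f\<in>borel_measurable borel.
      (\<integral>\<^sup>+x. epow (supball (frac_avg (\<tau>\<^sub>0 + h) f) x) Q' * ennreal (u x powr (Q' / Q) * exp (t * \<rho> * Q' * \<beta> x)) \<partial>lborel)
      \<le> ennreal C * epow (\<integral>\<^sup>+x. epow (f x) p * ennreal (u x powr (p / q) * exp (t * p * \<beta> x)) \<partial>lborel) (Q' / P)"
    if h: "\<bar>h\<bar> = \<theta>" and t: "\<bar>t\<bar> \<le> \<epsilon>" and Q': "Q' = 1 / (1 / Q + h)" for h t Q'
  proof -
    have hQ: "\<bar>h * Q\<bar> \<le> 1 / 2" using \<theta>Q h Q0 by (simp add: abs_mult)
    have Q'_eq: "Q' = Q / (1 + h * Q)" using Q0 unfolding Q' by (simp add: field_simps)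
    have pos: "1 / 2 \<le> 1 + h * Q" using hQ by linarith
    have Q'0: "0 < Q'" unfolding Q'_eq using pos Q0 by simp
    have Q'2: "Q' \<le> 2 * Q" unfolding Q'_eq using pos Q0 mult_left_mono[OF pos, of "2 * Q"]
      by (simp add: pos_divide_le_eq)
    have iQ': "1 / Q' = 1 / Q + h" using Q' by simp
    have "1 / Q + h < 1 / P"
    proof -
      define x y where "x = 1 / P" and "y = 1 / Q"
      have "\<theta> \<le> (x - y) / 2" "y < x" using \<theta>_le(2) PQi unfolding x_def y_def by auto
      then have "y + h < x" using h by (simp add: field_simps)
      then show ?thesis by (simp only: x_def y_def)
    qed
    then have PQ': "P < Q'" using Q'0 PQ unfolding iQ'[symmetric] by (simp add: field_simps)
    define c' where "c' = Q' * (P - 1) / P"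
    have c'c: "c' / c = Q' / Q" unfolding c'_def c_PQ using PQ Q0 by simp
    have "\<bar>c' - c\<bar> \<le> \<epsilon>'"
    proof -
      have "Q' - Q = - (h * Q * Q')" using pos unfolding Q'_eq by (simp add: field_simps)
      then have "\<bar>Q' - Q\<bar> = \<theta> * Q * Q'" using h Q0 Q'0 by (simp add: abs_mult)
      also have "\<dots> \<le> \<theta> * Q * (2 * Q)" using \<theta> Q0 Q'2 by (intro mult_left_mono) auto
      also have "\<dots> \<le> \<epsilon>'" using \<theta>_le(3) Q0 by (simp add: field_simps power2_eq_square)
      finally have "\<bar>Q' - Q\<bar> \<le> \<epsilon>'" .
      moreover have "c' - c = (Q' - Q) * ((P - 1) / P)"
        unfolding c'_def c_PQ using diff_divide_distrib[of "Q' * (P - 1)" "Q * (P - 1)" P]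
        by (simp only: left_diff_distrib[of Q' Q] times_divide_eq_right)
      moreover have "0 \<le> (P - 1) / P" "(P - 1) / P \<le> 1" using PQ by auto
      ultimately show ?thesis
        using mult_mono[of "\<bar>Q' - Q\<bar>" \<epsilon>' "(P - 1) / P" 1] \<epsilon>' PQ(1) by (simp add: abs_mult)
    qed
    moreover have "\<bar>t * \<rho> * Q'\<bar> \<le> \<epsilon>'"
    proof -
      have "\<bar>t * \<rho> * Q'\<bar> = \<bar>t\<bar> * (\<rho> * Q')" using \<rho> Q'0 by (simp add: abs_mult)
      also have "\<dots> \<le> \<epsilon> * (\<rho> * (2 * Q))"
        using t \<rho> Q'2 Q'0 \<epsilon> by (intro mult_mono) auto
      also have "\<dots> = \<epsilon>'" using q \<rho> by (simp add: \<epsilon>_def Q_def)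
      finally show ?thesis .
    qed
    ultimately obtain K' where K': "muckenhoupt (\<lambda>x. u x powr (c' / c) * exp (t * \<rho> * Q' * \<beta> x)) c' K'"
      using pert by blast
    obtain C where C: "0 < C" "\<And>f. f \<in> borel_measurable borel \<Longrightarrow>
      (\<integral>\<^sup>+x. epow (supball (\<lambda>z r. ennreal (measure lborel (ball z r) powr (- (1 + c') / Q')) *
        (\<integral>\<^sup>+y\<in>ball z r. f y \<partial>lborel)) x) Q' * ennreal (u x powr (c' / c) * exp (t * \<rho> * Q' * \<beta> x)) \<partial>lborel)
      \<le> ennreal C * epow (\<integral>\<^sup>+x. epow (f x) P * ennreal ((u x powr (c' / c) * exp (t * \<rho> * Q' * \<beta> x)) powr (P / Q')) \<partial>lborel) (Q' / P)"
      using muckenhoupt.fractional_maximal_strong_type[OF K' PQ(1) PQ' c'_def] by blast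
    \<comment> \<open>Because c' = Q' (P - 1) / P, the volume exponent in the maximal theorem for Q'
      is the natural one shifted by h: the condition for Q' matches the fractional average produced
      by Welland's argument.\<close>
    have "(1 + c') / Q' = 1 / Q' + (P - 1) / P" using Q'0 by (simp add: c'_def add_divide_distrib)
    then have "(1 + c') / Q' = \<tau>\<^sub>0 + h" unfolding iQ' using \<tau>\<^sub>0_eq by simp
    then have ex: "- (1 + c') / Q' = - (\<tau>\<^sub>0 + h)" by (metis minus_divide_left)
    have wt: "(u x powr (c' / c) * exp (t * \<rho> * Q' * \<beta> x)) powr (P / Q') = u x powr (p / q) * exp (t * p * \<beta> x)" for x
    proof -
      have "(u x powr (c' / c)) powr (P / Q') = u x powr (p / q)"
        unfolding c'c using Q'0 \<rho> by (simp add: powr_powr P_def Q_def)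
      moreover have "exp (t * \<rho> * Q' * \<beta> x) powr (P / Q') = exp (t * p * \<beta> x)"
        using Q'0 \<rho> by (simp add: powr_def P_def)
      ultimately show ?thesis by (simp add: powr_mult)
    qed
    have "(\<integral>\<^sup>+x. epow (supball (frac_avg (\<tau>\<^sub>0 + h) f) x) Q' * ennreal (u x powr (Q' / Q) * exp (t * \<rho> * Q' * \<beta> x)) \<partial>lborel)
      \<le> ennreal C * epow (\<integral>\<^sup>+x. epow (f x) p * ennreal (u x powr (p / q) * exp (t * p * \<beta> x)) \<partial>lborel) (Q' / P)"
      if [measurable]: "f \<in> borel_measurable borel" for f
    proof -
      have "frac_avg (\<tau>\<^sub>0 + h) f = (\<lambda>z r. ennreal (measure lborel (ball z r) powr (- (1 + c') / Q')) *
        (\<integral>\<^sup>+y\<in>ball z r. epow (f y) \<rho> \<partial>lborel))"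
        unfolding ex frac_avg_def by (rule refl)
      moreover have "epow (epow (f x) \<rho>) P = epow (f x) p" for x
        using \<rho> PQ by (simp add: epow_epow P_def)
      ultimately show ?thesis
        using C(2)[of "\<lambda>x. epow (f x) \<rho>"] unfolding wt unfolding c'c by simp
    qed
    with C(1) show ?thesis by blast
  qed
  have "\<exists>C>0. \<forall>f\<in>borel_measurable borel.
    (\<integral>\<^sup>+x. epow (T f x) q * ennreal (u x * exp (t * q * \<beta> x)) \<partial>lborel)
      \<le> ennreal C * epow (\<integral>\<^sup>+x. epow (f x) p * ennreal (u x powr (p / q) * exp (t * p * \<beta> x)) \<partial>lborel) (q / p)"
    if t: "\<bar>t\<bar> \<le> \<epsilon>" for t
  proof -
    define Q1 Q2 where "Q1 = 1 / (1 / Q - \<theta>)" and "Q2 = 1 / (1 / Q + \<theta>)"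
    define W where "W Q' x = u x powr (Q' / Q) * exp (t * \<rho> * Q' * \<beta> x)" for Q' x
    have [measurable]: "W Q' \<in> borel_measurable borel" for Q' unfolding W_def by measurable
    have W_nonneg: "0 \<le> W Q' x" for Q' x by (simp add: W_def)
    define N where "N f = (\<integral>\<^sup>+x. epow (f x) p * ennreal (u x powr (p / q) * exp (t * p * \<beta> x)) \<partial>lborel)" for f
    obtain C1 where C1: "0 < C1" "\<And>f. f \<in> borel_measurable borel \<Longrightarrow>
      (\<integral>\<^sup>+x. epow (supball (frac_avg (\<tau>\<^sub>0 - \<theta>) f) x) Q1 * ennreal (W Q1 x) \<partial>lborel) \<le> ennreal C1 * epow (N f) (Q1 / P)"
      using strong[of "- \<theta>" t Q1] \<theta> t unfolding Q1_def W_def N_def by auto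
    obtain C2 where C2: "0 < C2" "\<And>f. f \<in> borel_measurable borel \<Longrightarrow>
      (\<integral>\<^sup>+x. epow (supball (frac_avg (\<tau>\<^sub>0 + \<theta>) f) x) Q2 * ennreal (W Q2 x) \<partial>lborel) \<le> ennreal C2 * epow (N f) (Q2 / P)"
      using strong[of "\<theta>" t Q2] \<theta> t unfolding Q2_def W_def N_def by auto
    \<comment> \<open>These are the Hoelder exponents with Q1 a = Q2 (1 - a) = Q/2: each maximal
      function enters to the power Q/2 required by the geometric mean, and the two weights multiply
      to u exp (t q \<beta>).\<close>
    define a where "a = (1 - \<theta> * Q) / 2"
    have a: "0 < a" "a < 1" "1 - a = (1 + \<theta> * Q) / 2" "0 < 1 - a"
    proof -
      have "0 < \<theta> * Q" using \<theta> Q0 by simp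
      then show "0 < a" "a < 1" "0 < 1 - a" using \<theta>Q by (auto simp: a_def)
      show "1 - a = (1 + \<theta> * Q) / 2" by (simp add: a_def field_simps)
    qed
    have \<theta>Q': "1 - \<theta> * Q > 0" "1 + \<theta> * Q > 0" using \<theta>Q \<theta> Q0 by (auto intro: add_pos_pos)
    have Q1_eq: "Q1 = Q / (1 - \<theta> * Q)" and Q2_eq: "Q2 = Q / (1 + \<theta> * Q)"
      unfolding Q1_def Q2_def using Q0 \<theta>Q' by (simp_all add: field_simps)
    have Q12: "0 < Q1" "0 < Q2" unfolding Q1_eq Q2_eq using \<theta>Q' Q0 by auto
    have Qa: "Q1 * a = Q / 2" "Q2 * (1 - a) = Q / 2"
      unfolding Q1_eq Q2_eq a(3) unfolding a_def using \<theta>Q' by simp_all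
    define C where "C = CW powr q * (C1 powr a * C2 powr (1 - a))"
    have "0 < C" using CW C1 C2 by (simp add: C_def)
    moreover have "(\<integral>\<^sup>+x. epow (T f x) q * ennreal (u x * exp (t * q * \<beta> x)) \<partial>lborel) \<le> ennreal C * epow (N f) (q / p)"
      if f [measurable]: "f \<in> borel_measurable borel" for f
    proof -
      define N1 N2 where "N1 x = supball (frac_avg (\<tau>\<^sub>0 - \<theta>) f) x" and "N2 x = supball (frac_avg (\<tau>\<^sub>0 + \<theta>) f) x" for x
      have [measurable]: "N1 \<in> borel_measurable borel" "N2 \<in> borel_measurable borel"
        unfolding N1_def N2_def by measurable
      have "epow (T f x) q * ennreal (u x * exp (t * q * \<beta> x))
        \<le> ennreal (CW powr q) * (epow (epow (N1 x) Q1 * ennreal (W Q1 x)) a * epow (epow (N2 x) Q2 * ennreal (W Q2 x)) (1 - a))" for x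
      proof -
        have "epow (T f x) q \<le> epow (ennreal CW * epow (N1 x * N2 x) (1 / (2 * \<rho>))) q"
          unfolding N1_def N2_def using q by (intro epow_mono CW(2) f) auto
        also have "\<dots> = ennreal (CW powr q) * (epow (N1 x) (Q / 2) * epow (N2 x) (Q / 2))"
        proof -
          have "1 / (2 * \<rho>) * q = Q / 2" by (simp add: Q_def)
          moreover have "0 < 1 / (2 * \<rho>)" using \<rho> by simp
          ultimately have "epow (epow Z (1 / (2 * \<rho>))) q = epow Z (Q / 2)" for Z
            using epow_epow[of "1 / (2 * \<rho>)" q Z] q(1) by (simp only:)
          moreover have "epow (N1 x * N2 x) (Q / 2) = epow (N1 x) (Q / 2) * epow (N2 x) (Q / 2)"
            using Q0 by (simp add: epow_mult)
          ultimately show ?thesis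
            using CW(1) by (simp only: epow_mult[OF q(1)] epow_ennreal less_imp_le)
        qed
        finally have le: "epow (T f x) q \<le> ennreal (CW powr q) * (epow (N1 x) (Q / 2) * epow (N2 x) (Q / 2))" .
        have "W Q1 x powr a * W Q2 x powr (1 - a) = u x * exp (t * q * \<beta> x)"
        proof -
          have "W Q' x powr b = u x powr (1 / 2) * exp (t * q * \<beta> x / 2)" if "Q' * b = Q / 2" for Q' b
          proof -
            have "Q' / Q * b = Q' * b / Q" by simp
            also have "\<dots> = 1 / 2" unfolding that using Q0 by simp
            finally have "(u x powr (Q' / Q)) powr b = u x powr (1 / 2)" by (simp only: powr_powr)
            moreover have "exp (t * \<rho> * Q' * \<beta> x) powr b = exp (t * \<rho> * (Q' * b) * \<beta> x)"
              by (simp add: powr_def mult_ac)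
            then have "exp (t * \<rho> * Q' * \<beta> x) powr b = exp (t * q * \<beta> x / 2)"
              unfolding that using \<rho> by (simp add: Q_def)
            ultimately show ?thesis by (simp add: W_def powr_mult)
          qed
          then have "W Q1 x powr a * W Q2 x powr (1 - a) = (u x powr (1 / 2) * exp (t * q * \<beta> x / 2)) * (u x powr (1 / 2) * exp (t * q * \<beta> x / 2))"
            using Qa by simp
          also have "\<dots> = (u x powr (1 / 2) * u x powr (1 / 2)) * (exp (t * q * \<beta> x / 2) * exp (t * q * \<beta> x / 2))"
            by (simp only: mult_ac)
          also have "u x powr (1 / 2) * u x powr (1 / 2) = u x"
            using u_pos[of x] by (simp flip: powr_add)
          also have "exp (t * q * \<beta> x / 2) * exp (t * q * \<beta> x / 2) = exp (t * q * \<beta> x)"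
            by (simp flip: exp_add)
          finally show ?thesis .
        qed
        then have "ennreal (u x * exp (t * q * \<beta> x)) = epow (ennreal (W Q1 x)) a * epow (ennreal (W Q2 x)) (1 - a)"
          using W_nonneg by (simp add: epow_ennreal flip: ennreal_mult)
        moreover have "epow (epow (N1 x) Q1 * ennreal (W Q1 x)) a = epow (N1 x) (Q / 2) * epow (ennreal (W Q1 x)) a"
          by (simp only: epow_mult[OF a(1)] epow_epow[OF Q12(1) a(1)] Qa)
        moreover have "epow (epow (N2 x) Q2 * ennreal (W Q2 x)) (1 - a) = epow (N2 x) (Q / 2) * epow (ennreal (W Q2 x)) (1 - a)"
          by (simp only: epow_mult[OF a(4)] epow_epow[OF Q12(2) a(4)] Qa)
        ultimately show ?thesis
          using mult_right_mono[OF le, of "ennreal (u x * exp (t * q * \<beta> x))"] by (simp add: mult_ac)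
      qed
      then have "(\<integral>\<^sup>+x. epow (T f x) q * ennreal (u x * exp (t * q * \<beta> x)) \<partial>lborel)
        \<le> (\<integral>\<^sup>+x. ennreal (CW powr q) * (epow (epow (N1 x) Q1 * ennreal (W Q1 x)) a * epow (epow (N2 x) Q2 * ennreal (W Q2 x)) (1 - a)) \<partial>lborel)"
        by (intro nn_integral_mono)
      also have "\<dots> = ennreal (CW powr q) * (\<integral>\<^sup>+x. epow (epow (N1 x) Q1 * ennreal (W Q1 x)) a * epow (epow (N2 x) Q2 * ennreal (W Q2 x)) (1 - a) \<partial>lborel)"
        by (rule nn_integral_cmult) measurable
      also have "\<dots> \<le> ennreal (CW powr q) * (epow (ennreal C1 * epow (N f) (Q1 / P)) a * epow (ennreal C2 * epow (N f) (Q2 / P)) (1 - a))"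
      proof (rule mult_left_mono)
        have "(\<integral>\<^sup>+x. epow (epow (N1 x) Q1 * ennreal (W Q1 x)) a * epow (epow (N2 x) Q2 * ennreal (W Q2 x)) (1 - a) \<partial>lborel)
          \<le> epow (\<integral>\<^sup>+x. epow (N1 x) Q1 * ennreal (W Q1 x) \<partial>lborel) a * epow (\<integral>\<^sup>+x. epow (N2 x) Q2 * ennreal (W Q2 x) \<partial>lborel) (1 - a)"
          by (rule Holder_nn_integral[OF _ _ a(1,2)]) measurable
        also have "\<dots> \<le> epow (ennreal C1 * epow (N f) (Q1 / P)) a * epow (ennreal C2 * epow (N f) (Q2 / P)) (1 - a)"
          unfolding N1_def N2_def using a(1,2) by (intro mult_mono epow_mono C1(2) C2(2) f) auto
        finally show "(\<integral>\<^sup>+x. epow (epow (N1 x) Q1 * ennreal (W Q1 x)) a * epow (epow (N2 x) Q2 * ennreal (W Q2 x)) (1 - a) \<partial>lborel)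
          \<le> epow (ennreal C1 * epow (N f) (Q1 / P)) a * epow (ennreal C2 * epow (N f) (Q2 / P)) (1 - a)" .
      qed simp
      also have "\<dots> = ennreal C * (epow (N f) (Q / 2 / P) * epow (N f) (Q / 2 / P))"
      proof -
        have "Q1 / P * a = Q / 2 / P" "Q2 / P * (1 - a) = Q / 2 / P"
          by (simp_all only: times_divide_eq_left Qa)
        moreover have "0 < Q1 / P" "0 < Q2 / P" using Q12 PQ(1) by auto
        ultimately have "epow (ennreal C1 * epow (N f) (Q1 / P)) a = ennreal (C1 powr a) * epow (N f) (Q / 2 / P)"
          "epow (ennreal C2 * epow (N f) (Q2 / P)) (1 - a) = ennreal (C2 powr (1 - a)) * epow (N f) (Q / 2 / P)"
          using epow_epow[of "Q1 / P" a "N f"] epow_epow[of "Q2 / P" "1 - a" "N f"] a(1,4) C1(1) C2(1)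
          by (simp_all only: epow_mult[OF a(1)] epow_mult[OF a(4)] epow_ennreal less_imp_le)
        then show ?thesis by (simp add: C_def ennreal_mult mult_ac)
      qed
      also have "epow (N f) (Q / 2 / P) * epow (N f) (Q / 2 / P) = epow (N f) (q / p)"
        unfolding PQ(5) using Q0 PQ(1) by (subst epow_add[symmetric]) (auto simp flip: add_divide_distrib)
      finally show ?thesis .
    qed
    ultimately show ?thesis unfolding N_def by blast
  qed
  with \<epsilon> show thesis using that by blast
qed


text \<open>Conjugation by exp (t \<beta>) is a change of weights: u becomes u1 = u exp (t q
  \<beta>) on the side of T g, and g = exp (- t \<beta>) f has for the weight u^(p/q) exp (t p
  \<beta>) the norm that f has for u^(p/q). Hence f is always measured by its hypothesis in terms of
  u, and masses of u1 are traded for masses of u through \<open>perturbed_ball_ratio\<close>. The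
  number \<Lambda> plays the part of the Morrey norm.\<close>

theorem Morrey_estimate:
  assumes \<kappa>: "0 < \<kappa>" "\<kappa> < p / q"
  obtains \<epsilon> where "0 < \<epsilon>" "\<And>t. \<bar>t\<bar> \<le> \<epsilon> \<Longrightarrow> \<exists>C>0. \<forall>f\<in>borel_measurable borel. \<forall>\<Lambda>\<ge>0.
    (\<forall>z r. 0 < r \<longrightarrow> (\<integral>\<^sup>+x\<in>ball z r. epow (f x) p * ennreal (u x powr (p / q)) \<partial>lborel)
        \<le> ennreal (\<Lambda> powr p * ball_mass u z r powr \<kappa>)) \<longrightarrow>
    (\<forall>z r. 0 < r \<longrightarrow> (\<integral>\<^sup>+x\<in>ball z r. epow (ennreal (exp (t * \<beta> x)) * T (\<lambda>y. ennreal (exp (- t * \<beta> y)) * f y) x) q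
          * ennreal (u x) \<partial>lborel)
        \<le> ennreal (C * \<Lambda> powr q * ball_mass u z r powr (\<kappa> * q / p)))"
proof -
  \<comment> \<open>The hypothesis \<kappa> < p/q is exactly \<mu> < 1/q, the condition under which
    the ratio of masses decays.\<close>
  define \<mu> where "\<mu> = \<kappa> / p"
  have \<mu>: "0 < \<mu>" "\<mu> < 1 / q" using \<kappa> PQ q(1) by (simp_all add: \<mu>_def field_simps)
  obtain \<epsilon>1 where \<epsilon>1: "0 < \<epsilon>1" "\<And>t. \<bar>t\<bar> \<le> \<epsilon>1 \<Longrightarrow> \<exists>C>0. \<forall>f\<in>borel_measurable borel.
    (\<integral>\<^sup>+x. epow (T f x) q * ennreal (u x * exp (t * q * \<beta> x)) \<partial>lborel)
      \<le> ennreal C * epow (\<integral>\<^sup>+x. epow (f x) p * ennreal (u x powr (p / q) * exp (t * p * \<beta> x)) \<partial>lborel) (q / p)"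
    using T_strong_type by blast
  obtain \<epsilon>2 Cr \<nu> where \<epsilon>2: "0 < \<epsilon>2" and Cr: "0 < Cr" and \<nu>: "0 < \<nu>" "\<nu> < 1" and ratio:
    "\<And>t z r j. \<bar>t\<bar> \<le> \<epsilon>2 \<Longrightarrow> 0 < r \<Longrightarrow>
      ball_mass (\<lambda>x. u x * exp (t * q * \<beta> x)) z r powr (1 / q) *
        ball_mass u z (2 ^ j * r) powr \<mu>
      \<le> Cr * \<nu> ^ j * ball_mass (\<lambda>x. u x * exp (t * q * \<beta> x)) z (2 ^ j * r) powr (1 / q) *
        ball_mass u z r powr \<mu>"
    using perturbed_ball_ratio[OF \<beta>_measurable D_pos \<beta>_osc q(1) \<mu>] by blast
  obtain \<epsilon>3 where \<epsilon>3: "0 < \<epsilon>3" and pert: "\<And>c' s. \<bar>c' - c\<bar> \<le> \<epsilon>3 \<Longrightarrow> \<bar>s\<bar> \<le> \<epsilon>3 \<Longrightarrow>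
      \<exists>K'. muckenhoupt (\<lambda>x. u x powr (c' / c) * exp (s * \<beta> x)) c' K'"
    using power_exp_weight[OF \<beta>_measurable D_pos \<beta>_osc] by blast
  define \<epsilon> where "\<epsilon> = min \<epsilon>1 (min \<epsilon>2 (\<epsilon>3 / q))"
  have \<epsilon>: "0 < \<epsilon>" using \<epsilon>1 \<epsilon>2 \<epsilon>3 q by (simp add: \<epsilon>_def)
  have "\<exists>C>0. \<forall>f\<in>borel_measurable borel. \<forall>\<Lambda>\<ge>0.
    (\<forall>z r. 0 < r \<longrightarrow> (\<integral>\<^sup>+x\<in>ball z r. epow (f x) p * ennreal (u x powr (p / q)) \<partial>lborel)
        \<le> ennreal (\<Lambda> powr p * ball_mass u z r powr \<kappa>)) \<longrightarrow>
    (\<forall>z r. 0 < r \<longrightarrow> (\<integral>\<^sup>+x\<in>ball z r. epow (ennreal (exp (t * \<beta> x)) * T (\<lambda>y. ennreal (exp (- t * \<beta> y)) * f y) x) q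
          * ennreal (u x) \<partial>lborel)
        \<le> ennreal (C * \<Lambda> powr q * ball_mass u z r powr (\<kappa> * q / p)))"
    if t: "\<bar>t\<bar> \<le> \<epsilon>" for t
  proof -
    have t_le: "\<bar>t\<bar> \<le> \<epsilon>1" "\<bar>t\<bar> \<le> \<epsilon>2" "\<bar>t * q\<bar> \<le> \<epsilon>3"
    proof -
      show "\<bar>t\<bar> \<le> \<epsilon>1" "\<bar>t\<bar> \<le> \<epsilon>2" using t unfolding \<epsilon>_def by linarith+
      have "\<bar>t\<bar> \<le> \<epsilon>3 / q" using t unfolding \<epsilon>_def by linarith
      then show "\<bar>t * q\<bar> \<le> \<epsilon>3" using q(1) by (simp add: abs_mult field_simps)
    qed
    define u1 where "u1 x = u x * exp (t * q * \<beta> x)" for x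
    have u1_eq: "u x powr (c / c) * exp (t * q * \<beta> x) = u1 x" for x
      using c_pos u_pos[of x] by (simp add: u1_def)
    obtain K1 where K1: "muckenhoupt u1 c K1"
      using pert[of c "t * q"] t_le(3) \<epsilon>3 unfolding u1_eq by auto
    interpret M1: muckenhoupt u1 c K1 by (rule K1)
    obtain C1 where C1: "0 < C1" "\<And>f. f \<in> borel_measurable borel \<Longrightarrow>
      (\<integral>\<^sup>+x. epow (T f x) q * ennreal (u1 x) \<partial>lborel)
        \<le> ennreal C1 * epow (\<integral>\<^sup>+x. epow (f x) p * ennreal (u x powr (p / q) * exp (t * p * \<beta> x)) \<partial>lborel) (q / p)"
      using \<epsilon>1(2)[OF t_le(1)] unfolding u1_def by blast
    define \<omega> where "\<omega> = unit_ball_vol (real DIM('a))"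
    \<comment> \<open>C2 is the constant of one far piece: the volume normalisation, the cost of
      recentring the ball, and the Muckenhoupt constant of u1. In Y it is multiplied by the
      constants of the kernel decomposition and of the mass ratio and by the sum of the geometric
      series.\<close>
    define C2 where "C2 = \<omega> powr (\<tau>\<^sub>0 / \<rho>) * (2 powr (DIM('a) * \<tau>\<^sub>0) * K1 powr (1 / Q)) powr (1 / \<rho>)"
    have C2: "0 \<le> C2" by (simp add: C2_def)
    define G where "G = K * (2 ^ DIM('a)) powr (1 + c)"
    have G: "0 < G" using K_pos by (simp add: G_def)
    define Y where "Y = 2 powr (DIM('a) - \<alpha>) * A * (C2 * Cr * (1 / (1 - \<nu>)))"
    have Y: "0 \<le> Y" unfolding Y_def using A_pos C2 Cr \<nu> by (intro mult_nonneg_nonneg) auto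
    define C where "C = 2 powr q * (C1 * G powr (\<kappa> * q / p) + Y powr q)"
    have "0 < C" unfolding C_def using C1 G by (intro mult_pos_pos add_pos_nonneg) auto
    moreover have "(\<integral>\<^sup>+x\<in>ball z r. epow (ennreal (exp (t * \<beta> x)) * T (\<lambda>y. ennreal (exp (- t * \<beta> y)) * f y) x) q
          * ennreal (u x) \<partial>lborel)
        \<le> ennreal (C * \<Lambda> powr q * ball_mass u z r powr (\<kappa> * q / p))"
      if f [measurable]: "f \<in> borel_measurable borel" and \<Lambda>: "0 \<le> \<Lambda>"
        and bound: "\<And>z r. 0 < r \<Longrightarrow> (\<integral>\<^sup>+x\<in>ball z r. epow (f x) p * ennreal (u x powr (p / q)) \<partial>lborel)
        \<le> ennreal (\<Lambda> powr p * ball_mass u z r powr \<kappa>)" and r: "0 < r" for f \<Lambda> z r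
    proof -
      define g where "g y = ennreal (exp (- t * \<beta> y)) * f y" for y
      have [measurable]: "g \<in> borel_measurable borel" unfolding g_def by measurable
      have gw: "epow (g y) p * ennreal (u y powr (p / q) * exp (t * p * \<beta> y)) = epow (f y) p * ennreal (u y powr (p / q))" for y
      proof -
        have "exp (- t * \<beta> y) powr p * exp (t * p * \<beta> y) = 1"
          by (simp add: powr_def flip: exp_add)
        then have "exp (- t * \<beta> y) powr p * (u y powr (p / q) * exp (t * p * \<beta> y)) = u y powr (p / q)"
          by (metis mult.left_commute mult.right_neutral)
        then have "ennreal (exp (- t * \<beta> y) powr p) * ennreal (u y powr (p / q) * exp (t * p * \<beta> y)) = ennreal (u y powr (p / q))"
          by (simp flip: ennreal_mult)
        moreover have "epow (g y) p = epow (f y) p * ennreal (exp (- t * \<beta> y) powr p)"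
          using PQ(3) by (simp add: g_def epow_mult epow_ennreal mult.commute)
        ultimately show ?thesis by (simp add: mult.assoc)
      qed
      define V where "V R = ball_mass u z R" for R
      define U where "U R = ball_mass u1 z R" for R
      have V: "0 < V R" and U: "0 < U R" if "0 < R" for R
        using ball_pos[OF that] M1.ball_pos[OF that] by (auto simp: V_def U_def)
      define g1 where "g1 y = g y * indicator (ball z (2 * r)) y" for y
      define g2 where "g2 y = g y * indicator (- ball z (2 * r)) y" for y
      have [measurable]: "g1 \<in> borel_measurable borel" "g2 \<in> borel_measurable borel"
        unfolding g1_def g2_def by measurable
      have split: "T g x = T g1 x + T g2 x" for x
      proof -
        have "g = (\<lambda>y. g1 y + g2 y)"
          by (auto simp: g1_def g2_def indicator_def fun_eq_iff)
        then have "T g x = T (\<lambda>y. g1 y + g2 y) x" by simp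
        also have "\<dots> = T g1 x + T g2 x" by (rule T_add) measurable
        finally show ?thesis .
      qed
      \<comment> \<open>On 2B the strong type estimate on the whole space applies to the truncated
        function, and doubling returns from the mass of 2B to that of B.\<close>
      have near: "(\<integral>\<^sup>+x. epow (T g1 x) q * ennreal (u1 x) \<partial>lborel)
          \<le> ennreal (C1 * G powr (\<kappa> * q / p) * \<Lambda> powr q * V r powr (\<kappa> * q / p))"
      proof -
        have "epow (g1 x) p * ennreal (u x powr (p / q) * exp (t * p * \<beta> x))
            = epow (f x) p * ennreal (u x powr (p / q)) * indicator (ball z (2 * r)) x" for x
          unfolding gw[symmetric] using PQ(3) by (cases "x \<in> ball z (2 * r)") (auto simp: g1_def)
        then have "(\<integral>\<^sup>+x. epow (g1 x) p * ennreal (u x powr (p / q) * exp (t * p * \<beta> x)) \<partial>lborel)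
            \<le> ennreal (\<Lambda> powr p * V (2 * r) powr \<kappa>)"
          using bound[of "2 * r" z] r by (simp add: V_def)
        then have "epow (\<integral>\<^sup>+x. epow (g1 x) p * ennreal (u x powr (p / q) * exp (t * p * \<beta> x)) \<partial>lborel) (q / p)
            \<le> epow (ennreal (\<Lambda> powr p * V (2 * r) powr \<kappa>)) (q / p)"
          using PQ q(1) by (intro epow_mono) auto
        also have "\<dots> = ennreal (\<Lambda> powr q * V (2 * r) powr (\<kappa> * q / p))"
        proof -
          have "(\<Lambda> powr p * V (2 * r) powr \<kappa>) powr (q / p) = \<Lambda> powr q * V (2 * r) powr (\<kappa> * q / p)"
            using PQ(3) by (simp add: powr_mult powr_powr)
          then show ?thesis by (simp add: epow_ennreal)
        qed
        also have "\<dots> \<le> ennreal (\<Lambda> powr q * (G * V r) powr (\<kappa> * q / p))"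
        proof (intro ennreal_leI mult_left_mono powr_mono2)
          have "ball z r \<subseteq> ball z (2 * r)" using r by (intro subset_ball) simp
          then show "V (2 * r) \<le> G * V r"
            using ball_growth[OF r, of z z "2 * r"] r by (simp add: V_def G_def)
        qed (use \<kappa> PQ q(1) in \<open>auto simp: V_def\<close>)
        finally have "ennreal C1 * epow (\<integral>\<^sup>+x. epow (g1 x) p * ennreal (u x powr (p / q) * exp (t * p * \<beta> x)) \<partial>lborel) (q / p)
            \<le> ennreal C1 * ennreal (\<Lambda> powr q * (G * V r) powr (\<kappa> * q / p))"
          by (rule mult_left_mono) simp
        also have "\<dots> = ennreal (C1 * G powr (\<kappa> * q / p) * \<Lambda> powr q * V r powr (\<kappa> * q / p))"
          using C1 G V[OF r] by (simp add: powr_mult mult_ac flip: ennreal_mult)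
        finally show ?thesis by (intro order_trans[OF C1(2)]) auto
      qed
      have far: "T g2 x \<le> ennreal (Y * \<Lambda> * V r powr \<mu> * U r powr (- 1 / q))" if x: "x \<in> ball z r" for x
      proof -
        define H where "H = C2 * \<Lambda> * Cr * (V r powr \<mu> * U r powr (- 1 / q))"
        have H: "0 \<le> H" unfolding H_def using C2 \<Lambda> Cr by (intro mult_nonneg_nonneg) auto
        \<comment> \<open>Balls about a point of B with radius at most r stay inside 2B, where g2
          vanishes; only the growing radii contribute.\<close>
        have small: "piece g2 x (r / 2 ^ j) = 0" for j
        proof -
          have "ball x (r / 2 ^ j) \<subseteq> ball z (2 * r)"
          proof
            fix y assume "y \<in> ball x (r / 2 ^ j)"
            moreover have "r / 2 ^ j \<le> r" using r by (simp add: divide_le_eq)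
            ultimately have "dist x y < r" by simp
            moreover have "dist z x < r" using x by simp
            ultimately have "dist z y < 2 * r" using dist_triangle[of z y x] by linarith
            then show "y \<in> ball z (2 * r)" by simp
          qed
          then have zero: "epow (g2 y) \<rho> * indicator (ball x (r / 2 ^ j)) y = 0" for y
            by (auto simp: g2_def indicator_def)
          show ?thesis unfolding piece_def zero by simp
        qed
        have large: "piece g2 x (2 ^ j * r) \<le> ennreal (\<nu> ^ j * H)" for j
        proof -
          define s where "s = 2 ^ j * r"
          have s: "0 < s" "2 * s = 2 ^ Suc j * r" using r by (simp_all add: s_def)
          have rs: "r \<le> s" unfolding s_def using r mult_right_mono[of 1 "2 ^ j" r] by simp
          have sub: "ball x s \<subseteq> ball z (2 * s)"
          proof
            fix y assume "y \<in> ball x s"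
            then have "dist x y < s" by simp
            moreover have "dist z x < s" using x rs by simp
            ultimately have "dist z y < 2 * s" using dist_triangle[of z y x] by linarith
            then show "y \<in> ball z (2 * s)" by simp
          qed
          \<comment> \<open>Recentring from x to z doubles the radius. It makes the bound uniform
            over x in B and leads to the concentric balls on which the ratio of masses is
            known.\<close>
          have "frac_avg \<tau>\<^sub>0 g2 x s \<le> ennreal (2 powr (DIM('a) * \<tau>\<^sub>0)) * frac_avg \<tau>\<^sub>0 g z (2 * s)"
          proof -
            have "measure lborel (ball z (2 * s)) = 2 ^ DIM('a) * measure lborel (ball x s)"
              using s(1) by (simp add: measure_lborel_ball power_mult_distrib)
            then have "measure lborel (ball z (2 * s)) powr - \<tau>\<^sub>0 = 2 powr (- (DIM('a) * \<tau>\<^sub>0)) * measure lborel (ball x s) powr - \<tau>\<^sub>0"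
              by (simp add: powr_mult powr_powr flip: powr_realpow)
            then have e: "measure lborel (ball x s) powr - \<tau>\<^sub>0 = 2 powr (DIM('a) * \<tau>\<^sub>0) * measure lborel (ball z (2 * s)) powr - \<tau>\<^sub>0"
              by (simp flip: mult.assoc powr_add)
            have "(\<integral>\<^sup>+y\<in>ball x s. epow (g2 y) \<rho> \<partial>lborel) \<le> (\<integral>\<^sup>+y\<in>ball z (2 * s). epow (g y) \<rho> \<partial>lborel)"
              using sub by (intro nn_integral_mono) (auto simp: indicator_def g2_def)
            then have "frac_avg \<tau>\<^sub>0 g2 x s \<le> ennreal (2 powr (DIM('a) * \<tau>\<^sub>0) * measure lborel (ball z (2 * s)) powr - \<tau>\<^sub>0)
                * (\<integral>\<^sup>+y\<in>ball z (2 * s). epow (g y) \<rho> \<partial>lborel)"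
              unfolding frac_avg_def e by (rule mult_left_mono) simp
            then show ?thesis unfolding frac_avg_def by (simp add: ennreal_mult mult.assoc)
          qed
          \<comment> \<open>The weight that pairs with g is u1, so its Muckenhoupt constant appears.
            The remaining norm is that of f for u^(p/q), and the hypothesis on f applies on the ball
            of radius 2 s.\<close>
          also have "frac_avg \<tau>\<^sub>0 g z (2 * s) \<le> ennreal (K1 powr (1 / Q) * U (2 * s) powr (- 1 / Q)) *
              ennreal ((\<Lambda> powr p * V (2 * s) powr \<kappa>) powr (1 / P))"
          proof -
            have "(1 + c) / Q = 1 / Q + (P - 1) / P"
              using PQ by (simp add: c_PQ add_divide_distrib)
            then have ex: "- (1 + c) / Q = - \<tau>\<^sub>0" using \<tau>\<^sub>0_eq by (metis minus_divide_left)
            have s2: "0 < 2 * s" using s by simp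
            have wt: "epow (epow (g y) \<rho>) P * ennreal (u1 y powr (P / Q)) = epow (f y) p * ennreal (u y powr (p / q))" for y
            proof -
              have "epow (epow (g y) \<rho>) P = epow (g y) p"
                using \<rho> PQ by (simp add: epow_epow P_def)
              moreover have "u1 y powr (P / Q) = u y powr (p / q) * exp (t * p * \<beta> y)"
                using \<rho> q(1) by (simp add: u1_def powr_mult P_def Q_def) (simp add: powr_def)
              ultimately show ?thesis using gw[of y] by simp
            qed
            have "frac_avg \<tau>\<^sub>0 g z (2 * s) = ennreal (measure lborel (ball z (2 * s)) powr (- (1 + c) / Q)) *
                (\<integral>\<^sup>+y\<in>ball z (2 * s). epow (g y) \<rho> \<partial>lborel)"
              unfolding frac_avg_def ex ..
            also have "\<dots> \<le> ennreal (K1 powr (1 / Q) * U (2 * s) powr (- 1 / Q)) *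
                epow (\<integral>\<^sup>+y\<in>ball z (2 * s). epow (epow (g y) \<rho>) P * ennreal (u1 y powr (P / Q)) \<partial>lborel) (1 / P)"
              unfolding U_def by (rule M1.fractional_average_le[OF _ PQ(1,2) c_PQ s2]) measurable
            also have "\<dots> \<le> ennreal (K1 powr (1 / Q) * U (2 * s) powr (- 1 / Q)) *
                epow (ennreal (\<Lambda> powr p * V (2 * s) powr \<kappa>)) (1 / P)"
              unfolding wt V_def using PQ by (intro mult_left_mono epow_mono bound s2) auto
            finally show ?thesis by (simp add: epow_ennreal)
          qed
          finally have "frac_avg \<tau>\<^sub>0 g2 x s \<le> ennreal (2 powr (DIM('a) * \<tau>\<^sub>0)) * (ennreal (K1 powr (1 / Q) * U (2 * s) powr (- 1 / Q)) *
              ennreal ((\<Lambda> powr p * V (2 * s) powr \<kappa>) powr (1 / P)))"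
            by (simp add: mult_left_mono)
          also have "\<dots> = ennreal (2 powr (DIM('a) * \<tau>\<^sub>0) * K1 powr (1 / Q) * U (2 * s) powr (- 1 / Q) * (\<Lambda> powr p * V (2 * s) powr \<kappa>) powr (1 / P))"
            by (simp add: mult.assoc flip: ennreal_mult)
          finally have "epow (frac_avg \<tau>\<^sub>0 g2 x s) (1 / \<rho>) \<le>
              ennreal ((2 powr (DIM('a) * \<tau>\<^sub>0) * K1 powr (1 / Q) * U (2 * s) powr (- 1 / Q) * (\<Lambda> powr p * V (2 * s) powr \<kappa>) powr (1 / P)) powr (1 / \<rho>))"
            using \<rho> by (subst epow_ennreal[symmetric]) (auto intro!: epow_mono)
          also have "(2 powr (DIM('a) * \<tau>\<^sub>0) * K1 powr (1 / Q) * U (2 * s) powr (- 1 / Q) * (\<Lambda> powr p * V (2 * s) powr \<kappa>) powr (1 / P)) powr (1 / \<rho>)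
              = (2 powr (DIM('a) * \<tau>\<^sub>0) * K1 powr (1 / Q)) powr (1 / \<rho>) * (U (2 * s) powr (- 1 / q) * (\<Lambda> * V (2 * s) powr \<mu>))"
          proof -
            have "(U (2 * s) powr (- 1 / Q)) powr (1 / \<rho>) = U (2 * s) powr (- 1 / q)"
              using \<rho> by (simp add: powr_powr Q_def)
            moreover have "((\<Lambda> powr p * V (2 * s) powr \<kappa>) powr (1 / P)) powr (1 / \<rho>) = \<Lambda> * V (2 * s) powr \<mu>"
              using \<rho> PQ(3) \<Lambda> by (simp add: powr_mult powr_powr P_def \<mu>_def)
            ultimately show ?thesis by (simp add: powr_mult mult.assoc)
          qed
          finally have "piece g2 x s \<le> ennreal (\<omega> powr (\<tau>\<^sub>0 / \<rho>)) * ennreal ((2 powr (DIM('a) * \<tau>\<^sub>0) * K1 powr (1 / Q)) powr (1 / \<rho>) * (U (2 * s) powr (- 1 / q) * (\<Lambda> * V (2 * s) powr \<mu>)))"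
            unfolding piece_eq[OF s(1)] \<omega>_def by (rule mult_left_mono) simp
          also have "\<dots> = ennreal (C2 * (\<Lambda> * (U (2 * s) powr (- 1 / q) * V (2 * s) powr \<mu>)))"
            using \<Lambda> by (simp add: C2_def mult_ac flip: ennreal_mult)
          also have "\<dots> \<le> ennreal (\<nu> ^ j * H)"
          proof (intro ennreal_leI)
            have s2: "0 < 2 * s" using s by simp
            \<comment> \<open>The ball has radius 2 s = 2^(j+1) r, so the ratio is taken at
              \<open>Suc j\<close>; the additional factor \<nu> < 1 is dropped.\<close>
            have "U r powr (1 / q) * V (2 * s) powr \<mu> \<le> Cr * \<nu> ^ Suc j * U (2 * s) powr (1 / q) * V r powr \<mu>"
              using ratio[OF t_le(2) r, of z "Suc j"] unfolding s(2) U_def V_def u1_def .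
            also have "\<dots> \<le> Cr * \<nu> ^ j * U (2 * s) powr (1 / q) * V r powr \<mu>"
              using \<nu> Cr by (intro mult_right_mono mult_left_mono) (auto simp: mult_left_le_one_le)
            finally have *: "U r powr (1 / q) * V (2 * s) powr \<mu> \<le> Cr * \<nu> ^ j * U (2 * s) powr (1 / q) * V r powr \<mu>" .
            define a b where "a = U r powr (1 / q)" and "b = U (2 * s) powr (1 / q)"
            have ab: "0 < a" "0 < b" using U[OF r] U[OF s2] by (auto simp: a_def b_def)
            have inv: "U r powr (- 1 / q) = 1 / a" "U (2 * s) powr (- 1 / q) = 1 / b"
              unfolding a_def b_def by (metis minus_divide_left powr_minus_divide)+
            have "U (2 * s) powr (- 1 / q) * V (2 * s) powr \<mu> \<le> Cr * \<nu> ^ j * (V r powr \<mu> * U r powr (- 1 / q))"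
              using * ab unfolding inv a_def[symmetric] b_def[symmetric] by (simp add: field_simps)
            then have "C2 * (\<Lambda> * (U (2 * s) powr (- 1 / q) * V (2 * s) powr \<mu>)) \<le> C2 * (\<Lambda> * (Cr * \<nu> ^ j * (V r powr \<mu> * U r powr (- 1 / q))))"
              using C2 \<Lambda> by (intro mult_left_mono) auto
            then show "C2 * (\<Lambda> * (U (2 * s) powr (- 1 / q) * V (2 * s) powr \<mu>)) \<le> \<nu> ^ j * H"
              by (simp add: H_def mult_ac)
          qed
          finally show ?thesis by (simp add: s_def)
        qed
        have "(\<Sum>j. piece g2 x (2 ^ j * r) + piece g2 x (r / 2 ^ j)) \<le> (\<Sum>j. ennreal (\<nu> ^ j * H))"
          unfolding small using large by (intro suminf_le summableI) auto
        also have "\<dots> = ennreal (\<Sum>j. \<nu> ^ j * H)"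
          using \<nu> H by (intro suminf_ennreal2) (auto intro!: summable_mult2 summable_geometric)
        also have "(\<Sum>j. \<nu> ^ j * H) = 1 / (1 - \<nu>) * H"
          using \<nu> suminf_mult2[of "\<lambda>j. \<nu> ^ j" H] by (simp add: suminf_geometric summable_geometric)
        finally have "(\<Sum>j. piece g2 x (2 ^ j * r) + piece g2 x (r / 2 ^ j)) \<le> ennreal (1 / (1 - \<nu>) * H)" .
        then have "T g2 x \<le> ennreal (2 powr (DIM('a) - \<alpha>) * A) * ennreal (1 / (1 - \<nu>) * H)"
          using r by (intro order_trans[OF T_le_pieces[OF _ r]] mult_left_mono) auto
        also have "\<dots> = ennreal (2 powr (DIM('a) - \<alpha>) * A * (1 / (1 - \<nu>) * H))"
          using A_pos \<nu> H by (subst ennreal_mult) auto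
        also have "2 powr (DIM('a) - \<alpha>) * A * (1 / (1 - \<nu>) * H) = Y * \<Lambda> * V r powr \<mu> * U r powr (- 1 / q)"
          by (simp add: Y_def H_def mult_ac)
        finally show ?thesis .
      qed
      have far_int: "(\<integral>\<^sup>+x\<in>ball z r. epow (T g2 x) q * ennreal (u1 x) \<partial>lborel)
          \<le> ennreal (Y powr q * \<Lambda> powr q * V r powr (\<kappa> * q / p))"
      proof -
        \<comment> \<open>The bound on the far part is constant on B. Integrating its q-th power for
          u1 multiplies by U r, which cancels the q-th power of U r powr (- 1/q).\<close>
        define X where "X = Y * \<Lambda> * V r powr \<mu> * U r powr (- 1 / q)"
        have X: "0 \<le> X" using Y \<Lambda> by (simp add: X_def)
        have "(\<integral>\<^sup>+x\<in>ball z r. epow (T g2 x) q * ennreal (u1 x) \<partial>lborel)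
          \<le> (\<integral>\<^sup>+x. ennreal (X powr q) * (ennreal (u1 x) * indicator (ball z r) x) \<partial>lborel)"
        proof (intro nn_integral_mono)
          fix x
          show "epow (T g2 x) q * ennreal (u1 x) * indicator (ball z r) x
            \<le> ennreal (X powr q) * (ennreal (u1 x) * indicator (ball z r) x)"
          proof (cases "x \<in> ball z r")
            case True
            have "epow (T g2 x) q \<le> epow (ennreal X) q"
              using far[OF True] q(1) unfolding X_def by (intro epow_mono) auto
            then show ?thesis
              using X True by (simp add: epow_ennreal mult_right_mono)
          qed simp
        qed
        also have "\<dots> = ennreal (X powr q) * ennreal (U r)"
          using M1.emeasure_ball_eq[of z r]
          by (subst nn_integral_cmult) (auto simp: emeasure_wmeasure U_def)
        also have "\<dots> = ennreal (X powr q * U r)"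
          using U[OF r] by (simp add: ennreal_mult less_imp_le)
        also have "X powr q * U r = Y powr q * \<Lambda> powr q * V r powr (\<kappa> * q / p)"
        proof -
          have "(U r powr (- 1 / q)) powr q * U r = 1"
          proof -
            have "- 1 / q * q = - 1" using q(1) by simp
            then have "(U r powr (- 1 / q)) powr q = U r powr - 1" by (metis powr_powr)
            then show ?thesis using U[OF r] by (simp add: powr_minus)
          qed
          moreover have "(V r powr \<mu>) powr q = V r powr (\<kappa> * q / p)"
            by (simp add: powr_powr \<mu>_def)
          moreover have "X powr q = Y powr q * \<Lambda> powr q * (V r powr \<mu>) powr q * (U r powr (- 1 / q)) powr q"
            using Y \<Lambda> by (simp add: X_def powr_mult)
          ultimately show ?thesis by (simp add: mult.assoc)
        qed
        finally show ?thesis .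
      qed
      have "(\<integral>\<^sup>+x\<in>ball z r. epow (ennreal (exp (t * \<beta> x)) * T g x) q * ennreal (u x) \<partial>lborel)
        \<le> (\<integral>\<^sup>+x. ennreal (2 powr q) * (epow (T g1 x) q * ennreal (u1 x) + epow (T g2 x) q * ennreal (u1 x) * indicator (ball z r) x) \<partial>lborel)"
      proof (intro nn_integral_mono)
        fix x
        have "exp (t * \<beta> x) powr q = exp (t * q * \<beta> x)"
          by (simp add: powr_def mult_ac)
        then have "epow (ennreal (exp (t * \<beta> x)) * T g x) q * ennreal (u x) = epow (T g x) q * ennreal (u1 x)"
          using q(1) u_pos[of x] by (simp add: epow_mult epow_ennreal u1_def ennreal_mult less_imp_le mult_ac)
        also have "\<dots> \<le> ennreal (2 powr q) * (epow (T g1 x) q + epow (T g2 x) q) * ennreal (u1 x)"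
          unfolding split by (intro mult_right_mono epow_sum_le q(1)) simp
        finally show "epow (ennreal (exp (t * \<beta> x)) * T g x) q * ennreal (u x) * indicator (ball z r) x
          \<le> ennreal (2 powr q) * (epow (T g1 x) q * ennreal (u1 x) + epow (T g2 x) q * ennreal (u1 x) * indicator (ball z r) x)"
          by (cases "x \<in> ball z r") (auto simp: distrib_right mult.assoc)
      qed
      also have "\<dots> = ennreal (2 powr q) * ((\<integral>\<^sup>+x. epow (T g1 x) q * ennreal (u1 x) \<partial>lborel)
          + (\<integral>\<^sup>+x\<in>ball z r. epow (T g2 x) q * ennreal (u1 x) \<partial>lborel))"
      proof -
        have "(\<integral>\<^sup>+x. epow (T g1 x) q * ennreal (u1 x) + epow (T g2 x) q * ennreal (u1 x) * indicator (ball z r) x \<partial>lborel)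
          = (\<integral>\<^sup>+x. epow (T g1 x) q * ennreal (u1 x) \<partial>lborel) + (\<integral>\<^sup>+x\<in>ball z r. epow (T g2 x) q * ennreal (u1 x) \<partial>lborel)"
          by (rule nn_integral_add) measurable
        then show ?thesis by (subst nn_integral_cmult) auto
      qed
      also have "\<dots> \<le> ennreal (2 powr q) * (ennreal (C1 * G powr (\<kappa> * q / p) * \<Lambda> powr q * V r powr (\<kappa> * q / p))
          + ennreal (Y powr q * \<Lambda> powr q * V r powr (\<kappa> * q / p)))"
        by (intro mult_left_mono add_mono near far_int) simp
      also have "\<dots> = ennreal (2 powr q * (C1 * G powr (\<kappa> * q / p) * \<Lambda> powr q * V r powr (\<kappa> * q / p)
          + Y powr q * \<Lambda> powr q * V r powr (\<kappa> * q / p)))"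
        using C1 by (simp flip: ennreal_plus ennreal_mult)
      also have "2 powr q * (C1 * G powr (\<kappa> * q / p) * \<Lambda> powr q * V r powr (\<kappa> * q / p)
          + Y powr q * \<Lambda> powr q * V r powr (\<kappa> * q / p)) = C * \<Lambda> powr q * V r powr (\<kappa> * q / p)"
        by (simp add: C_def algebra_simps)
      finally show ?thesis unfolding g_def V_def .
    qed
    ultimately show ?thesis by blast
  qed
  with \<epsilon> show thesis using that by blast
qed

end

section \<open>Borel representatives\<close>

lemma completion_ex_borel_measurable_complex:
  fixes f :: "'a \<Rightarrow> complex"
  assumes [measurable]: "f \<in> borel_measurable (completion M)"
  obtains g where "g \<in> borel_measurable M" "AE x in M. f x = g x"
proof -
  obtain g1 where g1: "g1 \<in> borel_measurable M" "AE x in M. Re (f x) = g1 x"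
    using completion_ex_borel_measurable_real[of "\<lambda>x. Re (f x)" M] by auto
  obtain g2 where g2: "g2 \<in> borel_measurable M" "AE x in M. Im (f x) = g2 x"
    using completion_ex_borel_measurable_real[of "\<lambda>x. Im (f x)" M] by auto
  show thesis
  proof (rule that[of "\<lambda>x. Complex (g1 x) (g2 x)"])
    have [measurable]: "g1 \<in> borel_measurable M" "g2 \<in> borel_measurable M" by fact+
    show "(\<lambda>x. Complex (g1 x) (g2 x)) \<in> borel_measurable M"
      unfolding Complex_eq by measurable
    show "AE x in M. f x = Complex (g1 x) (g2 x)"
      using g1(2) g2(2) by eventually_elim (simp add: complex_eq_iff)
  qed
qed

text \<open>The function is the pointwise limit of its truncations to closed balls of radius n, each
  of them integrable.\<close>

lemma locally_integrable_measurable: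
  fixes f :: "'a::euclidean_space \<Rightarrow> 'b::{banach, second_countable_topology}"
  assumes "locally_integrable f"
  shows "f \<in> borel_measurable lebesgue"
proof (rule borel_measurable_LIMSEQ_metric)
  show "(\<lambda>x. indicator (cball 0 (real n)) x *\<^sub>R f x) \<in> borel_measurable lebesgue" for n
    using assms unfolding locally_integrable_def set_integrable_def
    by (intro borel_measurable_integrable) simp
  show "(\<lambda>n. indicator (cball 0 (real n)) x *\<^sub>R f x) \<longlonglongrightarrow> f x" for x
  proof (rule tendsto_eventually)
    obtain N where "norm x \<le> real N" using real_arch_simple by blast
    then show "\<forall>\<^sub>F n in sequentially. indicator (cball 0 (real n)) x *\<^sub>R f x = f x"
      by (intro eventually_sequentiallyI[of N]) (auto simp: indicator_def)
  qed
qed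

lemma lebesgue_integral_borel_version:
  fixes f g :: "'a::euclidean_space \<Rightarrow> complex"
  assumes [measurable]: "g \<in> borel_measurable borel" and ae: "AE x in lborel. f x = g x"
  shows "integrable lebesgue f \<longleftrightarrow> integrable lborel g" "integral\<^sup>L lebesgue f = integral\<^sup>L lborel g"
proof -
  have g: "g \<in> borel_measurable lebesgue" by (simp add: measurable_completion)
  have ae': "AE x in lebesgue. f x = g x" using ae by (rule AE_completion)
  then have "AE x in lebesgue. g x = f x" by eventually_elim simp
  then have f: "f \<in> borel_measurable lebesgue" by (rule borel_measurable_AE[OF g])
  show "integrable lebesgue f \<longleftrightarrow> integrable lborel g"
    using integrable_cong_AE[OF f g ae'] by (simp add: integrable_completion)
  show "integral\<^sup>L lebesgue f = integral\<^sup>L lborel g"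
    using integral_cong_AE[OF f g ae'] by (simp add: integral_completion)
qed

lemma AE_lborel_scale:
  fixes P :: "'a::euclidean_space \<Rightarrow> bool"
  assumes c: "c \<noteq> 0" and "AE y in lborel. P y"
  shows "AE y in lborel. P (c *\<^sub>R y)"
proof -
  have "AE y in density (distr lborel borel (\<lambda>x. 0 + c *\<^sub>R x)) (\<lambda>_. ennreal (\<bar>c\<bar> ^ DIM('a))). P y"
    by (subst lborel_affine[OF c, of "0::'a", symmetric]) (rule assms(2))
  then have "AE y in distr lborel borel (\<lambda>x. 0 + c *\<^sub>R x). 0 < ennreal (\<bar>c\<bar> ^ DIM('a)) \<longrightarrow> P y"
    by (subst (asm) AE_density) auto
  then have "AE y in distr lborel borel (\<lambda>x. 0 + c *\<^sub>R x). P y"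
    using c by simp
  then have "AE y in lborel. P (0 + c *\<^sub>R y)"
    by (rule AE_distrD[rotated]) simp
  then show ?thesis by simp
qed

lemma nn_integral_lborel_scale:
  fixes f :: "'a::euclidean_space \<Rightarrow> ennreal"
  assumes c: "0 < c" and [measurable]: "f \<in> borel_measurable borel"
  shows "(\<integral>\<^sup>+y. f y \<partial>lborel) = ennreal (c ^ DIM('a)) * (\<integral>\<^sup>+y. f (c *\<^sub>R y) \<partial>lborel)"
proof -
  have "(\<integral>\<^sup>+y. f y \<partial>lborel) = (\<integral>\<^sup>+y. f y \<partial>density (distr lborel borel (\<lambda>x. 0 + c *\<^sub>R x)) (\<lambda>_. ennreal (\<bar>c\<bar> ^ DIM('a))))"
    using c lborel_affine[of c "0::'a"] by simp
  also have "\<dots> = (\<integral>\<^sup>+y. ennreal (\<bar>c\<bar> ^ DIM('a)) * f y \<partial>distr lborel borel (\<lambda>x. 0 + c *\<^sub>R x))"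
    by (rule nn_integral_density) measurable
  also have "\<dots> = (\<integral>\<^sup>+y. ennreal (\<bar>c\<bar> ^ DIM('a)) * f (0 + c *\<^sub>R y) \<partial>lborel)"
    by (rule nn_integral_distr) measurable
  finally show ?thesis using c by (simp add: nn_integral_cmult)
qed

lemma AE_if_AE_all_balls:
  assumes "\<And>n::nat. AE x in lborel. x \<in> ball (0::'a::euclidean_space) (real n) \<longrightarrow> P x"
  shows "AE x in lborel. P x"
proof -
  have "AE x in lborel. \<forall>n::nat. x \<in> ball 0 (real n) \<longrightarrow> P x"
    using assms unfolding AE_all_countable by blast
  then show ?thesis
  proof eventually_elim
    fix x :: 'a assume *: "\<forall>n::nat. x \<in> ball 0 (real n) \<longrightarrow> P x"
    obtain n where "norm x < real n" using reals_Archimedean2 by blast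
    with * show "P x" by auto
  qed
qed

text \<open>Finiteness of the integral of the negative power forces w > 0 a.e., so w agrees a.e.
  with a Borel function \<open>w0\<close> that is positive everywhere. The weight w^q is locally
  integrable because its dual has positive mass while the product of the two averages is bounded.
  Raising that product to the power Q = q/r gives the Muckenhoupt form.\<close>

lemma A_class_muckenhoupt:
  fixes w :: "'a::euclidean_space \<Rightarrow> real"
  assumes w: "weight w" and A: "(\<lambda>x. w x powr r) \<in> A_class (p / r) (q / r)"
    and r: "1 \<le> r" "r < p" and q: "0 < q"
  obtains w0 K where "w0 \<in> borel_measurable borel" "\<And>x. 0 < w0 x" "AE x in lborel. w x = w0 x"
    "muckenhoupt (\<lambda>x. w0 x powr q) (q / r * (p / r - 1) / (p / r)) K"
proof -
  define P Q P' where "P = p / r" and "Q = q / r" and "P' = P / (P - 1)"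
  define c where "c = q / r * (p / r - 1) / (p / r)"
  have P: "1 < P" and Q: "0 < Q" using r q by (simp_all add: P_def Q_def)
  have P': "0 < P'" using P by (simp add: P'_def)
  have c: "0 < c" "c = Q / P'" using P Q by (simp_all add: c_def P'_def flip: P_def Q_def)
  obtain C where C: "0 < C" and
    AC: "\<And>z R. 0 < R \<Longrightarrow> (\<integral>\<^sup>+x\<in>ball z R. inverse (ennreal ((w x powr r) powr P')) \<partial>lebesgue) < \<infinity>"
    "\<And>z R. 0 < R \<Longrightarrow>
      epow ((\<integral>\<^sup>+x\<in>ball z R. ennreal ((w x powr r) powr Q) \<partial>lebesgue) / emeasure lebesgue (ball z R)) (1 / Q) *
      epow ((\<integral>\<^sup>+x\<in>ball z R. inverse (ennreal ((w x powr r) powr P')) \<partial>lebesgue) / emeasure lebesgue (ball z R)) (1 / P') \<le> ennreal C"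
    using A unfolding A_class_def Let_def P'_def P_def Q_def by blast
  have wm: "w \<in> borel_measurable lebesgue" using w by (auto simp: weight_def intro: locally_integrable_measurable)
  obtain w' where w'm[measurable]: "w' \<in> borel_measurable borel" and w': "AE x in lborel. w x = w' x"
    using completion_ex_borel_measurable_real[OF wm] by auto
  \<comment> \<open>The value 1 fills the null set on which the Borel version of w fails to be
    positive, so that no negative power of the weight meets 0.\<close>
  define w0 where "w0 x = (if 0 < w' x then w' x else 1)" for x
  have w0m[measurable]: "w0 \<in> borel_measurable borel" unfolding w0_def by measurable
  have w0_pos: "0 < w0 x" for x by (simp add: w0_def)
  have "AE x in lborel. w x \<noteq> 0"
  proof (rule AE_if_AE_all_balls)
    fix n :: nat
    show "AE x in lborel. x \<in> ball 0 (real n) \<longrightarrow> w x \<noteq> 0"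
    proof (cases "n = 0")
      case False
      define h where "h x = inverse (ennreal ((w' x powr r) powr P')) * indicator (ball 0 (real n)) x" for x :: 'a
      have [measurable]: "h \<in> borel_measurable borel" unfolding h_def by measurable
      have "(\<integral>\<^sup>+x. h x \<partial>lborel) = (\<integral>\<^sup>+x\<in>ball 0 (real n). inverse (ennreal ((w x powr r) powr P')) \<partial>lborel)"
        unfolding h_def by (rule nn_integral_cong_AE) (use w' in eventually_elim, simp)
      also have "\<dots> < \<infinity>" using AC(1)[of "real n" 0] False by (simp add: nn_integral_completion)
      finally have "AE x in lborel. h x \<noteq> \<infinity>"
        by (intro nn_integral_noteq_infinite) auto
      with w' show ?thesis
        by eventually_elim (use r in \<open>auto simp: h_def\<close>)
    qed simp
  qed
  with w' have ww0: "AE x in lborel. w x = w0 x"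
  proof eventually_elim
    fix x assume "w x = w' x" "w x \<noteq> 0"
    moreover have "0 \<le> w x" using w by (simp add: weight_def)
    ultimately show "w x = w0 x" by (simp add: w0_def)
  qed
  define u where "u x = w0 x powr q" for x
  have um[measurable]: "u \<in> borel_measurable borel" unfolding u_def by measurable
  have u_pos: "0 < u x" for x using w0_pos[of x] by (simp add: u_def)
  define s where "s x = u x powr (- 1 / c)" for x
  have sm[measurable]: "s \<in> borel_measurable borel" unfolding s_def by measurable
  have s_pos: "0 < s x" for x using u_pos[of x] by (simp add: s_def)
  have I: "(\<integral>\<^sup>+x\<in>ball z R. ennreal ((w x powr r) powr Q) \<partial>lebesgue) = emeasure (wmeasure u) (ball z R)" for z R
  proof -
    have "(w0 x powr r) powr Q = u x" for x using r by (simp add: powr_powr Q_def u_def)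
    then have "(\<integral>\<^sup>+x\<in>ball z R. ennreal ((w x powr r) powr Q) \<partial>lborel) = (\<integral>\<^sup>+x\<in>ball z R. ennreal (u x) \<partial>lborel)"
      by (intro nn_integral_cong_AE) (use ww0 in eventually_elim, simp)
    then show ?thesis by (simp add: nn_integral_completion emeasure_wmeasure)
  qed
  have J: "(\<integral>\<^sup>+x\<in>ball z R. inverse (ennreal ((w x powr r) powr P')) \<partial>lebesgue) = emeasure (wmeasure s) (ball z R)" for z R
  proof -
    have "inverse (ennreal ((w0 x powr r) powr P')) = ennreal (s x)" for x
    proof -
      have "s x = w0 x powr (q * (- 1 / c))" by (simp add: s_def u_def powr_powr)
      also have "q * (- 1 / c) = - (r * P')" unfolding c(2) using Q P' r q by (simp add: Q_def)
      finally have "s x = inverse ((w0 x powr r) powr P')" by (simp add: powr_powr powr_minus)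
      then show ?thesis using w0_pos[of x] by (simp add: inverse_ennreal)
    qed
    then have "(\<integral>\<^sup>+x\<in>ball z R. inverse (ennreal ((w x powr r) powr P')) \<partial>lborel) = (\<integral>\<^sup>+x\<in>ball z R. ennreal (s x) \<partial>lborel)"
      by (intro nn_integral_cong_AE) (use ww0 in eventually_elim, simp)
    then show ?thesis by (simp add: nn_integral_completion emeasure_wmeasure)
  qed
  have fin: "emeasure (wmeasure u) (ball z R) < top" "emeasure (wmeasure s) (ball z R) < top"
    and bnd: "ball_mass u z R * ball_mass s z R powr c
      \<le> C powr Q * measure lborel (ball z R) powr (1 + c)" if R: "0 < R" for z R
  proof -
    define B where "B = measure lborel (ball z R)"
    have B: "0 < B" "emeasure lebesgue (ball z R) = ennreal B"
      using measure_lborel_ball_pos[OF R] emeasure_lborel_ball[of z R] by (auto simp: B_def)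
    have pos: "0 < emeasure (wmeasure u) (ball z R)" "0 < emeasure (wmeasure s) (ball z R)"
      using B emeasure_lborel_ball[of z R]
      by (auto intro!: emeasure_wmeasure_pos u_pos s_pos simp: B_def)
    show f2: "emeasure (wmeasure s) (ball z R) < top" using AC(1)[OF R] J by simp
    have main: "epow (emeasure (wmeasure u) (ball z R) / ennreal B) (1 / Q) * epow (emeasure (wmeasure s) (ball z R) / ennreal B) (1 / P') \<le> ennreal C"
      using AC(2)[OF R, of z] unfolding I J B(2) .
    show f1: "emeasure (wmeasure u) (ball z R) < top"
    proof (rule ccontr)
      assume "\<not> emeasure (wmeasure u) (ball z R) < top"
      then have "emeasure (wmeasure u) (ball z R) = top" using top.not_eq_extremum by blast
      then have "epow (emeasure (wmeasure u) (ball z R) / ennreal B) (1 / Q) = top"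
        by (simp add: ennreal_top_divide)
      moreover have "epow (emeasure (wmeasure s) (ball z R) / ennreal B) (1 / P') \<noteq> 0"
        using pos(2) by (simp add: ennreal_divide_eq_0_iff)
      ultimately show False using main by (simp add: ennreal_top_mult top_unique)
    qed
    define V S where "V = ball_mass u z R" and "S = ball_mass s z R"
    have VS: "emeasure (wmeasure u) (ball z R) = ennreal V" "emeasure (wmeasure s) (ball z R) = ennreal S"
      unfolding V_def S_def using f1 f2 by (auto intro!: emeasure_eq_ennreal_measure)
    have VS0: "0 \<le> V" "0 \<le> S" by (simp_all add: V_def S_def)
    have "ennreal ((V / B) powr (1 / Q) * (S / B) powr (1 / P')) \<le> ennreal C"
      using main VS0 B(1) unfolding VS by (simp add: divide_ennreal epow_ennreal ennreal_mult)
    then have "(V / B) powr (1 / Q) * (S / B) powr (1 / P') \<le> C"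
      using C by (subst (asm) ennreal_le_iff) auto
    then have "((V / B) powr (1 / Q) * (S / B) powr (1 / P')) powr Q \<le> C powr Q"
      using Q by (intro powr_mono2) auto
    also have "((V / B) powr (1 / Q) * (S / B) powr (1 / P')) powr Q = (V / B) * (S / B) powr c"
      using Q VS0 B(1) by (simp add: powr_mult powr_powr c(2))
    finally have "(V / B) * (S / B) powr c \<le> C powr Q" .
    then have "V * S powr c / (B * B powr c) \<le> C powr Q"
      using VS0 B(1) by (simp add: powr_divide)
    then have "V * S powr c \<le> C powr Q * (B * B powr c)"
      using B(1) by (simp add: pos_divide_le_eq)
    then show "V * S powr c \<le> C powr Q * B powr (1 + c)"
      using B(1) by (simp add: powr_add)
  qed
  have "muckenhoupt u c (C powr Q)"
  proof
    show "u \<in> borel_measurable borel" "0 < u x" "0 < c" "0 < C powr Q" for x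
      using u_pos c C by auto
    show "emeasure (wmeasure u) (ball z R) < top" for z R
      by (cases "0 < R") (use fin in \<open>auto simp: not_less ball_empty\<close>)
    show "emeasure (wmeasure (\<lambda>x. u x powr (- 1 / c))) (ball z R) < top" for z R
      by (cases "0 < R") (use fin(2) in \<open>auto simp: not_less ball_empty s_def[abs_def]\<close>)
    show "ball_mass u z R * ball_mass (\<lambda>x. u x powr (- 1 / c)) z R powr c
      \<le> C powr Q * measure lborel (ball z R) powr (1 + c)" if "0 < R" for z R
      using bnd[OF that, of z] unfolding s_def[abs_def] .
  qed
  then have "muckenhoupt (\<lambda>x. w0 x powr q) (q / r * (p / r - 1) / (p / r)) (C powr Q)"
    unfolding u_def[abs_def] c_def .
  then show thesis
    by (rule that[OF w0m w0_pos ww0])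
qed

text \<open>The mean value of b serves as the constant, and passing to real or imaginary parts does
  not increase the modulus. The summand 1 in D keeps it positive when the seminorm of b is
  0.\<close>

lemma BMO_osc_le:
  fixes b b0 :: "'a::euclidean_space \<Rightarrow> complex"
  assumes b: "b \<in> BMO" and ae: "AE x in lborel. b x = b0 x"
  obtains D where "0 < D" "\<And>z r. 0 < r \<Longrightarrow> \<exists>m. osc_le (\<lambda>x. Re (b0 x)) D m z r"
    "\<And>z r. 0 < r \<Longrightarrow> \<exists>m. osc_le (\<lambda>x. Im (b0 x)) D m z r"
proof -
  obtain M where M: "bmo_norm b = ennreal M" "0 \<le> M"
    using b unfolding BMO_def by (cases "bmo_norm b") auto
  define D where "D = (M + 1) * unit_ball_vol (DIM('a))"
  have D: "0 < D" using M by (simp add: D_def add_nonneg_pos)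
  have osc: "(\<integral>\<^sup>+x\<in>ball z r. ennreal (norm (b0 x - ball_average b z r)) \<partial>lborel) \<le> ennreal (D * r ^ DIM('a))"
    if r: "0 < r" for z r
  proof -
    define B where "B = measure lborel (ball z r)"
    have B: "0 < B" "emeasure lebesgue (ball z r) = ennreal B"
      using measure_lborel_ball_pos[OF r] emeasure_lborel_ball[of z r] by (auto simp: B_def)
    define I where "I = (\<integral>\<^sup>+x\<in>ball z r. ennreal (norm (b x - ball_average b z r)) \<partial>lebesgue)"
    have "I / ennreal B \<le> ennreal M"
      unfolding M(1)[symmetric] bmo_norm_def I_def B(2)[symmetric]
      using r by (intro SUP_upper2[of "(z, r)"]) auto
    then have "I / ennreal B * ennreal B \<le> ennreal M * ennreal B"
      by (rule mult_right_mono) simp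
    moreover have "I / ennreal B * ennreal B = I"
      using B(1) mult_divide_eq_ennreal[of "ennreal B" I] by (simp add: ennreal_divide_times ennreal_times_divide)
    ultimately have "I \<le> ennreal (M * B)" using M(2) B(1) by (simp add: ennreal_mult)
    also have "\<dots> \<le> ennreal (D * r ^ DIM('a))"
      using r M(2) by (intro ennreal_leI) (simp add: B_def D_def measure_lborel_ball)
    also have "I = (\<integral>\<^sup>+x\<in>ball z r. ennreal (norm (b0 x - ball_average b z r)) \<partial>lborel)"
      unfolding I_def nn_integral_completion
      by (intro nn_integral_cong_AE) (use ae in eventually_elim, simp)
    finally show ?thesis .
  qed
  show thesis
  proof (rule that[OF D])
    fix z :: 'a and r :: real assume r: "0 < r"
    have "osc_le (\<lambda>x. Re (b0 x)) D (Re (ball_average b z r)) z r"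
      unfolding osc_le_def
    proof (rule order_trans[OF _ osc[OF r, of z]], intro nn_integral_mono mult_right_mono ennreal_leI)
      show "\<bar>Re (b0 x) - Re (ball_average b z r)\<bar> \<le> norm (b0 x - ball_average b z r)" for x
        using abs_Re_le_cmod[of "b0 x - ball_average b z r"] by simp
    qed simp
    then show "\<exists>m. osc_le (\<lambda>x. Re (b0 x)) D m z r" ..
    have "osc_le (\<lambda>x. Im (b0 x)) D (Im (ball_average b z r)) z r"
      unfolding osc_le_def
    proof (rule order_trans[OF _ osc[OF r, of z]], intro nn_integral_mono mult_right_mono ennreal_leI)
      show "\<bar>Im (b0 x) - Im (ball_average b z r)\<bar> \<le> norm (b0 x - ball_average b z r)" for x
        using abs_Im_le_cmod[of "b0 x - ball_average b z r"] by simp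
    qed simp
    then show "\<exists>m. osc_le (\<lambda>x. Im (b0 x)) D m z r" ..
  qed
qed

text \<open>By definition of the sphere measure a null set is one whose cone in the unit ball is
  null. Rescaling by 1/n does not alter y / |y| and carries the statement to balls of every
  radius.\<close>

lemma AE_sphere_measureD:
  fixes P :: "'a::euclidean_space \<Rightarrow> bool"
  assumes "AE x in sphere_measure. P x"
  shows "AE y in lborel. P (y /\<^sub>R norm y)"
proof -
  let ?U = "uniform_measure lborel (ball (0::'a) 1)"
  have [measurable]: "sphere (0::'a) 1 \<in> sets borel" by (simp add: borel_closed)
  have m: "(\<lambda>x. x /\<^sub>R norm x) \<in> ?U \<rightarrow>\<^sub>M borel" by measurable
  have "AE x in restrict_space (distr ?U borel (\<lambda>x. x /\<^sub>R norm x)) (sphere 0 1). P x"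
    using assms unfolding sphere_measure_def AE_completion_iff .
  then have "AE x in distr ?U borel (\<lambda>x. x /\<^sub>R norm x). x \<in> sphere 0 1 \<longrightarrow> P x"
    by (subst (asm) AE_restrict_space_iff) auto
  then have "AE x in ?U. x /\<^sub>R norm x \<in> sphere 0 1 \<longrightarrow> P (x /\<^sub>R norm x)"
    by (rule AE_distrD[OF m])
  then have *: "AE x in lborel. 0 < indicator (ball 0 1) x / emeasure lborel (ball (0::'a) 1) \<longrightarrow>
      x /\<^sub>R norm x \<in> sphere 0 1 \<longrightarrow> P (x /\<^sub>R norm x)"
    unfolding uniform_measure_def by (subst (asm) AE_density) auto
  have fin: "emeasure lborel (ball (0::'a) 1) \<noteq> top" using emeasure_lborel_ball_finite[of "0::'a" 1] by simp
  have 1: "AE x in lborel. x \<in> ball 0 1 \<longrightarrow> x \<noteq> 0 \<longrightarrow> P (x /\<^sub>R norm x)"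
    using * by eventually_elim (use fin in \<open>auto simp: ennreal_divide_eq_0_iff zero_less_iff_neq_zero\<close>)
  have "AE x in lborel. x \<noteq> 0 \<longrightarrow> P (x /\<^sub>R norm x)"
  proof (rule AE_if_AE_all_balls)
    fix n :: nat
    show "AE x in lborel. x \<in> ball 0 (real n) \<longrightarrow> x \<noteq> 0 \<longrightarrow> P (x /\<^sub>R norm x)"
    proof (cases "n = 0")
      case False
      have "AE x in lborel. inverse (real n) *\<^sub>R x \<in> ball 0 1 \<longrightarrow> inverse (real n) *\<^sub>R x \<noteq> 0 \<longrightarrow>
          P ((inverse (real n) *\<^sub>R x) /\<^sub>R norm (inverse (real n) *\<^sub>R x))"
        using False by (intro AE_lborel_scale[OF _ 1]) simp
      then show ?thesis
        by eventually_elim (use False in \<open>auto simp: field_simps\<close>)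
    qed simp
  qed
  moreover have "AE x in lborel. x \<noteq> (0::'a)" by (rule AE_lborel_singleton)
  ultimately show ?thesis by eventually_elim simp
qed

text \<open>In place of polar coordinates the integral is pulled back along y / |y|, the measure
  being an image of the uniform distribution on the ball. The origin, whose image is off the sphere,
  is a null set.\<close>

lemma nn_integral_sphere_measure:
  fixes g :: "'a::euclidean_space \<Rightarrow> ennreal"
  assumes [measurable]: "g \<in> borel_measurable borel"
  shows "(\<integral>\<^sup>+x. g x \<partial>sphere_measure)
    = (\<integral>\<^sup>+y\<in>ball 0 1. g (y /\<^sub>R norm y) \<partial>lborel) / emeasure lborel (ball (0::'a) 1)"
proof -
  let ?U = "uniform_measure lborel (ball (0::'a) 1)"
  have [measurable]: "sphere (0::'a) 1 \<in> sets borel" by (simp add: borel_closed)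
  have m: "(\<lambda>x. x /\<^sub>R norm x) \<in> ?U \<rightarrow>\<^sub>M borel" by measurable
  have "(\<integral>\<^sup>+x. g x \<partial>sphere_measure) = (\<integral>\<^sup>+x\<in>sphere 0 1. g x \<partial>distr ?U borel (\<lambda>x. x /\<^sub>R norm x))"
    unfolding sphere_measure_def nn_integral_completion by (subst nn_integral_restrict_space) auto
  also have "\<dots> = (\<integral>\<^sup>+y. g (y /\<^sub>R norm y) * indicator (sphere 0 1) (y /\<^sub>R norm y) \<partial>?U)"
    by (rule nn_integral_distr[OF m]) measurable
  also have "\<dots> = (\<integral>\<^sup>+y. g (y /\<^sub>R norm y) * indicator (sphere 0 1) (y /\<^sub>R norm y) * indicator (ball 0 1) y \<partial>lborel)
      / emeasure lborel (ball (0::'a) 1)"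
    by (subst nn_integral_uniform_measure) auto
  also have "(\<integral>\<^sup>+y. g (y /\<^sub>R norm y) * indicator (sphere 0 1) (y /\<^sub>R norm y) * indicator (ball 0 1) y \<partial>lborel)
     = (\<integral>\<^sup>+y\<in>ball 0 1. g (y /\<^sub>R norm y) \<partial>lborel)"
  proof (rule nn_integral_cong_AE)
    have "AE y in lborel. y \<noteq> (0::'a)" by (rule AE_lborel_singleton)
    then show "AE y in lborel. g (y /\<^sub>R norm y) * indicator (sphere 0 1) (y /\<^sub>R norm y) * indicator (ball 0 1) y
      = g (y /\<^sub>R norm y) * indicator (ball 0 1) y"
      by eventually_elim simp
  qed
  finally show ?thesis .
qed

text \<open>Hoelder's inequality with exponents s and s' on the ball of radius R. By homogeneity the
  integral of |\<Omega>0|^s over that ball is R^n times the one over the unit ball, which is finite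
  because \<Omega> is in L^s of the sphere. For s = \<infinity> the essential bound is used directly
  and \<rho> = 1.\<close>

lemma rough_kernel_of_Lp_space:
  fixes \<Omega> :: "'a::euclidean_space \<Rightarrow> complex" and \<alpha> :: real
  assumes s: "1 < s" and \<Omega>: "\<Omega> \<in> Lp_space s sphere_measure" and \<alpha>: "0 < \<alpha>" "\<alpha> < DIM('a)"
  obtains \<Omega>0 A where "\<Omega>0 \<in> borel_measurable borel" "AE y in lborel. \<Omega> (y /\<^sub>R norm y) = \<Omega>0 y"
    "rough_kernel (\<lambda>y. norm (\<Omega>0 y)) \<alpha> (conj_exponent s) A"
proof -
  let ?M = "restrict_space (distr (uniform_measure lborel (ball (0::'a) 1)) borel (\<lambda>x. x /\<^sub>R norm x)) (sphere 0 1)"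
  have \<Omega>m: "\<Omega> \<in> borel_measurable (completion ?M)"
    using \<Omega> by (simp add: Lp_space_def sphere_measure_def)
  obtain g where g: "g \<in> borel_measurable ?M" "AE x in ?M. \<Omega> x = g x"
    using completion_ex_borel_measurable_complex[OF \<Omega>m] by blast
  \<comment> \<open>Extension by 0 off the sphere makes the representative Borel on the whole
    space.\<close>
  define G where "G x = indicator (sphere 0 1) x *\<^sub>R g x" for x
  have [measurable]: "G \<in> borel_measurable borel"
    using g(1) unfolding G_def by (subst (asm) borel_measurable_restrict_space_iff) auto
  have "AE x in ?M. \<Omega> x = G x"
    using g(2) AE_space[of ?M] by eventually_elim (simp add: G_def space_restrict_space)
  then have \<Omega>G: "AE x in sphere_measure. \<Omega> x = G x"
    unfolding sphere_measure_def by (rule AE_completion)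
  define \<Omega>0 where "\<Omega>0 y = G (y /\<^sub>R norm y)" for y
  have \<Omega>0m[measurable]: "\<Omega>0 \<in> borel_measurable borel" unfolding \<Omega>0_def by measurable
  have ae: "AE y in lborel. \<Omega> (y /\<^sub>R norm y) = \<Omega>0 y"
    unfolding \<Omega>0_def by (rule AE_sphere_measureD[OF \<Omega>G])
  \<comment> \<open>\<open>\<Omega>0\<close> is a function of y / |y|, so it is homogeneous
    everywhere and not merely a.e.; at the origin both sides are its value at 0.\<close>
  have hom: "\<Omega>0 (R *\<^sub>R y) = \<Omega>0 y" if "0 < R" for R y
  proof (cases "y = 0")
    case False
    then have "inverse (R * norm y) * R = inverse (norm y)" using that by (simp add: field_simps)
    then have "(R *\<^sub>R y) /\<^sub>R norm (R *\<^sub>R y) = y /\<^sub>R norm y" using that by simp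
    then show ?thesis by (simp only: \<Omega>0_def)
  qed simp
  define \<rho> where "\<rho> = conj_exponent s"
  have "\<exists>A. rough_kernel (\<lambda>y. norm (\<Omega>0 y)) \<alpha> \<rho> A"
  proof (cases "s = \<infinity>")
    case True
    then obtain B where "AE x in sphere_measure. norm (\<Omega> x) \<le> B"
      using \<Omega> by (auto simp: Lp_space_def)
    then have "AE x in sphere_measure. norm (G x) \<le> B"
      using \<Omega>G by eventually_elim simp
    then have B: "AE y in lborel. norm (\<Omega>0 y) \<le> B"
      unfolding \<Omega>0_def by (rule AE_sphere_measureD)
    define A where "A = max B 1"
    have \<rho>: "\<rho> = 1" using True by (simp add: \<rho>_def conj_exponent_def)
    have "rough_kernel (\<lambda>y. norm (\<Omega>0 y)) \<alpha> \<rho> A"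
    proof
      show "0 < A" "1 \<le> \<rho>" by (auto simp: A_def \<rho>)
      fix R :: real and h :: "'a \<Rightarrow> ennreal"
      assume R: "0 < R" and [measurable]: "h \<in> borel_measurable borel"
      have "(\<integral>\<^sup>+y\<in>ball 0 R. ennreal (norm (\<Omega>0 y)) * h y \<partial>lborel) \<le> (\<integral>\<^sup>+y. ennreal A * (h y * indicator (ball 0 R) y) \<partial>lborel)"
      proof (rule nn_integral_mono_AE)
        show "AE y in lborel. ennreal (norm (\<Omega>0 y)) * h y * indicator (ball 0 R) y \<le> ennreal A * (h y * indicator (ball 0 R) y)"
          using B
        proof eventually_elim
          fix y assume "norm (\<Omega>0 y) \<le> B"
          then have "ennreal (norm (\<Omega>0 y)) \<le> ennreal A" by (intro ennreal_leI) (simp add: A_def)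
          then show "ennreal (norm (\<Omega>0 y)) * h y * indicator (ball 0 R) y \<le> ennreal A * (h y * indicator (ball 0 R) y)"
            by (simp add: mult.assoc mult_right_mono)
        qed
      qed
      also have "\<dots> = ennreal A * (\<integral>\<^sup>+y\<in>ball 0 R. h y \<partial>lborel)"
        by (rule nn_integral_cmult) measurable
      finally show "(\<integral>\<^sup>+y\<in>ball 0 R. ennreal (norm (\<Omega>0 y)) * h y \<partial>lborel)
        \<le> ennreal (A * R powr (DIM('a) * (1 - 1 / \<rho>))) * epow (\<integral>\<^sup>+y\<in>ball 0 R. epow (h y) \<rho> \<partial>lborel) (1 / \<rho>)"
        using R by (simp add: \<rho>)
    qed (use \<alpha> in auto)
    then show ?thesis ..
  next
    case False
    define t where "t = enn2real s"
    have st: "s = ennreal t" "1 < t"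
    proof -
      show "s = ennreal t" using False by (simp add: t_def less_top)
      then show "1 < t" using s by (metis ennreal_1 ennreal_less_iff zero_le_one)
    qed
    have \<rho>: "\<rho> = t / (t - 1)" "1 < \<rho>" "1 - 1 / t = 1 / \<rho>" "0 < \<rho>"
      using False st(2) by (auto simp: \<rho>_def conj_exponent_def t_def[symmetric] field_simps)
    have "(\<integral>\<^sup>+x. ennreal (norm (\<Omega> x) powr t) \<partial>sphere_measure) < \<infinity>"
      using \<Omega> False by (simp add: Lp_space_def t_def)
    moreover have "(\<integral>\<^sup>+x. ennreal (norm (\<Omega> x) powr t) \<partial>sphere_measure) = (\<integral>\<^sup>+x. ennreal (norm (G x) powr t) \<partial>sphere_measure)"
      by (rule nn_integral_cong_AE) (use \<Omega>G in eventually_elim, simp)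
    ultimately have "(\<integral>\<^sup>+y\<in>ball 0 1. ennreal (norm (\<Omega>0 y) powr t) \<partial>lborel) / emeasure lborel (ball (0::'a) 1) < \<infinity>"
      by (simp add: nn_integral_sphere_measure \<Omega>0_def)
    then have "(\<integral>\<^sup>+y\<in>ball 0 1. ennreal (norm (\<Omega>0 y) powr t) \<partial>lborel) < top"
      using emeasure_lborel_ball[of "0::'a" 1] measure_lborel_ball_pos[of 1 "0::'a"]
      by (auto simp: ennreal_divide_eq_top_iff less_top[symmetric] top.not_eq_extremum[symmetric])
    then obtain B where B: "(\<integral>\<^sup>+y\<in>ball 0 1. ennreal (norm (\<Omega>0 y) powr t) \<partial>lborel) = ennreal B" "0 \<le> B"
      by (cases "(\<integral>\<^sup>+y\<in>ball 0 1. ennreal (norm (\<Omega>0 y) powr t) \<partial>lborel)") auto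
    \<comment> \<open>B^(1/t) is the norm of \<Omega>0 over the unit ball; adding 1 keeps A positive
      when \<Omega> vanishes a.e.\<close>
    define A where "A = B powr (1 / t) + 1"
    have "rough_kernel (\<lambda>y. norm (\<Omega>0 y)) \<alpha> \<rho> A"
    proof
      show "0 < A" "1 \<le> \<rho>" using \<rho>(2) by (auto simp: A_def add_nonneg_pos)
      fix R :: real and h :: "'a \<Rightarrow> ennreal"
      assume R: "0 < R" and [measurable]: "h \<in> borel_measurable borel"
      have ball: "(\<integral>\<^sup>+y\<in>ball 0 R. ennreal (norm (\<Omega>0 y) powr t) \<partial>lborel) = ennreal (R ^ DIM('a) * B)"
      proof -
        have "(\<integral>\<^sup>+y\<in>ball 0 R. ennreal (norm (\<Omega>0 y) powr t) \<partial>lborel)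
          = ennreal (R ^ DIM('a)) * (\<integral>\<^sup>+y. ennreal (norm (\<Omega>0 (R *\<^sub>R y)) powr t) * indicator (ball 0 R) (R *\<^sub>R y) \<partial>lborel)"
          by (rule nn_integral_lborel_scale[OF R]) measurable
        also have "(\<integral>\<^sup>+y. ennreal (norm (\<Omega>0 (R *\<^sub>R y)) powr t) * indicator (ball 0 R) (R *\<^sub>R y) \<partial>lborel)
          = (\<integral>\<^sup>+y\<in>ball 0 1. ennreal (norm (\<Omega>0 y) powr t) \<partial>lborel)"
          using R by (intro nn_integral_cong) (auto simp: hom indicator_def)
        finally show ?thesis using B R by (simp add: ennreal_mult)
      qed
      have "(\<integral>\<^sup>+y\<in>ball 0 R. ennreal (norm (\<Omega>0 y)) * h y \<partial>lborel)
         = (\<integral>\<^sup>+y. epow (ennreal (norm (\<Omega>0 y) powr t) * indicator (ball 0 R) y) (1 / t)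
             * epow (epow (h y) \<rho> * indicator (ball 0 R) y) (1 - 1 / t) \<partial>lborel)"
      proof (rule nn_integral_cong)
        fix y
        have "epow (ennreal (norm (\<Omega>0 y) powr t)) (1 / t) = ennreal (norm (\<Omega>0 y))"
          using st(2) by (simp add: epow_ennreal powr_powr)
        moreover have "epow (epow (h y) \<rho>) (1 - 1 / t) = h y"
          unfolding \<rho>(3) by (rule epow_epow_inverse[OF \<rho>(4)])
        ultimately show "ennreal (norm (\<Omega>0 y)) * h y * indicator (ball 0 R) y = epow (ennreal (norm (\<Omega>0 y) powr t) * indicator (ball 0 R) y) (1 / t)
             * epow (epow (h y) \<rho> * indicator (ball 0 R) y) (1 - 1 / t)"
          by (cases "y \<in> ball 0 R") simp_all
      qed
      also have "\<dots> \<le> epow (\<integral>\<^sup>+y\<in>ball 0 R. ennreal (norm (\<Omega>0 y) powr t) \<partial>lborel) (1 / t)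
          * epow (\<integral>\<^sup>+y\<in>ball 0 R. epow (h y) \<rho> \<partial>lborel) (1 - 1 / t)"
        using st(2) by (intro Holder_nn_integral; (measurable | simp))
      also have "epow (\<integral>\<^sup>+y\<in>ball 0 R. ennreal (norm (\<Omega>0 y) powr t) \<partial>lborel) (1 / t) \<le> ennreal (A * R powr (DIM('a) * (1 - 1 / \<rho>)))"
      proof -
        have "1 - 1 / \<rho> = 1 / t" using \<rho>(3) by linarith
        moreover have "(R ^ DIM('a) * B) powr (1 / t) = R powr (DIM('a) * (1 / t)) * B powr (1 / t)"
          using R B(2) by (simp add: powr_mult powr_powr flip: powr_realpow)
        moreover have "R powr (DIM('a) * (1 / t)) * B powr (1 / t) \<le> A * R powr (DIM('a) * (1 / t))"
          by (simp add: A_def algebra_simps)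
        ultimately show ?thesis
          unfolding ball using R B(2) by (simp add: epow_ennreal ennreal_leI)
      qed
      finally show "(\<integral>\<^sup>+y\<in>ball 0 R. ennreal (norm (\<Omega>0 y)) * h y \<partial>lborel)
        \<le> ennreal (A * R powr (DIM('a) * (1 - 1 / \<rho>))) * epow (\<integral>\<^sup>+y\<in>ball 0 R. epow (h y) \<rho> \<partial>lborel) (1 / \<rho>)"
        unfolding \<rho>(3) by (simp add: mult_right_mono)
    qed (use \<alpha> in auto)
    then show ?thesis ..
  qed
  then show thesis using that \<Omega>0m ae unfolding \<rho>_def by blast
qed

section \<open>The commutator\<close>

text \<open>Since t |s| \<le> exp (t |s|), and exp (t |s|) is one of exp (t s) and exp (- t s), each
  coordinate of d costs two exponentials.\<close>

lemma norm_le_sum_exp: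
  fixes d :: complex
  assumes t: "0 < t"
  shows "norm d \<le> (1 / t) * (exp (t * Re d) + exp (- t * Re d) + exp (t * Im d) + exp (- t * Im d))"
proof -
  have *: "t * \<bar>s\<bar> \<le> exp (t * s) + exp (- t * s)" for s
  proof -
    have "t * \<bar>s\<bar> \<le> exp (t * \<bar>s\<bar>)" using exp_ge_add_one_self[of "t * \<bar>s\<bar>"] by linarith
    also have "\<dots> \<le> exp (t * s) + exp (- t * s)" by (cases "0 \<le> s") simp_all
    finally show ?thesis .
  qed
  have "t * norm d \<le> t * (\<bar>Re d\<bar> + \<bar>Im d\<bar>)" using t cmod_le by (intro mult_left_mono) auto
  also have "\<dots> \<le> exp (t * Re d) + exp (- t * Re d) + exp (t * Im d) + exp (- t * Im d)"
    using *[of "Re d"] *[of "Im d"] by (simp add: distrib_left)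
  finally show ?thesis using t by (simp add: field_simps)
qed

text \<open>A positive weight cannot hide an infinite value of h: on a set of positive measure it
  would make the integral over some ball infinite. This turns norm bounds into pointwise convergence
  of the integrals that define the operators.\<close>

lemma AE_finite_if_weighted_norm_finite:
  fixes h :: "'a::euclidean_space \<Rightarrow> ennreal"
  assumes [measurable]: "h \<in> borel_measurable borel" "u \<in> borel_measurable borel"
    and u: "\<And>x. 0 < u x"
    and fin: "\<And>r. 0 < r \<Longrightarrow> (\<integral>\<^sup>+x\<in>ball 0 r. epow (h x) q * ennreal (u x) \<partial>lborel) < top"
  shows "AE x in lborel. h x < top"
proof (rule AE_if_AE_all_balls)
  fix n :: nat
  show "AE x in lborel. x \<in> ball 0 (real n) \<longrightarrow> h x < top"
  proof (cases "n = 0")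
    case False
    then have "AE x in lborel. epow (h x) q * ennreal (u x) * indicator (ball 0 (real n)) x \<noteq> \<infinity>"
      using fin[of "real n"] by (intro nn_integral_noteq_infinite) auto
    then show ?thesis
    proof eventually_elim
      fix x assume *: "epow (h x) q * ennreal (u x) * indicator (ball 0 (real n)) x \<noteq> \<infinity>"
      show "x \<in> ball 0 (real n) \<longrightarrow> h x < top"
      proof (intro impI, rule ccontr)
        assume "x \<in> ball 0 (real n)" "\<not> h x < top"
        then have "h x = top" using top.not_eq_extremum by blast
        with * \<open>x \<in> ball 0 (real n)\<close> show False
          using u[of x] by (simp add: ennreal_top_mult)
      qed
    qed
  qed simp
qed

text \<open>Cancellation between the two terms of the commutator enters only through the difference
  of b: the integral \<open>G\<close> of absolute values dominates the commutator, and four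
  conjugated operators with Morrey bounds of the same form dominate \<open>G\<close>. The assertions
  on integrability follow from finiteness a.e. of \<open>G\<close> and of
  \<open>T F\<close>.\<close>

theorem theorem1p3:
  fixes \<Omega> b :: "real ^ 'n \<Rightarrow> complex" and w :: "real ^ 'n \<Rightarrow> real"
    and s :: ennreal and \<alpha> p q \<kappa> s' :: real
  assumes "CARD('n) \<ge> 2"
    and "1 < s" and "s' = conj_exponent s"
    and "\<Omega> \<in> Lp_space s sphere_measure" and "homogeneous_deg0 \<Omega>"
    and "b \<in> BMO"
    and "0 < \<alpha>" and "\<alpha> < real CARD('n)"
    and "1 \<le> s'" and "s' < p" and "p < real CARD('n) / \<alpha>"
    and "1 / q = 1 / p - \<alpha> / real CARD('n)"
    and "0 < \<kappa>" and "\<kappa> < p / q"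
    and "weight w"
    and "(\<lambda>x. w x powr s') \<in> A_class (p / s') (q / s')"
  shows "\<exists>C>0. \<forall>f \<in> morrey2 p \<kappa> (\<lambda>x. w x powr p) (\<lambda>x. w x powr q).
     (AE x in lebesgue.
        integrable lebesgue (rough_integrand \<Omega> \<alpha> f x) \<and>
        integrable lebesgue (rough_integrand \<Omega> \<alpha> (\<lambda>y. b y * f y) x) \<and>
        integrable lebesgue (commutator_integrand \<Omega> \<alpha> b f x) \<and>
        commutator b (rough_frac_int \<Omega> \<alpha>) f x
          = (LINT y|lebesgue. commutator_integrand \<Omega> \<alpha> b f x y)) \<and>
     commutator b (rough_frac_int \<Omega> \<alpha>) f \<in> morrey q (\<kappa> * q / p) (\<lambda>x. w x powr q) \<and>
     morrey_norm q (\<kappa> * q / p) (\<lambda>x. w x powr q) (commutator b (rough_frac_int \<Omega> \<alpha>) f)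
       \<le> ennreal C * morrey_norm2 p \<kappa> (\<lambda>x. w x powr p) (\<lambda>x. w x powr q) f"
proof -
  have p: "0 < p" using assms(9,10) by simp
  have q: "0 < q"
  proof -
    have "\<alpha> / real CARD('n) < 1 / p" using assms(7,11) p by (simp add: field_simps)
    then have "0 < 1 / q" using assms(12) by simp
    then show ?thesis by simp
  qed

  \<comment> \<open>Borel data and the weight condition\<close>
  obtain w0 K where w0[measurable]: "w0 \<in> borel_measurable borel" and w0_pos: "\<And>x. 0 < w0 x"
    and ww0: "AE x in lborel. w x = w0 x"
    and Mu: "muckenhoupt (\<lambda>x. w0 x powr q) (q / s' * (p / s' - 1) / (p / s')) K"
    using A_class_muckenhoupt[OF assms(15,16,9,10) q] by blast
  obtain \<Omega>0 A where \<Omega>0[measurable]: "\<Omega>0 \<in> borel_measurable borel" and \<Omega>\<Omega>0: "AE y in lborel. \<Omega> (y /\<^sub>R norm y) = \<Omega>0 y"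
    and RK: "rough_kernel (\<lambda>y. norm (\<Omega>0 y)) \<alpha> s' A"
    using rough_kernel_of_Lp_space[OF assms(2,4,7)] assms(3,8) by auto
  have bm: "b \<in> borel_measurable lebesgue"
    using assms(6) by (auto simp: BMO_def intro: locally_integrable_measurable)
  obtain b0 where b0[measurable]: "b0 \<in> borel_measurable borel" and bb0: "AE x in lborel. b x = b0 x"
    using completion_ex_borel_measurable_complex[OF bm] by auto
  obtain D where D: "0 < D" "\<And>z r. 0 < r \<Longrightarrow> \<exists>m. osc_le (\<lambda>x. Re (b0 x)) D m z r"
    "\<And>z r. 0 < r \<Longrightarrow> \<exists>m. osc_le (\<lambda>x. Im (b0 x)) D m z r"
    using BMO_osc_le[OF assms(6) bb0] by blast
  define u where "u x = w0 x powr q" for x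
  have u_pos: "0 < u x" for x using w0_pos[of x] by (simp add: u_def)
  have um[measurable]: "u \<in> borel_measurable borel" unfolding u_def by measurable
  define c where "c = q / s' * (p / s' - 1) / (p / s')"
  interpret rough_kernel "\<lambda>y. norm (\<Omega>0 y)" \<alpha> s' A by (rule RK)
  interpret muckenhoupt u c K using Mu unfolding u_def[abs_def] c_def .
  interpret KR: rough_muckenhoupt "\<lambda>y. norm (\<Omega>0 y)" \<alpha> s' A u c K p q "\<lambda>x. Re (b0 x)" D
    by unfold_locales (use assms(10,12) q D in \<open>auto simp: c_def\<close>)
  interpret KI: rough_muckenhoupt "\<lambda>y. norm (\<Omega>0 y)" \<alpha> s' A u c K p q "\<lambda>x. Im (b0 x)" D
    by unfold_locales (use assms(10,12) q D in \<open>auto simp: c_def\<close>)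
  define V where "V z r = ball_mass u z r" for z r

  \<comment> \<open>Morrey bounds for the conjugated operators\<close>
  define hyp where "hyp F \<Lambda> \<longleftrightarrow> F \<in> borel_measurable borel \<and> 0 \<le> \<Lambda> \<and>
    (\<forall>z r. 0 < r \<longrightarrow> (\<integral>\<^sup>+x\<in>ball z r. epow (F x) p * ennreal (u x powr (p / q)) \<partial>lborel)
        \<le> ennreal (\<Lambda> powr p * V z r powr \<kappa>))" for F :: "real^'n \<Rightarrow> ennreal" and \<Lambda> :: real
  define E where "E \<beta> t F x = ennreal (exp (t * \<beta> x)) * T (\<lambda>y. ennreal (exp (- t * \<beta> y)) * F y) x"
    for \<beta> :: "real^'n \<Rightarrow> real" and t F x
  define bounded_by where "bounded_by C h \<Lambda> \<longleftrightarrow> (\<forall>z r. 0 < r \<longrightarrow> (\<integral>\<^sup>+x\<in>ball z r. epow (h x) q * ennreal (u x) \<partial>lborel)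
        \<le> ennreal (C * \<Lambda> powr q * V z r powr (\<kappa> * q / p)))" for C h \<Lambda>
  obtain \<epsilon>R where \<epsilon>R: "0 < \<epsilon>R" "\<And>t. \<bar>t\<bar> \<le> \<epsilon>R \<Longrightarrow> \<exists>C>0. \<forall>F \<Lambda>. hyp F \<Lambda> \<longrightarrow> bounded_by C (E (\<lambda>x. Re (b0 x)) t F) \<Lambda>"
  proof (rule KR.Morrey_estimate[OF assms(13,14)], goal_cases)
    case (1 \<epsilon>)
    show ?case
    proof (rule that[OF 1(2)])
      fix t :: real assume "\<bar>t\<bar> \<le> \<epsilon>"
      from 1(3)[OF this] show "\<exists>C>0. \<forall>F \<Lambda>. hyp F \<Lambda> \<longrightarrow> bounded_by C (E (\<lambda>x. Re (b0 x)) t F) \<Lambda>"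
        unfolding hyp_def bounded_by_def E_def V_def
        by - (elim exE conjE, intro exI conjI, assumption, intro allI impI, elim conjE,
            drule (1) bspec, drule spec, drule (1) mp, drule (1) mp, blast)
    qed
  qed
  obtain \<epsilon>I where \<epsilon>I: "0 < \<epsilon>I" "\<And>t. \<bar>t\<bar> \<le> \<epsilon>I \<Longrightarrow> \<exists>C>0. \<forall>F \<Lambda>. hyp F \<Lambda> \<longrightarrow> bounded_by C (E (\<lambda>x. Im (b0 x)) t F) \<Lambda>"
  proof (rule KI.Morrey_estimate[OF assms(13,14)], goal_cases)
    case (1 \<epsilon>)
    show ?case
    proof (rule that[OF 1(2)])
      fix t :: real assume "\<bar>t\<bar> \<le> \<epsilon>"
      from 1(3)[OF this] show "\<exists>C>0. \<forall>F \<Lambda>. hyp F \<Lambda> \<longrightarrow> bounded_by C (E (\<lambda>x. Im (b0 x)) t F) \<Lambda>"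
        unfolding hyp_def bounded_by_def E_def V_def
        by - (elim exE conjE, intro exI conjI, assumption, intro allI impI, elim conjE,
            drule (1) bspec, drule spec, drule (1) mp, drule (1) mp, blast)
    qed
  qed
  define t where "t = min \<epsilon>R \<epsilon>I"
  have t: "0 < t" "\<bar>t\<bar> \<le> \<epsilon>R" "\<bar>- t\<bar> \<le> \<epsilon>R" "\<bar>t\<bar> \<le> \<epsilon>I" "\<bar>- t\<bar> \<le> \<epsilon>I" "\<bar>0\<bar> \<le> \<epsilon>R"
    using \<epsilon>R(1) \<epsilon>I(1) by (auto simp: t_def)
  \<comment> \<open>At parameter 0 the conjugated operator is T itself. This bound serves to show
    that T |f| is finite a.e., which allows the two terms of the commutator to be separated.\<close>
  obtain C0 where C0: "\<And>F \<Lambda>. hyp F \<Lambda> \<Longrightarrow> bounded_by C0 (E (\<lambda>x. Re (b0 x)) 0 F) \<Lambda>"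
    using \<epsilon>R(2)[OF t(6)] by blast
  obtain C1 where C1: "0 < C1" "\<And>F \<Lambda>. hyp F \<Lambda> \<Longrightarrow> bounded_by C1 (E (\<lambda>x. Re (b0 x)) t F) \<Lambda>"
    using \<epsilon>R(2)[OF t(2)] by blast
  obtain C2 where C2: "0 < C2" "\<And>F \<Lambda>. hyp F \<Lambda> \<Longrightarrow> bounded_by C2 (E (\<lambda>x. Re (b0 x)) (- t) F) \<Lambda>"
    using \<epsilon>R(2)[OF t(3)] by blast
  obtain C3 where C3: "0 < C3" "\<And>F \<Lambda>. hyp F \<Lambda> \<Longrightarrow> bounded_by C3 (E (\<lambda>x. Im (b0 x)) t F) \<Lambda>"
    using \<epsilon>I(2)[OF t(4)] by blast
  obtain C4 where C4: "0 < C4" "\<And>F \<Lambda>. hyp F \<Lambda> \<Longrightarrow> bounded_by C4 (E (\<lambda>x. Im (b0 x)) (- t) F) \<Lambda>"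
    using \<epsilon>I(2)[OF t(5)] by blast
  have E_measurable[measurable]: "E \<beta> t F \<in> borel_measurable borel"
    if [measurable]: "\<beta> \<in> borel_measurable borel" "F \<in> borel_measurable borel" for \<beta> t F
    unfolding E_def by measurable
  \<comment> \<open>The factor 1/t comes from the bound of |d| by exponentials; the two factors 2
    powr q come from adding the four terms in pairs by \<open>bounded_add\<close>.\<close>
  define C where "C = (1 / t) powr q * (2 powr q * (2 powr q * (C1 + C2 + (C3 + C4))))"
  have C: "0 < C" using C1(1) C2(1) C3(1) C4(1) t(1) by (simp add: C_def)
  have bounded_add: "bounded_by (2 powr q * (k1 + k2)) (\<lambda>x. h1 x + h2 x) \<Lambda>"
    if "bounded_by k1 h1 \<Lambda>" "bounded_by k2 h2 \<Lambda>" "0 \<le> k1" "0 \<le> k2"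
      and [measurable]: "h1 \<in> borel_measurable borel" "h2 \<in> borel_measurable borel" for k1 k2 h1 h2 \<Lambda>
    unfolding bounded_by_def
  proof (intro allI impI)
    fix z :: "real^'n" and r :: real assume r: "0 < r"
    have "(\<integral>\<^sup>+x\<in>ball z r. epow (h1 x + h2 x) q * ennreal (u x) \<partial>lborel)
      \<le> (\<integral>\<^sup>+x. ennreal (2 powr q) * (epow (h1 x) q * ennreal (u x) * indicator (ball z r) x
         + epow (h2 x) q * ennreal (u x) * indicator (ball z r) x) \<partial>lborel)"
    proof (rule nn_integral_mono)
      fix x
      have "epow (h1 x + h2 x) q * (ennreal (u x) * indicator (ball z r) x)
        \<le> ennreal (2 powr q) * (epow (h1 x) q + epow (h2 x) q) * (ennreal (u x) * indicator (ball z r) x)"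
        by (intro mult_right_mono epow_sum_le q) simp
      then show "epow (h1 x + h2 x) q * ennreal (u x) * indicator (ball z r) x
        \<le> ennreal (2 powr q) * (epow (h1 x) q * ennreal (u x) * indicator (ball z r) x
         + epow (h2 x) q * ennreal (u x) * indicator (ball z r) x)"
        by (simp add: distrib_right mult.assoc)
    qed
    also have "\<dots> = ennreal (2 powr q) * ((\<integral>\<^sup>+x\<in>ball z r. epow (h1 x) q * ennreal (u x) \<partial>lborel)
        + (\<integral>\<^sup>+x\<in>ball z r. epow (h2 x) q * ennreal (u x) \<partial>lborel))"
    proof -
      have "(\<integral>\<^sup>+x. epow (h1 x) q * ennreal (u x) * indicator (ball z r) x
         + epow (h2 x) q * ennreal (u x) * indicator (ball z r) x \<partial>lborel) =
         (\<integral>\<^sup>+x\<in>ball z r. epow (h1 x) q * ennreal (u x) \<partial>lborel) + (\<integral>\<^sup>+x\<in>ball z r. epow (h2 x) q * ennreal (u x) \<partial>lborel)"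
        by (rule nn_integral_add) measurable
      then show ?thesis by (subst nn_integral_cmult) auto
    qed
    also have "\<dots> \<le> ennreal (2 powr q) * (ennreal (k1 * \<Lambda> powr q * V z r powr (\<kappa> * q / p)) + ennreal (k2 * \<Lambda> powr q * V z r powr (\<kappa> * q / p)))"
      using that(1,2) r unfolding bounded_by_def by (intro mult_left_mono add_mono) auto
    also have "\<dots> = ennreal (2 powr q * (k1 * \<Lambda> powr q * V z r powr (\<kappa> * q / p) + k2 * \<Lambda> powr q * V z r powr (\<kappa> * q / p)))"
      using that(3,4) by (simp flip: ennreal_plus ennreal_mult)
    also have "2 powr q * (k1 * \<Lambda> powr q * V z r powr (\<kappa> * q / p) + k2 * \<Lambda> powr q * V z r powr (\<kappa> * q / p))
        = 2 powr q * (k1 + k2) * \<Lambda> powr q * V z r powr (\<kappa> * q / p)"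
      by (simp add: algebra_simps)
    finally show "(\<integral>\<^sup>+x\<in>ball z r. epow (h1 x + h2 x) q * ennreal (u x) \<partial>lborel)
      \<le> ennreal (2 powr q * (k1 + k2) * \<Lambda> powr q * V z r powr (\<kappa> * q / p))" .
  qed
  have V_eq: "(\<integral>\<^sup>+x\<in>ball z r. ennreal (w x powr q) \<partial>lebesgue) = ennreal (V z r)" for z r
  proof -
    have "(\<integral>\<^sup>+x\<in>ball z r. ennreal (w x powr q) \<partial>lborel) = (\<integral>\<^sup>+x\<in>ball z r. ennreal (u x) \<partial>lborel)"
      by (intro nn_integral_cong_AE) (use ww0 in eventually_elim, simp add: u_def)
    then show ?thesis
      using emeasure_ball_eq[of z r] by (simp add: nn_integral_completion emeasure_wmeasure V_def)
  qed
  have V_pos: "0 < V z r" if "0 < r" for z r unfolding V_def by (rule ball_pos[OF that])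
  define k where "k y = \<Omega>0 y / of_real (norm y powr (real CARD('n) - \<alpha>))" for y
  have [measurable]: "k \<in> borel_measurable borel" unfolding k_def by measurable
  have k_norm: "ennreal (norm (\<Omega>0 y) / norm y powr (DIM(real^'n) - \<alpha>)) = ennreal (norm (k y))" for y
    by (simp add: k_def norm_divide)
  show ?thesis
  proof (intro exI[of _ "C powr (1 / q)"] conjI ballI)
    show "0 < C powr (1 / q)" using C by simp
    fix f assume f: "f \<in> morrey2 p \<kappa> (\<lambda>x. w x powr p) (\<lambda>x. w x powr q)"
    have fm: "f \<in> borel_measurable lebesgue"
      using f by (simp add: morrey2_def Lp_loc_def)
    obtain f0 where f0[measurable]: "f0 \<in> borel_measurable borel" and ff0: "AE x in lborel. f x = f0 x"
      using completion_ex_borel_measurable_complex[OF fm] by auto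
    define F where "F x = ennreal (norm (f0 x))" for x
    have [measurable]: "F \<in> borel_measurable borel" unfolding F_def by measurable
    obtain \<Lambda> where \<Lambda>: "morrey_norm2 p \<kappa> (\<lambda>x. w x powr p) (\<lambda>x. w x powr q) f = ennreal \<Lambda>" "0 \<le> \<Lambda>"
      using f by (cases "morrey_norm2 p \<kappa> (\<lambda>x. w x powr p) (\<lambda>x. w x powr q) f") (auto simp: morrey2_def)
    have hyp: "hyp F \<Lambda>"
      unfolding hyp_def
    proof (intro conjI allI impI)
      fix z :: "real^'n" and r :: real assume r: "0 < r"
      define X where "X = (\<integral>\<^sup>+x\<in>ball z r. ennreal (norm (f x) powr p * w x powr p) \<partial>lebesgue)"
      have "epow (X / epow (ennreal (V z r)) \<kappa>) (1 / p) \<le> ennreal \<Lambda>"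
        unfolding \<Lambda>(1)[symmetric] morrey_norm2_def X_def V_eq[symmetric]
        using r by (intro SUP_upper2[of "(z, r)"]) auto
      then have "X / epow (ennreal (V z r)) \<kappa> \<le> epow (ennreal \<Lambda>) p"
        using p by (subst (asm) epow_le_iff_le_epow) auto
      then have "X / ennreal (V z r powr \<kappa>) \<le> ennreal (\<Lambda> powr p)"
        using \<Lambda>(2) V_pos[OF r, of z] by (simp add: epow_ennreal)
      then have "X / ennreal (V z r powr \<kappa>) * ennreal (V z r powr \<kappa>) \<le> ennreal (\<Lambda> powr p) * ennreal (V z r powr \<kappa>)"
        by (rule mult_right_mono) simp
      moreover have "X / ennreal (V z r powr \<kappa>) * ennreal (V z r powr \<kappa>) = X"
        using V_pos[OF r, of z] mult_divide_eq_ennreal[of "ennreal (V z r powr \<kappa>)" X]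
        by (simp add: ennreal_divide_times ennreal_times_divide)
      ultimately have "X \<le> ennreal (\<Lambda> powr p * V z r powr \<kappa>)" by (simp add: ennreal_mult)
      moreover have "X = (\<integral>\<^sup>+x\<in>ball z r. epow (F x) p * ennreal (u x powr (p / q)) \<partial>lborel)"
        unfolding X_def nn_integral_completion
      proof (rule nn_integral_cong_AE)
        show "AE x in lborel. ennreal (norm (f x) powr p * w x powr p) * indicator (ball z r) x
          = epow (F x) p * ennreal (u x powr (p / q)) * indicator (ball z r) x"
          using ff0 ww0
          by eventually_elim (use q in \<open>simp add: F_def epow_ennreal u_def powr_powr ennreal_mult\<close>)
      qed
      ultimately show "(\<integral>\<^sup>+x\<in>ball z r. epow (F x) p * ennreal (u x powr (p / q)) \<partial>lborel) \<le> ennreal (\<Lambda> powr p * V z r powr \<kappa>)"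
        by simp
    qed (use \<Lambda> in auto)

    \<comment> \<open>The absolute commutator integral and its majorants\<close>
    define G where "G x = (\<integral>\<^sup>+y. ennreal (norm (k (x - y))) * (ennreal (norm (b0 x - b0 y)) * F y) \<partial>lborel)" for x
    have [measurable]: "G \<in> borel_measurable borel" unfolding G_def by measurable
    define E1 E2 E3 E4 where "E1 = E (\<lambda>x. Re (b0 x)) t F" and "E2 = E (\<lambda>x. Re (b0 x)) (- t) F"
      and "E3 = E (\<lambda>x. Im (b0 x)) t F" and "E4 = E (\<lambda>x. Im (b0 x)) (- t) F"
    have [measurable]: "E1 \<in> borel_measurable borel" "E2 \<in> borel_measurable borel"
      "E3 \<in> borel_measurable borel" "E4 \<in> borel_measurable borel"
      unfolding E1_def E2_def E3_def E4_def by measurable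
    have G_le: "G x \<le> ennreal (1 / t) * (E1 x + E2 x + (E3 x + E4 x))" for x
    proof -
      \<comment> \<open>Reflection expresses the operator in the variables of the commutator kernel;
        the factor exp (\<tau> \<beta> x) then moves under the integral and merges with exp (-
        \<tau> \<beta> y).\<close>
      have E_eq: "E \<beta> \<tau> F x = (\<integral>\<^sup>+y. ennreal (norm (k (x - y))) * (ennreal (exp (\<tau> * (\<beta> x - \<beta> y))) * F y) \<partial>lborel)"
        if [measurable]: "\<beta> \<in> borel_measurable borel" for \<beta> \<tau>
      proof -
        have "E \<beta> \<tau> F x = ennreal (exp (\<tau> * \<beta> x)) * (\<integral>\<^sup>+y. ennreal (norm (k (x - y))) * (ennreal (exp (- \<tau> * \<beta> y)) * F y) \<partial>lborel)"
          unfolding E_def by (subst T_reflect) (measurable, simp add: k_norm[simplified])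
        also have "\<dots> = (\<integral>\<^sup>+y. ennreal (exp (\<tau> * \<beta> x)) * (ennreal (norm (k (x - y))) * (ennreal (exp (- \<tau> * \<beta> y)) * F y)) \<partial>lborel)"
          by (rule nn_integral_cmult[symmetric]) measurable
        also have "\<dots> = (\<integral>\<^sup>+y. ennreal (norm (k (x - y))) * (ennreal (exp (\<tau> * (\<beta> x - \<beta> y))) * F y) \<partial>lborel)"
        proof (rule nn_integral_cong)
          fix y
          have "ennreal (exp (\<tau> * (\<beta> x - \<beta> y))) = ennreal (exp (\<tau> * \<beta> x)) * ennreal (exp (- \<tau> * \<beta> y))"
            by (simp add: right_diff_distrib exp_diff exp_minus divide_inverse flip: ennreal_mult)
          then show "ennreal (exp (\<tau> * \<beta> x)) * (ennreal (norm (k (x - y))) * (ennreal (exp (- \<tau> * \<beta> y)) * F y))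
            = ennreal (norm (k (x - y))) * (ennreal (exp (\<tau> * (\<beta> x - \<beta> y))) * F y)"
            by (simp only: mult_ac)
        qed
        finally show ?thesis .
      qed
      define J where "J g = (\<integral>\<^sup>+y. ennreal (norm (k (x - y))) * (ennreal (g y) * F y) \<partial>lborel)" for g :: "real^'n \<Rightarrow> real"
      have J_add: "J g1 + J g2 = J (\<lambda>y. g1 y + g2 y)"
        if [measurable]: "g1 \<in> borel_measurable borel" "g2 \<in> borel_measurable borel" and "\<And>y. 0 \<le> g1 y" "\<And>y. 0 \<le> g2 y" for g1 g2
      proof -
        have "J (\<lambda>y. g1 y + g2 y) = (\<integral>\<^sup>+y. ennreal (norm (k (x - y))) * (ennreal (g1 y) * F y) + ennreal (norm (k (x - y))) * (ennreal (g2 y) * F y) \<partial>lborel)"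
          unfolding J_def using that(3,4) by (intro nn_integral_cong) (simp add: ennreal_plus distrib_left distrib_right)
        also have "\<dots> = J g1 + J g2" unfolding J_def by (rule nn_integral_add) measurable
        finally show ?thesis by simp
      qed
      define e1 e2 e3 e4 where "e1 y = exp (t * (Re (b0 x) - Re (b0 y)))" and "e2 y = exp (- t * (Re (b0 x) - Re (b0 y)))"
        and "e3 y = exp (t * (Im (b0 x) - Im (b0 y)))" and "e4 y = exp (- t * (Im (b0 x) - Im (b0 y)))" for y
      have em[measurable]: "e1 \<in> borel_measurable borel" "e2 \<in> borel_measurable borel" "e3 \<in> borel_measurable borel" "e4 \<in> borel_measurable borel"
        unfolding e1_def e2_def e3_def e4_def by measurable
      have enn: "0 \<le> e1 y" "0 \<le> e2 y" "0 \<le> e3 y" "0 \<le> e4 y" for y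
        by (simp_all add: e1_def e2_def e3_def e4_def)
      have EJ: "E1 x = J e1" "E2 x = J e2" "E3 x = J e3" "E4 x = J e4"
        unfolding E1_def E2_def E3_def E4_def J_def e1_def e2_def e3_def e4_def by (rule E_eq; measurable)+
      have "J e1 + J e2 = J (\<lambda>y. e1 y + e2 y)" "J e3 + J e4 = J (\<lambda>y. e3 y + e4 y)"
        using J_add[OF em(1,2)] J_add[OF em(3,4)] enn by blast+
      moreover have "J (\<lambda>y. e1 y + e2 y) + J (\<lambda>y. e3 y + e4 y) = J (\<lambda>y. e1 y + e2 y + (e3 y + e4 y))"
        by (intro J_add add_nonneg_nonneg borel_measurable_add em enn)
      ultimately have sum: "E1 x + E2 x + (E3 x + E4 x) = J (\<lambda>y. e1 y + e2 y + (e3 y + e4 y))"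
        unfolding EJ by simp
      have "G x \<le> (\<integral>\<^sup>+y. ennreal (1 / t) * (ennreal (norm (k (x - y))) * (ennreal (e1 y + e2 y + (e3 y + e4 y)) * F y)) \<partial>lborel)"
        unfolding G_def
      proof (rule nn_integral_mono)
        fix y
        have "norm (b0 x - b0 y) \<le> 1 / t * (e1 y + e2 y + (e3 y + e4 y))"
          using norm_le_sum_exp[OF t(1), of "b0 x - b0 y"] by (simp add: e1_def e2_def e3_def e4_def add.assoc)
        then have "ennreal (norm (b0 x - b0 y)) \<le> ennreal (1 / t) * ennreal (e1 y + e2 y + (e3 y + e4 y))"
          using t(1) by (subst ennreal_mult[symmetric]) (auto simp: e1_def e2_def e3_def e4_def add_nonneg_nonneg intro!: ennreal_leI)
        then have "ennreal (norm (k (x - y))) * (ennreal (norm (b0 x - b0 y)) * F y)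
          \<le> ennreal (norm (k (x - y))) * (ennreal (1 / t) * ennreal (e1 y + e2 y + (e3 y + e4 y)) * F y)"
          by (intro mult_left_mono mult_right_mono) auto
        then show "ennreal (norm (k (x - y))) * (ennreal (norm (b0 x - b0 y)) * F y)
          \<le> ennreal (1 / t) * (ennreal (norm (k (x - y))) * (ennreal (e1 y + e2 y + (e3 y + e4 y)) * F y))"
          by (simp only: mult_ac)
      qed
      also have "\<dots> = ennreal (1 / t) * J (\<lambda>y. e1 y + e2 y + (e3 y + e4 y))"
        unfolding J_def by (rule nn_integral_cmult) measurable
      finally show ?thesis unfolding sum .
    qed
    have G_bound: "bounded_by C G \<Lambda>"
    proof -
      have B12: "bounded_by (2 powr q * (C1 + C2)) (\<lambda>x. E1 x + E2 x) \<Lambda>"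
        unfolding E1_def E2_def using C1(1) C2(1) hyp by (intro bounded_add C1(2) C2(2) E_measurable) auto
      have B34: "bounded_by (2 powr q * (C3 + C4)) (\<lambda>x. E3 x + E4 x) \<Lambda>"
        unfolding E3_def E4_def using C3(1) C4(1) hyp by (intro bounded_add C3(2) C4(2) E_measurable) auto
      have em: "(\<lambda>x. E1 x + E2 x) \<in> borel_measurable borel" "(\<lambda>x. E3 x + E4 x) \<in> borel_measurable borel"
        by measurable
      have S: "bounded_by (2 powr q * (2 powr q * (C1 + C2) + 2 powr q * (C3 + C4))) (\<lambda>x. E1 x + E2 x + (E3 x + E4 x)) \<Lambda>"
        using C1(1) C2(1) C3(1) C4(1) by (intro bounded_add[OF B12 B34 _ _ em]) auto
      define S' where "S' = 2 powr q * (2 powr q * (C1 + C2) + 2 powr q * (C3 + C4))"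
      have S'0: "0 \<le> S'" using C1(1) C2(1) C3(1) C4(1) by (simp add: S'_def)
      have CS: "C = (1 / t) powr q * S'" by (simp add: C_def S'_def distrib_left)
      show ?thesis
        unfolding bounded_by_def
      proof (intro allI impI)
        fix z :: "real^'n" and r :: real assume r: "0 < r"
        have "(\<integral>\<^sup>+x\<in>ball z r. epow (G x) q * ennreal (u x) \<partial>lborel)
          \<le> (\<integral>\<^sup>+x. ennreal ((1 / t) powr q) * (epow (E1 x + E2 x + (E3 x + E4 x)) q * ennreal (u x) * indicator (ball z r) x) \<partial>lborel)"
        proof (rule nn_integral_mono)
          fix x
          have "epow (G x) q \<le> epow (ennreal (1 / t) * (E1 x + E2 x + (E3 x + E4 x))) q"
            by (intro epow_mono G_le q)
          also have "\<dots> = ennreal ((1 / t) powr q) * epow (E1 x + E2 x + (E3 x + E4 x)) q"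
            using q t(1) by (simp add: epow_mult epow_ennreal)
          finally have "epow (G x) q * (ennreal (u x) * indicator (ball z r) x)
             \<le> ennreal ((1 / t) powr q) * epow (E1 x + E2 x + (E3 x + E4 x)) q * (ennreal (u x) * indicator (ball z r) x)"
            by (rule mult_right_mono) simp
          then show "epow (G x) q * ennreal (u x) * indicator (ball z r) x
            \<le> ennreal ((1 / t) powr q) * (epow (E1 x + E2 x + (E3 x + E4 x)) q * ennreal (u x) * indicator (ball z r) x)"
            by (simp only: mult.assoc)
        qed
        also have "\<dots> = ennreal ((1 / t) powr q) * (\<integral>\<^sup>+x\<in>ball z r. epow (E1 x + E2 x + (E3 x + E4 x)) q * ennreal (u x) \<partial>lborel)"
          by (rule nn_integral_cmult) measurable
        also have "\<dots> \<le> ennreal ((1 / t) powr q) * ennreal (S' * \<Lambda> powr q * V z r powr (\<kappa> * q / p))"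
          using S r unfolding bounded_by_def S'_def by (intro mult_left_mono) auto
        also have "\<dots> = ennreal (C * \<Lambda> powr q * V z r powr (\<kappa> * q / p))"
          using S'0 by (simp add: CS mult.assoc flip: ennreal_mult)
        finally show "(\<integral>\<^sup>+x\<in>ball z r. epow (G x) q * ennreal (u x) \<partial>lborel)
          \<le> ennreal (C * \<Lambda> powr q * V z r powr (\<kappa> * q / p))" .
      qed
    qed
    have G_fin: "AE x in lborel. G x < top"
    proof (rule AE_finite_if_weighted_norm_finite[OF _ um u_pos])
      show "(\<integral>\<^sup>+x\<in>ball 0 r. epow (G x) q * ennreal (u x) \<partial>lborel) < top" if "0 < r" for r
        using G_bound that unfolding bounded_by_def by (meson ennreal_less_top le_less_trans)
    qed measurable
    have TF_fin: "AE x in lborel. T F x < top"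
    proof (rule AE_finite_if_weighted_norm_finite[OF _ um u_pos])
      have "E (\<lambda>x. Re (b0 x)) 0 F = T F" by (simp add: E_def fun_eq_iff)
      then have "bounded_by C0 (T F) \<Lambda>" using C0[OF hyp] by simp
      then show "(\<integral>\<^sup>+x\<in>ball 0 r. epow (T F x) q * ennreal (u x) \<partial>lborel) < top" if "0 < r" for r
        using that unfolding bounded_by_def by (meson ennreal_less_top le_less_trans)
    qed measurable

    \<comment> \<open>Pointwise identification of the integrals\<close>
    have rough_eq: "AE y in lborel. rough_integrand \<Omega> \<alpha> h x y = k y * h0 (x - y)"
      if "AE y in lborel. h y = h0 y" for h h0 x
      using AE_lborel_reflect[OF that, of x] \<Omega>\<Omega>0
      by eventually_elim (simp add: rough_integrand_def k_def)
    have frac_eq: "rough_frac_int \<Omega> \<alpha> h x = (LINT y|lborel. k y * h0 (x - y))"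
      if "AE y in lborel. h y = h0 y" and [measurable]: "h0 \<in> borel_measurable borel" for h h0 x
      unfolding rough_frac_int_def by (rule lebesgue_integral_borel_version(2)[OF _ rough_eq[OF that(1)]]) measurable
    have bff0: "AE y in lborel. b y * f y = b0 y * f0 y"
      using bb0 ff0 by eventually_elim simp
    have comm_eq: "AE y in lborel. commutator_integrand \<Omega> \<alpha> b f x y = k (x - y) * ((b0 x - b0 y) * f0 y)"
      if "b x = b0 x" for x
    proof -
      have "AE y in lborel. y \<noteq> x" by (rule AE_lborel_singleton)
      with AE_lborel_reflect[OF \<Omega>\<Omega>0, of x] bb0 ff0 show ?thesis
      proof eventually_elim
        fix y assume *: "\<Omega> ((x - y) /\<^sub>R norm (x - y)) = \<Omega>0 (x - y)" "b y = b0 y" "f y = f0 y" "y \<noteq> x"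
        \<comment> \<open>Homogeneity with the factor 1 / |x - y|: the commutator integrand
          evaluates \<Omega> at x - y, whereas the operator evaluates it at the normalised
          vector.\<close>
        have "\<Omega> ((x - y) /\<^sub>R norm (x - y)) = \<Omega> (x - y)"
          using assms(5) *(4) unfolding homogeneous_deg0_def by simp
        with * that show "commutator_integrand \<Omega> \<alpha> b f x y = k (x - y) * ((b0 x - b0 y) * f0 y)"
          by (simp add: commutator_integrand_def k_def)
      qed
    qed
    define H where "H = commutator b (rough_frac_int \<Omega> \<alpha>) f"
    have point: "integrable lebesgue (rough_integrand \<Omega> \<alpha> f x) \<and>
        integrable lebesgue (rough_integrand \<Omega> \<alpha> (\<lambda>y. b y * f y) x) \<and>
        integrable lebesgue (commutator_integrand \<Omega> \<alpha> b f x) \<and>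
        H x = (LINT y|lebesgue. commutator_integrand \<Omega> \<alpha> b f x y) \<and> ennreal (norm (H x)) \<le> G x"
      if bx: "b x = b0 x" and Gx: "G x < top" and Tx: "T F x < top" for x
    proof -
      define g1 where "g1 y = k y * f0 (x - y)" for y
      define g2 where "g2 y = k y * (b0 (x - y) * f0 (x - y))" for y
      define g3 where "g3 y = k (x - y) * ((b0 x - b0 y) * f0 y)" for y
      have [measurable]: "g1 \<in> borel_measurable borel" "g2 \<in> borel_measurable borel" "g3 \<in> borel_measurable borel"
        unfolding g1_def g2_def g3_def by measurable
      have "(\<integral>\<^sup>+y. ennreal (norm (g1 y)) \<partial>lborel) = T F x"
        unfolding T_def g1_def F_def
        by (intro nn_integral_cong) (simp add: norm_mult ennreal_mult k_norm[simplified])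
      then have i1: "integrable lborel g1" using Tx by (intro integrableI_bounded) auto
      have n3: "(\<integral>\<^sup>+y. ennreal (norm (g3 y)) \<partial>lborel) = G x"
        unfolding G_def g3_def F_def by (simp add: norm_mult ennreal_mult)
      then have i3: "integrable lborel g3" using Gx by (intro integrableI_bounded) auto
      have "(\<integral>\<^sup>+y. ennreal (norm (g3 (x - y))) \<partial>lborel) = G x"
        unfolding n3[symmetric] by (rule nn_integral_lborel_reflect) measurable
      then have i3': "integrable lborel (\<lambda>y. g3 (x - y))" using Gx by (intro integrableI_bounded) auto
      \<comment> \<open>Finiteness of \<open>T F\<close> does not control the integrand containing b
        f. Its integrability is deduced from that of the other two, with \<open>g3\<close> reflected
        to the variables of \<open>g1\<close>.\<close>
      have g2_eq: "g2 = (\<lambda>y. b0 x * g1 y - g3 (x - y))"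
        by (simp add: fun_eq_iff g1_def g2_def g3_def algebra_simps)
      have i2: "integrable lborel g2" unfolding g2_eq using i1 i3' by simp
      have "integral\<^sup>L lborel g2 = b0 x * integral\<^sup>L lborel g1 - integral\<^sup>L lborel g3"
        unfolding g2_eq using i1 i3' by (simp add: integral_lborel_reflect)
      moreover have "rough_frac_int \<Omega> \<alpha> f x = integral\<^sup>L lborel g1"
        unfolding g1_def by (rule frac_eq[OF ff0 f0])
      moreover have "rough_frac_int \<Omega> \<alpha> (\<lambda>y. b y * f y) x = integral\<^sup>L lborel g2"
        unfolding g2_def by (rule frac_eq[OF bff0]) measurable
      ultimately have H3: "H x = integral\<^sup>L lborel g3"
        by (simp add: H_def commutator_def bx)
      have "integrable lebesgue (rough_integrand \<Omega> \<alpha> f x)"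
        using lebesgue_integral_borel_version(1)[OF _ rough_eq[OF ff0, of x]] i1 unfolding g1_def by simp
      moreover have "integrable lebesgue (rough_integrand \<Omega> \<alpha> (\<lambda>y. b y * f y) x)"
        using lebesgue_integral_borel_version(1)[OF _ rough_eq[OF bff0, of x]] i2 unfolding g2_def by simp
      moreover have "integrable lebesgue (commutator_integrand \<Omega> \<alpha> b f x)"
        "(LINT y|lebesgue. commutator_integrand \<Omega> \<alpha> b f x y) = integral\<^sup>L lborel g3"
        using lebesgue_integral_borel_version[OF _ comm_eq[OF bx]] i3 unfolding g3_def by simp_all
      moreover have "ennreal (norm (H x)) \<le> G x"
        unfolding H3 n3[symmetric] by (rule integral_norm_bound_ennreal[OF i3])
      ultimately show ?thesis using H3 by simp
    qed
    have point_AE: "AE x in lborel. integrable lebesgue (rough_integrand \<Omega> \<alpha> f x) \<and>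
        integrable lebesgue (rough_integrand \<Omega> \<alpha> (\<lambda>y. b y * f y) x) \<and>
        integrable lebesgue (commutator_integrand \<Omega> \<alpha> b f x) \<and>
        H x = (LINT y|lebesgue. commutator_integrand \<Omega> \<alpha> b f x y) \<and> ennreal (norm (H x)) \<le> G x"
      using bb0 G_fin TF_fin by eventually_elim (rule point)
    show "AE x in lebesgue. integrable lebesgue (rough_integrand \<Omega> \<alpha> f x) \<and>
        integrable lebesgue (rough_integrand \<Omega> \<alpha> (\<lambda>y. b y * f y) x) \<and>
        integrable lebesgue (commutator_integrand \<Omega> \<alpha> b f x) \<and>
        commutator b (rough_frac_int \<Omega> \<alpha>) f x = (LINT y|lebesgue. commutator_integrand \<Omega> \<alpha> b f x y)"
      using AE_completion[OF point_AE] unfolding H_def by eventually_elim simp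

    \<comment> \<open>The Morrey norm of the commutator\<close>
    have H_int: "(\<integral>\<^sup>+x\<in>ball z r. ennreal (norm (H x) powr q * w x powr q) \<partial>lebesgue)
        \<le> ennreal (C * \<Lambda> powr q * V z r powr (\<kappa> * q / p))" if r: "0 < r" for z r
    proof -
      have "(\<integral>\<^sup>+x\<in>ball z r. ennreal (norm (H x) powr q * w x powr q) \<partial>lborel)
        \<le> (\<integral>\<^sup>+x\<in>ball z r. epow (G x) q * ennreal (u x) \<partial>lborel)"
      proof (rule nn_integral_mono_AE)
        show "AE x in lborel. ennreal (norm (H x) powr q * w x powr q) * indicator (ball z r) x
          \<le> epow (G x) q * ennreal (u x) * indicator (ball z r) x"
          using point_AE ww0
        proof eventually_elim
          fix x assume "integrable lebesgue (rough_integrand \<Omega> \<alpha> f x) \<and>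
            integrable lebesgue (rough_integrand \<Omega> \<alpha> (\<lambda>y. b y * f y) x) \<and>
            integrable lebesgue (commutator_integrand \<Omega> \<alpha> b f x) \<and>
            H x = (LINT y|lebesgue. commutator_integrand \<Omega> \<alpha> b f x y) \<and> ennreal (norm (H x)) \<le> G x"
            and wx: "w x = w0 x"
          then have "ennreal (norm (H x)) \<le> G x" by blast
          then have "epow (ennreal (norm (H x))) q \<le> epow (G x) q" by (rule epow_mono[OF _ q])
          then show "ennreal (norm (H x) powr q * w x powr q) * indicator (ball z r) x
            \<le> epow (G x) q * ennreal (u x) * indicator (ball z r) x"
            unfolding wx by (simp add: u_def epow_ennreal ennreal_mult mult_right_mono)
        qed
      qed
      also have "\<dots> \<le> ennreal (C * \<Lambda> powr q * V z r powr (\<kappa> * q / p))"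
        using G_bound r unfolding bounded_by_def by blast
      finally show ?thesis by (simp add: nn_integral_completion)
    qed
    have H_meas: "H \<in> borel_measurable lebesgue"
    proof -
      have [measurable]: "(\<lambda>x. LINT y|lborel. k y * f0 (x - y)) \<in> borel_measurable borel"
        "(\<lambda>x. LINT y|lborel. k y * (b0 (x - y) * f0 (x - y))) \<in> borel_measurable borel"
        by measurable
      have "H x = b x * (LINT y|lborel. k y * f0 (x - y)) - (LINT y|lborel. k y * (b0 (x - y) * f0 (x - y)))" for x
        unfolding H_def commutator_def using frac_eq[OF ff0 f0, of x] frac_eq[OF bff0, of x] by simp
      note H_eq = this
      have H: "AE x in lebesgue. b0 x * (LINT y|lborel. k y * f0 (x - y)) - (LINT y|lborel. k y * (b0 (x - y) * f0 (x - y))) = H x"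
        using AE_completion[OF bb0] by eventually_elim (simp add: H_eq)
      have "(\<lambda>x. b0 x * (LINT y|lborel. k y * f0 (x - y)) - (LINT y|lborel. k y * (b0 (x - y) * f0 (x - y)))) \<in> borel_measurable lborel"
        by measurable
      then show ?thesis
        by (intro borel_measurable_AE[OF measurable_completion H])
    qed
    have norm_le: "morrey_norm q (\<kappa> * q / p) (\<lambda>x. w x powr q) H \<le> ennreal (C powr (1 / q) * \<Lambda>)"
      unfolding morrey_norm2_def
    proof (rule SUP_least, clarify)
      fix z :: "real^'n" and r :: real assume "(0::real) < r"
      then have r: "0 < r" .
      define v where "v = V z r powr (\<kappa> * q / p)"
      have v: "0 < v" using V_pos[OF r, of z] by (simp add: v_def)
      have "(\<integral>\<^sup>+x\<in>ball z r. ennreal (norm (H x) powr q * w x powr q) \<partial>lebesgue) / epow (\<integral>\<^sup>+x\<in>ball z r. ennreal (w x powr q) \<partial>lebesgue) (\<kappa> * q / p)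
        \<le> ennreal (C * \<Lambda> powr q * v) / ennreal v"
        unfolding V_eq using H_int[OF r, of z] V_pos[OF r, of z]
        by (simp add: epow_ennreal v_def divide_right_mono_ennreal)
      also have "\<dots> = ennreal (C * \<Lambda> powr q)"
        using v C by (simp add: divide_ennreal)
      finally have "epow ((\<integral>\<^sup>+x\<in>ball z r. ennreal (norm (H x) powr q * w x powr q) \<partial>lebesgue) / epow (\<integral>\<^sup>+x\<in>ball z r. ennreal (w x powr q) \<partial>lebesgue) (\<kappa> * q / p)) (1 / q)
        \<le> epow (ennreal (C * \<Lambda> powr q)) (1 / q)"
        using q by (intro epow_mono) auto
      also have "\<dots> = ennreal (C powr (1 / q) * \<Lambda>)"
        using C q \<Lambda>(2) by (simp add: epow_ennreal powr_mult powr_powr)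
      finally show "epow ((\<integral>\<^sup>+x\<in>ball z r. ennreal (norm (H x) powr q * w x powr q) \<partial>lebesgue) / epow (\<integral>\<^sup>+x\<in>ball z r. ennreal (w x powr q) \<partial>lebesgue) (\<kappa> * q / p)) (1 / q)
        \<le> ennreal (C powr (1 / q) * \<Lambda>)" .
    qed
    then show "morrey_norm q (\<kappa> * q / p) (\<lambda>x. w x powr q) (commutator b (rough_frac_int \<Omega> \<alpha>) f)
       \<le> ennreal (C powr (1 / q)) * morrey_norm2 p \<kappa> (\<lambda>x. w x powr p) (\<lambda>x. w x powr q) f"
      unfolding H_def[symmetric] \<Lambda>(1) by (simp add: ennreal_mult \<Lambda>(2))
    have "(\<integral>\<^sup>+x\<in>L. ennreal (norm (H x) powr q * w x powr q) \<partial>lebesgue) < \<infinity>" if L: "compact L" for L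
    proof -
      \<comment> \<open>A compact set lies in one ball of positive radius, where the Morrey bound is
        finite; this gives membership in the local space.\<close>
      obtain R where "\<forall>x\<in>L. norm x \<le> R" using compact_imp_bounded[OF L] bounded_iff by blast
      then have "L \<subseteq> ball 0 (max R 0 + 1)" by force
      then have "(\<integral>\<^sup>+x\<in>L. ennreal (norm (H x) powr q * w x powr q) \<partial>lebesgue)
        \<le> (\<integral>\<^sup>+x\<in>ball 0 (max R 0 + 1). ennreal (norm (H x) powr q * w x powr q) \<partial>lebesgue)"
        by (intro nn_integral_mono) (auto simp: indicator_def)
      also have "\<dots> < \<infinity>"
        using le_less_trans[OF H_int[of "max R 0 + 1" 0] ennreal_less_top] by simp
      finally show ?thesis .
    qed
    then have "H \<in> Lp_loc q (\<lambda>x. w x powr q)"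
      using H_meas by (simp add: Lp_loc_def)
    then show "commutator b (rough_frac_int \<Omega> \<alpha>) f \<in> morrey q (\<kappa> * q / p) (\<lambda>x. w x powr q)"
      using le_less_trans[OF norm_le ennreal_less_top] unfolding morrey2_def H_def[symmetric] by simp
  qed
qed

end
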